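(* Assume $\mathbb{Q}\subseteq R$. Then the centre $Z(\mathbf{D}_{W_a})$ of the small torus formal affine Demazure algebra $\mathbf{D}_{W_a}$ generates the formal Peterson subalgebra $\mathbf{D}_{Q^\vee}$ as an $S$-module. Moreover, $Z(\mathbf{D}_{W_a})$ generates $\mathbf{D}_{W_a}$ as a $\mathbf{D}_W$-module.
   Context: $R$ is a commutative ring of characteristic $0$ and $F$ is a (one-dimensional commutative) formal group law over $R$ (that of an oriented cohomology theory with coefficient ring $R$). For a lattice $\Lambda$, $R[[\Lambda]]_F$ is the quotient of the power series ring $R[[x_\lambda\mid\lambda\in\Lambda]]$ by the closure of the ideal generated by $x_0$ and $x_{\lambda_1+\lambda_2}-F(x_{\lambda_1},x_{\lambda_2})$, $\lambda_1,\lambda_2\in\Lambda$. (In the case $F_\beta(x,y)=x+y-\beta xy$ over $R=\mathbb{Z}[\beta]$ one takes instead the quotient of the polynomial ring $R[x_\lambda\mid \lambda\in\Lambda]$ by the ideal generated by the same elements.) $\Phi$ is a finite irreducible root system with simple roots $I=\{\alpha_1,\dots,\alpha_n\}$, root lattice $Q$, coroot lattice $Q^\vee$, Weyl group $W$, highest root $\theta$. $W_a=Q^\vee\rtimes W$ is the affine Weyl group, with elements $t_\lambda w$ ($\lambda\in Q^\vee$, $w\in W$); $s_i=s_{\alpha_i}$ for $1\le i\le n$ and $s_0=t_{\theta^\vee}s_\theta$. $W_a$ acts on $Q$ through $W$ ($t_\lambda w(\mu)=w(\mu)$), hence on $S=R[[Q]]_F$. Each $x_\alpha$, $\alpha\in\Phi$,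 is assumed regular in $S$. $\mathcal{Q}=S[\tfrac1{x_\alpha}\mid\alpha\in\Phi]$. $\mathcal{Q}_{W_a}$ is the free left $\mathcal{Q}$-module with basis $\eta_u$, $u\in W_a$, with product $c\eta_u\cdot c'\eta_{u'}=c\,u(c')\eta_{uu'}$; $\mathcal{Q}_{Q^\vee}$ is the analogous (commutative) algebra with basis $\eta_{t_\lambda}$, $\lambda\in Q^\vee$. Let $\mathrm{pr}:\mathcal{Q}_{W_a}\to\mathcal{Q}_{Q^\vee}$, $c\eta_{t_\lambda w}\mapsto c\eta_{t_\lambda}$ ($w\in W$), and $\imath:\mathcal{Q}_{Q^\vee}\to\mathcal{Q}_{W_a}$, $c\eta_{t_\lambda}\mapsto c\eta_{t_\lambda}$. $X_i=\frac1{x_{\alpha_i}}(1-\eta_{s_i})$ for $1\le i\le n$ and $X_0=\frac1{x_{-\theta}}(1-\eta_{s_0})$. The small torus formal affine Demazure algebra $\mathbf{D}_{W_a}$ is the subring of $\mathcal{Q}_{W_a}$ generated by $S$ and $X_0,\dots,X_n$; $\mathbf{D}_W$ is the subring generated by $S$ and $X_1,\dots,X_n$. The formal Peterson subalgebra is $\mathbf{D}_{Q^\vee}=\imath(\mathrm{pr}(\mathbf{D}_{W_a}))$, which is known to be a subring of $\mathbf{D}_{W_a}$ when $\mathbb{Q}\subseteq R$, and to coincide with the centralizer of $S$ in $\mathbf{D}_{W_a}$. *)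

theory Defs
  imports
    "HOL-Analysis.Linear_Algebra"
    "HOL-Library.Multiset"
    "HOL-Algebra.QuotRing"
    "HOL-Algebra.Generated_Rings"
begin

section \<open>Power series rings and formal group laws\<close>

text \<open>
  Monomials in the variables indexed by \<open>V\<close> are the finite multisets over \<open>V\<close>, the size
  of the multiset being the degree. The set \<open>V\<close> may be infinite. The power series ring is the
  completion of the polynomial ring at the augmentation ideal, so each homogeneous component of a
  power series is required to be a polynomial, i.e. to have only finitely many nonzero
  coefficients. If \<open>V\<close> is finite this requirement is void.
\<close>

definition ps_ring :: "'x set \<Rightarrow> ('x multiset \<Rightarrow> 'r::comm_ring_1) ring" where
  "ps_ring V =
     \<lparr>carrier = {f. (\<forall>m. f m \<noteq> 0 \<longrightarrow> set_mset m \<subseteq> V) \<and> (\<forall>d. finite {m. size m = d \<and> f m \<noteq> 0})},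
      mult = (\<lambda>f g m. \<Sum>k\<in>{k. k \<subseteq># m}. f k * g (m - k)),
      one = (\<lambda>m. if m = {#} then 1 else 0),
      zero = (\<lambda>m. 0),
      add = (\<lambda>f g m. f m + g m)\<rparr>"

definition ps_var :: "'x \<Rightarrow> 'x multiset \<Rightarrow> 'r::comm_ring_1" where
  "ps_var x = (\<lambda>m. if m = {#x#} then 1 else 0)"

text \<open>Closure for the topology whose basic neighbourhoods of zero are the series of order \<open>\<ge> d\<close>.\<close>

definition ps_closure :: "'x set \<Rightarrow> ('x multiset \<Rightarrow> 'r::comm_ring_1) set \<Rightarrow> ('x multiset \<Rightarrow> 'r) set" where
  "ps_closure V J =
     {f \<in> carrier (ps_ring V). \<forall>d. \<exists>g\<in>J. \<forall>m. size m < d \<longrightarrow> f m = g m}"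

text \<open>
  A series \<open>F(x,y) = \<Sum> a\<^bsub>ij\<^esub> x\<^sup>i y\<^sup>j\<close> is given by its coefficients \<open>F i j = a\<^bsub>ij\<^esub>\<close>.
  The function below is the substitution \<open>F(f,g)\<close> for \<open>f\<close> and \<open>g\<close> without constant term:
  the terms with \<open>i + j > size m\<close> do not contribute to the coefficient of \<open>m\<close>.
\<close>

definition fgl_subst ::
    "'x set \<Rightarrow> (nat \<Rightarrow> nat \<Rightarrow> 'r::comm_ring_1) \<Rightarrow> ('x multiset \<Rightarrow> 'r) \<Rightarrow> ('x multiset \<Rightarrow> 'r) \<Rightarrow> 'x multiset \<Rightarrow> 'r"
  where
  "fgl_subst V F f g =
     (\<lambda>m. \<Sum>(i, j)\<in>{(i, j). i + j \<le> size m}.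
        F i j * (f [^]\<^bsub>ps_ring V\<^esub> i \<otimes>\<^bsub>ps_ring V\<^esub> g [^]\<^bsub>ps_ring V\<^esub> j) m)"

definition formal_group_law :: "(nat \<Rightarrow> nat \<Rightarrow> 'r::comm_ring_1) \<Rightarrow> bool" where
  "formal_group_law F \<longleftrightarrow>
     (let V = (UNIV :: nat set); x = ps_var 0; y = ps_var 1; z = ps_var 2; G = fgl_subst V F in
        G x \<zero>\<^bsub>ps_ring V\<^esub> = x \<and>
        G x y = G y x \<and>
        G (G x y) z = G x (G y z))"

definition contains_rationals :: "'r::comm_ring_1 itself \<Rightarrow> bool" where
  "contains_rationals _ \<longleftrightarrow>
     (\<exists>h :: rat \<Rightarrow> 'r. inj h \<and> h 1 = 1 \<and> (\<forall>p q. h (p + q) = h p + h q \<and> h (p * q) = h p * h q))"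


section \<open>Root systems and affine Weyl groups\<close>

text \<open>
  Coroots live in the same Euclidean space as roots, which is identified with its dual
  by means of the inner product.
\<close>

definition coroot :: "'v::euclidean_space \<Rightarrow> 'v" where
  "coroot \<alpha> = (2 / (\<alpha> \<bullet> \<alpha>)) *\<^sub>R \<alpha>"

definition reflection :: "'v::euclidean_space \<Rightarrow> 'v \<Rightarrow> 'v" where
  "reflection \<alpha> v = v - (v \<bullet> coroot \<alpha>) *\<^sub>R \<alpha>"

text \<open>Finite, crystallographic and reduced root systems.\<close>

definition root_system :: "'v::euclidean_space set \<Rightarrow> bool" where
  "root_system \<Phi> \<longleftrightarrow>
     finite \<Phi> \<and> span \<Phi> = UNIV \<and> 0 \<notin> \<Phi> \<and>
     (\<forall>\<alpha>\<in>\<Phi>. reflection \<alpha> ` \<Phi> = \<Phi>) \<and>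
     (\<forall>\<alpha>\<in>\<Phi>. \<forall>\<beta>\<in>\<Phi>. \<beta> \<bullet> coroot \<alpha> \<in> \<int>) \<and>
     (\<forall>\<alpha>\<in>\<Phi>. \<forall>c. c *\<^sub>R \<alpha> \<in> \<Phi> \<longrightarrow> c = 1 \<or> c = -1)"

definition irreducible_root_system :: "'v::euclidean_space set \<Rightarrow> bool" where
  "irreducible_root_system \<Phi> \<longleftrightarrow>
     root_system \<Phi> \<and> \<Phi> \<noteq> {} \<and>
     \<not> (\<exists>A B. A \<noteq> {} \<and> B \<noteq> {} \<and> A \<union> B = \<Phi> \<and> A \<inter> B = {} \<and> (\<forall>a\<in>A. \<forall>b\<in>B. a \<bullet> b = 0))"

definition int_lattice :: "'v::euclidean_space set \<Rightarrow> 'v set" where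
  "int_lattice X = range (\<lambda>c :: 'v \<Rightarrow> int. \<Sum>x\<in>X. of_int (c x) *\<^sub>R x)"

definition nat_cone :: "'v::euclidean_space set \<Rightarrow> 'v set" where
  "nat_cone X = range (\<lambda>c :: 'v \<Rightarrow> nat. \<Sum>x\<in>X. of_nat (c x) *\<^sub>R x)"

definition simple_roots :: "'v::euclidean_space set \<Rightarrow> 'v set \<Rightarrow> bool" where
  "simple_roots \<Phi> \<Delta> \<longleftrightarrow>
     \<Delta> \<subseteq> \<Phi> \<and> independent \<Delta> \<and> (\<forall>\<alpha>\<in>\<Phi>. \<alpha> \<in> nat_cone \<Delta> \<or> - \<alpha> \<in> nat_cone \<Delta>)"

definition highest_root :: "'v::euclidean_space set \<Rightarrow> 'v set \<Rightarrow> 'v \<Rightarrow> bool" where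
  "highest_root \<Phi> \<Delta> \<theta> \<longleftrightarrow> \<theta> \<in> \<Phi> \<and> (\<forall>\<alpha>\<in>\<Phi>. \<theta> - \<alpha> \<in> nat_cone \<Delta>)"

abbreviation root_lattice :: "'v::euclidean_space set \<Rightarrow> 'v set" where
  "root_lattice \<Phi> \<equiv> int_lattice \<Phi>"

abbreviation coroot_lattice :: "'v::euclidean_space set \<Rightarrow> 'v set" where
  "coroot_lattice \<Phi> \<equiv> int_lattice (coroot ` \<Phi>)"

inductive_set weyl_group :: "'v::euclidean_space set \<Rightarrow> ('v \<Rightarrow> 'v) set"
  for \<Phi> where
    id: "id \<in> weyl_group \<Phi>"
  | reflect: "\<alpha> \<in> \<Phi> \<Longrightarrow> w \<in> weyl_group \<Phi> \<Longrightarrow> reflection \<alpha> \<circ> w \<in> weyl_group \<Phi>"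

text \<open>The pair \<open>(\<mu>, w)\<close> stands for \<open>t\<^sub>\<mu> w\<close>.\<close>

definition affine_weyl_group :: "'v::euclidean_space set \<Rightarrow> ('v \<times> ('v \<Rightarrow> 'v)) monoid" where
  "affine_weyl_group \<Phi> =
     \<lparr>carrier = coroot_lattice \<Phi> \<times> weyl_group \<Phi>,
      mult = (\<lambda>(\<mu>, w1) (\<nu>, w2). (\<mu> + w1 \<nu>, w1 \<circ> w2)),
      one = (0, id)\<rparr>"


section \<open>Localization, twisted group algebras, generated modules, centre\<close>

inductive_set mult_closure :: "('a, 'b) ring_scheme \<Rightarrow> 'a set \<Rightarrow> 'a set"
  for A and X where
    one: "\<one>\<^bsub>A\<^esub> \<in> mult_closure A X"
  | mult: "x \<in> X \<Longrightarrow> m \<in> mult_closure A X \<Longrightarrow> x \<otimes>\<^bsub>A\<^esub> m \<in> mult_closure A X"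

definition frac_rel :: "('a, 'b) ring_scheme \<Rightarrow> 'a set \<Rightarrow> (('a \<times> 'a) \<times> ('a \<times> 'a)) set" where
  "frac_rel A M =
     {((a, s), (b, t)). a \<in> carrier A \<and> s \<in> M \<and> b \<in> carrier A \<and> t \<in> M \<and>
        (\<exists>u\<in>M. u \<otimes>\<^bsub>A\<^esub> (a \<otimes>\<^bsub>A\<^esub> t \<ominus>\<^bsub>A\<^esub> b \<otimes>\<^bsub>A\<^esub> s) = \<zero>\<^bsub>A\<^esub>)}"

definition loc_frac :: "('a, 'b) ring_scheme \<Rightarrow> 'a set \<Rightarrow> 'a \<Rightarrow> 'a \<Rightarrow> ('a \<times> 'a) set" where
  "loc_frac A M a s = frac_rel A M `` {(a, s)}"

definition localization :: "('a, 'b) ring_scheme \<Rightarrow> 'a set \<Rightarrow> ('a \<times> 'a) set ring" where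
  "localization A M =
     \<lparr>carrier = (carrier A \<times> M) // frac_rel A M,
      mult = (\<lambda>X Y. \<Union>(a, s)\<in>X. \<Union>(b, t)\<in>Y. loc_frac A M (a \<otimes>\<^bsub>A\<^esub> b) (s \<otimes>\<^bsub>A\<^esub> t)),
      one = loc_frac A M \<one>\<^bsub>A\<^esub> \<one>\<^bsub>A\<^esub>,
      zero = loc_frac A M \<zero>\<^bsub>A\<^esub> \<one>\<^bsub>A\<^esub>,
      add = (\<lambda>X Y. \<Union>(a, s)\<in>X. \<Union>(b, t)\<in>Y.
               loc_frac A M (a \<otimes>\<^bsub>A\<^esub> t \<oplus>\<^bsub>A\<^esub> b \<otimes>\<^bsub>A\<^esub> s) (s \<otimes>\<^bsub>A\<^esub> t))\<rparr>"

definition regular_elem :: "('a, 'b) ring_scheme \<Rightarrow> 'a \<Rightarrow> bool" where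
  "regular_elem A x \<longleftrightarrow> (\<forall>y\<in>carrier A. x \<otimes>\<^bsub>A\<^esub> y = \<zero>\<^bsub>A\<^esub> \<longrightarrow> y = \<zero>\<^bsub>A\<^esub>)"

text \<open>
  The free left \<open>A\<close>-module with basis \<open>\<eta>\<^sub>u\<close>, for \<open>u\<close> in the group \<open>G\<close> acting on \<open>A\<close>
  by \<open>act\<close>, and with product determined by \<open>(c \<eta>\<^sub>u)(c' \<eta>\<^sub>v) = c u(c') \<eta>\<^bsub>uv\<^esub>\<close>. An element
  is the finitely supported function of its coefficients; \<open>tw_elem A c u\<close> is \<open>c \<eta>\<^sub>u\<close>.
\<close>

definition tw_elem :: "('a, 'b) ring_scheme \<Rightarrow> 'a \<Rightarrow> 'g \<Rightarrow> 'g \<Rightarrow> 'a" where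
  "tw_elem A c u = (\<lambda>v. if v = u then c else \<zero>\<^bsub>A\<^esub>)"

definition twisted_group_algebra ::
    "('a, 'b) ring_scheme \<Rightarrow> ('g, 'c) monoid_scheme \<Rightarrow> ('g \<Rightarrow> 'a \<Rightarrow> 'a) \<Rightarrow> ('g \<Rightarrow> 'a) ring" where
  "twisted_group_algebra A G act =
     \<lparr>carrier = {f. (\<forall>u. f u \<in> carrier A) \<and> (\<forall>u. u \<notin> carrier G \<longrightarrow> f u = \<zero>\<^bsub>A\<^esub>) \<and>
                    finite {u. f u \<noteq> \<zero>\<^bsub>A\<^esub>}},
      mult = (\<lambda>f g w. finsum A (\<lambda>(u, v). f u \<otimes>\<^bsub>A\<^esub> act u (g v))
                 {(u, v). u \<in> carrier G \<and> v \<in> carrier G \<and>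
                    f u \<noteq> \<zero>\<^bsub>A\<^esub> \<and> g v \<noteq> \<zero>\<^bsub>A\<^esub> \<and> u \<otimes>\<^bsub>G\<^esub> v = w}),
      one = tw_elem A \<one>\<^bsub>A\<^esub> \<one>\<^bsub>G\<^esub>,
      zero = (\<lambda>u. \<zero>\<^bsub>A\<^esub>),
      add = (\<lambda>f g u. f u \<oplus>\<^bsub>A\<^esub> g u)\<rparr>"

text \<open>The left \<open>B\<close>-submodule of \<open>A\<close> generated by \<open>Z\<close>, for a subring \<open>B\<close> of \<open>A\<close>.\<close>

inductive_set module_span :: "('a, 'b) ring_scheme \<Rightarrow> 'a set \<Rightarrow> 'a set \<Rightarrow> 'a set"
  for A and B and Z where
    zero: "\<zero>\<^bsub>A\<^esub> \<in> module_span A B Z"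
  | incl: "z \<in> Z \<Longrightarrow> z \<in> module_span A B Z"
  | add: "x \<in> module_span A B Z \<Longrightarrow> y \<in> module_span A B Z \<Longrightarrow> x \<oplus>\<^bsub>A\<^esub> y \<in> module_span A B Z"
  | smult: "b \<in> B \<Longrightarrow> x \<in> module_span A B Z \<Longrightarrow> b \<otimes>\<^bsub>A\<^esub> x \<in> module_span A B Z"

definition centre :: "('a, 'b) ring_scheme \<Rightarrow> 'a set \<Rightarrow> 'a set" where
  "centre A D = {z \<in> D. \<forall>d\<in>D. z \<otimes>\<^bsub>A\<^esub> d = d \<otimes>\<^bsub>A\<^esub> z}"


section \<open>The formal group algebra of a lattice\<close>

definition fga_ideal :: "(nat \<Rightarrow> nat \<Rightarrow> 'r::comm_ring_1) \<Rightarrow> 'v::ab_group_add set \<Rightarrow> ('v multiset \<Rightarrow> 'r) set" where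
  "fga_ideal F \<Lambda> =
     ps_closure \<Lambda>
       (Idl\<^bsub>ps_ring \<Lambda>\<^esub> ({ps_var 0} \<union>
          {ps_var (\<mu> + \<nu>) \<ominus>\<^bsub>ps_ring \<Lambda>\<^esub> fgl_subst \<Lambda> F (ps_var \<mu>) (ps_var \<nu>) | \<mu> \<nu>.
             \<mu> \<in> \<Lambda> \<and> \<nu> \<in> \<Lambda>}))"

definition fga :: "(nat \<Rightarrow> nat \<Rightarrow> 'r::comm_ring_1) \<Rightarrow> 'v::ab_group_add set \<Rightarrow> ('v multiset \<Rightarrow> 'r) set ring" where
  "fga F \<Lambda> = ps_ring \<Lambda> Quot fga_ideal F \<Lambda>"

definition fga_var :: "(nat \<Rightarrow> nat \<Rightarrow> 'r::comm_ring_1) \<Rightarrow> 'v::ab_group_add set \<Rightarrow> 'v \<Rightarrow> ('v multiset \<Rightarrow> 'r) set" where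
  "fga_var F \<Lambda> \<mu> = fga_ideal F \<Lambda> +>\<^bsub>ps_ring \<Lambda>\<^esub> ps_var \<mu>"

text \<open>
  The action \<open>x\<^sub>\<lambda> \<mapsto> x\<^bsub>w(\<lambda>)\<^esub>\<close> of a linear bijection \<open>w\<close> preserving the lattice. On the
  quotient ring and on fractions the action is the image of classes of representatives.
\<close>

definition ps_act :: "('v \<Rightarrow> 'v) \<Rightarrow> ('v multiset \<Rightarrow> 'r) \<Rightarrow> 'v multiset \<Rightarrow> 'r" where
  "ps_act w f = (\<lambda>m. f (image_mset (inv_into UNIV w) m))"

definition fga_act :: "('v \<Rightarrow> 'v) \<Rightarrow> ('v multiset \<Rightarrow> 'r) set \<Rightarrow> ('v multiset \<Rightarrow> 'r) set" where
  "fga_act w c = ps_act w ` c"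

definition frac_act ::
    "('v \<Rightarrow> 'v) \<Rightarrow> (('v multiset \<Rightarrow> 'r) set \<times> ('v multiset \<Rightarrow> 'r) set) set \<Rightarrow>
     (('v multiset \<Rightarrow> 'r) set \<times> ('v multiset \<Rightarrow> 'r) set) set" where
  "frac_act w X = map_prod (fga_act w) (fga_act w) ` X"


section \<open>The small torus formal affine Demazure algebra\<close>

type_synonym ('v, 'r) root_frac = "(('v multiset \<Rightarrow> 'r) set \<times> ('v multiset \<Rightarrow> 'r) set) set"
type_synonym ('v, 'r) affine_tw = "'v \<times> ('v \<Rightarrow> 'v) \<Rightarrow> ('v, 'r) root_frac"

abbreviation S_ring :: "(nat \<Rightarrow> nat \<Rightarrow> 'r::comm_ring_1) \<Rightarrow> 'v::euclidean_space set \<Rightarrow> ('v multiset \<Rightarrow> 'r) set ring" where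
  "S_ring F \<Phi> \<equiv> fga F (root_lattice \<Phi>)"

abbreviation S_var :: "(nat \<Rightarrow> nat \<Rightarrow> 'r::comm_ring_1) \<Rightarrow> 'v::euclidean_space set \<Rightarrow> 'v \<Rightarrow> ('v multiset \<Rightarrow> 'r) set" where
  "S_var F \<Phi> \<mu> \<equiv> fga_var F (root_lattice \<Phi>) \<mu>"

definition root_denoms :: "(nat \<Rightarrow> nat \<Rightarrow> 'r::comm_ring_1) \<Rightarrow> 'v::euclidean_space set \<Rightarrow> ('v multiset \<Rightarrow> 'r) set set" where
  "root_denoms F \<Phi> = mult_closure (S_ring F \<Phi>) (S_var F \<Phi> ` \<Phi>)"

definition Q_ring :: "(nat \<Rightarrow> nat \<Rightarrow> 'r::comm_ring_1) \<Rightarrow> 'v::euclidean_space set \<Rightarrow> ('v, 'r) root_frac ring" where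
  "Q_ring F \<Phi> = localization (S_ring F \<Phi>) (root_denoms F \<Phi>)"

definition Q_frac ::
    "(nat \<Rightarrow> nat \<Rightarrow> 'r::comm_ring_1) \<Rightarrow> 'v::euclidean_space set \<Rightarrow>
     ('v multiset \<Rightarrow> 'r) set \<Rightarrow> ('v multiset \<Rightarrow> 'r) set \<Rightarrow> ('v, 'r) root_frac" where
  "Q_frac F \<Phi> = loc_frac (S_ring F \<Phi>) (root_denoms F \<Phi>)"

definition Q_Wa :: "(nat \<Rightarrow> nat \<Rightarrow> 'r::comm_ring_1) \<Rightarrow> 'v::euclidean_space set \<Rightarrow> ('v, 'r) affine_tw ring" where
  "Q_Wa F \<Phi> = twisted_group_algebra (Q_ring F \<Phi>) (affine_weyl_group \<Phi>) (\<lambda>(\<mu>, w). frac_act w)"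

definition S_in_Q_Wa :: "(nat \<Rightarrow> nat \<Rightarrow> 'r::comm_ring_1) \<Rightarrow> 'v::euclidean_space set \<Rightarrow> ('v, 'r) affine_tw set" where
  "S_in_Q_Wa F \<Phi> =
     (\<lambda>s. tw_elem (Q_ring F \<Phi>) (Q_frac F \<Phi> s \<one>\<^bsub>S_ring F \<Phi>\<^esub>) \<one>\<^bsub>affine_weyl_group \<Phi>\<^esub>) `
       carrier (S_ring F \<Phi>)"

text \<open>The element \<open>(1/x\<^sub>\<beta>) (1 - \<eta>\<^sub>u)\<close>.\<close>

definition demazure_elem ::
    "(nat \<Rightarrow> nat \<Rightarrow> 'r::comm_ring_1) \<Rightarrow> 'v::euclidean_space set \<Rightarrow> 'v \<Rightarrow> 'v \<times> ('v \<Rightarrow> 'v) \<Rightarrow> ('v, 'r) affine_tw" where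
  "demazure_elem F \<Phi> \<beta> u =
     tw_elem (Q_ring F \<Phi>) (Q_frac F \<Phi> \<one>\<^bsub>S_ring F \<Phi>\<^esub> (S_var F \<Phi> \<beta>)) \<one>\<^bsub>affine_weyl_group \<Phi>\<^esub>
       \<otimes>\<^bsub>Q_Wa F \<Phi>\<^esub> (\<one>\<^bsub>Q_Wa F \<Phi>\<^esub> \<ominus>\<^bsub>Q_Wa F \<Phi>\<^esub> tw_elem (Q_ring F \<Phi>) \<one>\<^bsub>Q_ring F \<Phi>\<^esub> u)"

definition X_simple :: "(nat \<Rightarrow> nat \<Rightarrow> 'r::comm_ring_1) \<Rightarrow> 'v::euclidean_space set \<Rightarrow> 'v \<Rightarrow> ('v, 'r) affine_tw" where
  "X_simple F \<Phi> \<alpha> = demazure_elem F \<Phi> \<alpha> (0, reflection \<alpha>)"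

definition X_affine :: "(nat \<Rightarrow> nat \<Rightarrow> 'r::comm_ring_1) \<Rightarrow> 'v::euclidean_space set \<Rightarrow> 'v \<Rightarrow> ('v, 'r) affine_tw" where
  "X_affine F \<Phi> \<theta> = demazure_elem F \<Phi> (- \<theta>) (coroot \<theta>, reflection \<theta>)"

definition D_W ::
    "(nat \<Rightarrow> nat \<Rightarrow> 'r::comm_ring_1) \<Rightarrow> 'v::euclidean_space set \<Rightarrow> 'v set \<Rightarrow> ('v, 'r) affine_tw set" where
  "D_W F \<Phi> \<Delta> = generate_ring (Q_Wa F \<Phi>) (S_in_Q_Wa F \<Phi> \<union> X_simple F \<Phi> ` \<Delta>)"

definition D_Wa ::
    "(nat \<Rightarrow> nat \<Rightarrow> 'r::comm_ring_1) \<Rightarrow> 'v::euclidean_space set \<Rightarrow> 'v set \<Rightarrow> 'v \<Rightarrow> ('v, 'r) affine_tw set" where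
  "D_Wa F \<Phi> \<Delta> \<theta> =
     generate_ring (Q_Wa F \<Phi>) (S_in_Q_Wa F \<Phi> \<union> insert (X_affine F \<Phi> \<theta>) (X_simple F \<Phi> ` \<Delta>))"

text \<open>
  Elements of the algebra with basis \<open>\<eta>\<close> indexed by the translations \<open>t\<^sub>\<lambda>\<close> are represented as
  functions of \<open>\<lambda>\<close>.
\<close>

definition pr_transl ::
    "(nat \<Rightarrow> nat \<Rightarrow> 'r::comm_ring_1) \<Rightarrow> 'v::euclidean_space set \<Rightarrow> ('v, 'r) affine_tw \<Rightarrow> 'v \<Rightarrow> ('v, 'r) root_frac" where
  "pr_transl F \<Phi> f = (\<lambda>\<mu>. \<Oplus>\<^bsub>Q_ring F \<Phi>\<^esub>w\<in>weyl_group \<Phi>. f (\<mu>, w))"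

definition incl_transl ::
    "(nat \<Rightarrow> nat \<Rightarrow> 'r::comm_ring_1) \<Rightarrow> 'v::euclidean_space set \<Rightarrow> ('v \<Rightarrow> ('v, 'r) root_frac) \<Rightarrow> ('v, 'r) affine_tw" where
  "incl_transl F \<Phi> g = (\<lambda>(\<mu>, w). if w = id then g \<mu> else \<zero>\<^bsub>Q_ring F \<Phi>\<^esub>)"

definition formal_peterson ::
    "(nat \<Rightarrow> nat \<Rightarrow> 'r::comm_ring_1) \<Rightarrow> 'v::euclidean_space set \<Rightarrow> 'v set \<Rightarrow> 'v \<Rightarrow> ('v, 'r) affine_tw set" where
  "formal_peterson F \<Phi> \<Delta> \<theta> = incl_transl F \<Phi> ` pr_transl F \<Phi> ` D_Wa F \<Phi> \<Delta> \<theta>"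

end

theory Submission
  imports Defs
begin

text \<open>
  Write \<open>K\<close> for the localization \<open>\<Q>\<close>. The map \<open>y\<^sub>l = \<Sum>\<^sub>\<beta> \<langle>l, \<beta>\<^sup>\<or>\<rangle> x\<^sub>\<beta>\<close> from the root lattice
  to \<open>S\<close> is additive and Weyl equivariant, and \<open>y\<^sub>\<alpha>\<close> is a unit multiple of \<open>x\<^sub>\<alpha>\<close> when the
  coefficients contain the rationals; it serves as a substitute for the formal logarithm. The divided
  differences \<open>\<partial>\<^sub>\<alpha> = (1 - \<eta>\<^sub>s) / y\<^sub>\<alpha>\<close>, for \<open>s\<close> the reflection in a root \<open>\<alpha>\<close>, lie in \<open>D\<^sub>W\<close> and satisfy
  \<open>\<partial>\<^sub>\<alpha> y\<^sub>l = \<langle>l, \<alpha>\<^sup>\<or>\<rangle> + y\<^bsub>s(l)\<^esub> \<partial>\<^sub>\<alpha>\<close>. They kill \<open>E = \<Sum>\<^sub>w \<eta>\<^sub>w\<close> from the left, so any \<open>n + 1\<close>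
  of them kill \<open>f E\<close> for \<open>f\<close> a product of \<open>n\<close> elements \<open>y\<^sub>l\<close>. By Lagrange interpolation \<open>1\<close> is a
  combination of elements \<open>f E c\<close> with \<open>f\<close> of degree less than \<open>|W|\<close>, hence every product of \<open>|W|\<close>
  divided differences vanishes.

  Let \<open>p = \<imath> \<circ> pr\<close>. For \<open>h \<in> D\<^bsub>Wa\<^esub>\<close> the element \<open>p(E h)\<close> is central, and
  \<open>|W| h = E h + \<Sum>\<^sub>w (1 - \<eta>\<^sub>w) h\<close>, where each \<open>1 - \<eta>\<^sub>w\<close> is a sum of terms \<open>y\<^sub>\<beta> \<partial>\<^sub>\<beta> \<eta>\<^sub>v\<close>. Iterating
  until the products of divided differences vanish writes \<open>p(h)\<close> as an \<open>S\<close>-combination of central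
  elements. For the second claim, \<open>X\<^sub>0 = p(X\<^sub>0) + \<eta>\<^sub>t X\<^bsub>-\<theta>\<^esub>\<close>, where \<open>t\<close> is the translation by the
  coroot of \<open>\<theta>\<close>.
\<close>

section \<open>Power series rings\<close>

text \<open>Interpolation divides by differences \<open>y_l - y_(v l)\<close>. Such a difference is
  \<open>y\<close> at the lattice vector \<open>l - v l\<close>, whereas the localization only
  inverts classes of roots. So each \<open>v \<noteq> id\<close> in \<open>W\<close> needs its own
  \<open>l\<close> with \<open>l - v l\<close> a positive integer multiple of a root; the material
  on Weyl groups serves this, through the fact that only the identity fixes a regular vector. The
  divided differences that occur belong to arbitrary roots, not only to simple ones, so a bound by
  word length is not at hand and interpolation takes its place. Rational coefficients enter three
  times: to show that \<open>y_alpha\<close> is a unit multiple of \<open>x_alpha\<close> (one half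
  and the inverse of a positive integer), to invert the multiple of the root in
  \<open>l - v l\<close>, and to divide by \<open>|W|\<close>. The map \<open>p\<close> turns left
  multiplication by \<open>eta_w\<close> into conjugation by \<open>eta_w\<close>, and
  \<open>E\<close> absorbs \<open>eta_w\<close> from the left; this is why \<open>p (E h)\<close> is
  central. Conversely, central elements are supported on translations because the orbit of the
  coroot of \<theta> spans, and here irreducibility is used.\<close>

lemma finite_submultisets: "finite {k. k \<subseteq># m}"
proof (induction m)
  case (add x m)
  have "{k. k \<subseteq># add_mset x m} \<subseteq> {k. k \<subseteq># m} \<union> add_mset x ` {k. k \<subseteq># m}"
  proof
    fix k assume "k \<in> {k. k \<subseteq># add_mset x m}"
    hence k: "k \<subseteq># add_mset x m" by simp
    show "k \<in> {k. k \<subseteq># m} \<union> add_mset x ` {k. k \<subseteq># m}"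
    proof (cases "x \<in># k")
      case True
      then obtain l where "k = add_mset x l" by (metis mset_add)
      thus ?thesis using k by auto
    next
      case False
      hence "k \<subseteq># m" using k
        by (metis diff_single_trivial subset_eq_diff_conv add_mset_add_single)
      thus ?thesis by simp
    qed
  qed
  thus ?case using add.IH finite_subset by blast
qed simp

definition ps_conv :: "('x multiset \<Rightarrow> 'r::comm_ring_1) \<Rightarrow> ('x multiset \<Rightarrow> 'r) \<Rightarrow> 'x multiset \<Rightarrow> 'r" where
  "ps_conv f g = (\<lambda>m. \<Sum>k\<in>{k. k \<subseteq># m}. f k * g (m - k))"

definition ps_const :: "'r::comm_ring_1 \<Rightarrow> 'x multiset \<Rightarrow> 'r" where
  "ps_const c = (\<lambda>m. if m = {#} then c else 0)"

lemma ps_ring_simps: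
  "mult (ps_ring V) = ps_conv"
  "one (ps_ring V) = ps_const 1"
  "zero (ps_ring V) = (\<lambda>m. 0)"
  "add (ps_ring V) = (\<lambda>f g m. f m + g m)"
  by (auto simp: ps_ring_def ps_conv_def ps_const_def fun_eq_iff)

lemma ps_carrier_iff:
  "f \<in> carrier (ps_ring V) \<longleftrightarrow>
     (\<forall>m. f m \<noteq> 0 \<longrightarrow> set_mset m \<subseteq> V) \<and> (\<forall>d. finite {m. size m = d \<and> f m \<noteq> 0})"
  by (auto simp: ps_ring_def)

lemma ps_conv_comm: "ps_conv f g = ps_conv g f"
proof
  fix m
  show "ps_conv f g m = ps_conv g f m"
    unfolding ps_conv_def
    by (rule sum.reindex_bij_witness[of _ "\<lambda>k. m - k" "\<lambda>k. m - k"])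
      (auto simp: mult.commute double_diff subset_mset.diff_diff_right)
qed

lemma ps_conv_assoc: "ps_conv (ps_conv f g) h = ps_conv f (ps_conv g h)"
proof
  fix m
  have "ps_conv (ps_conv f g) h m =
      (\<Sum>k\<in>{k. k \<subseteq># m}. \<Sum>l\<in>{l. l \<subseteq># k}. f l * g (k - l) * h (m - k))"
    unfolding ps_conv_def by (simp add: sum_distrib_right)
  also have "\<dots> = (\<Sum>(k, l)\<in>(SIGMA k:{k. k \<subseteq># m}. {l. l \<subseteq># k}). f l * g (k - l) * h (m - k))"
    by (rule sum.Sigma) (auto simp: finite_submultisets)
  \<comment> \<open>Both sides run over ordered splittings of \<open>m\<close> into three parts:
    \<open>k\<close> is the sum of the first two parts, \<open>l\<close> the first and
    \<open>j\<close> the second.\<close>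
  also have "\<dots> = (\<Sum>(l, j)\<in>(SIGMA l:{l. l \<subseteq># m}. {j. j \<subseteq># m - l}). f l * (g j * h (m - l - j)))"
  proof (rule sum.reindex_bij_witness[of _ "\<lambda>(l, j). (l + j, l)" "\<lambda>(k, l). (l, k - l)"])
    fix a assume "a \<in> (SIGMA k:{k. k \<subseteq># m}. {l. l \<subseteq># k})"
    then obtain k l where a: "a = (k, l)" "k \<subseteq># m" "l \<subseteq># k" by auto
    have "l \<subseteq># m" using a by (meson subset_mset.order_trans)
    moreover have "k - l \<subseteq># m - l" using a by (simp add: subseteq_mset_def diff_le_mono)
    ultimately show "(case a of (k, l) \<Rightarrow> (l, k - l)) \<in> (SIGMA l:{l. l \<subseteq># m}. {j. j \<subseteq># m - l})"
      using a by auto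
    show "(case case a of (k, l) \<Rightarrow> (l, k - l) of (l, j) \<Rightarrow> (l + j, l)) = a"
      using a by auto
    have "m - l - (k - l) = m - k" using a
      by (metis diff_diff_add_mset subset_mset.add_diff_inverse)
    then show "(case case a of (k, l) \<Rightarrow> (l, k - l) of (l, j) \<Rightarrow> f l * (g j * h (m - l - j))) =
       (case a of (k, l) \<Rightarrow> f l * g (k - l) * h (m - k))"
      using a by (auto simp: mult.assoc)
  next
    fix b assume "b \<in> (SIGMA l:{l. l \<subseteq># m}. {j. j \<subseteq># m - l})"
    then obtain l j where b: "b = (l, j)" "l \<subseteq># m" "j \<subseteq># m - l" by auto
    have "l + j \<subseteq># m" using b
      by (metis add.commute subset_mset.le_diff_conv2)
    thus "(case b of (l, j) \<Rightarrow> (l + j, l)) \<in> (SIGMA k:{k. k \<subseteq># m}. {l. l \<subseteq># k})"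
      using b by auto
    show "(case case b of (l, j) \<Rightarrow> (l + j, l) of (k, l) \<Rightarrow> (l, k - l)) = b"
      using b by auto
  qed
  also have "\<dots> = (\<Sum>l\<in>{l. l \<subseteq># m}. \<Sum>j\<in>{j. j \<subseteq># m - l}. f l * (g j * h (m - l - j)))"
    by (rule sum.Sigma[symmetric]) (auto simp: finite_submultisets)
  also have "\<dots> = ps_conv f (ps_conv g h) m"
    unfolding ps_conv_def by (simp add: sum_distrib_left)
  finally show "ps_conv (ps_conv f g) h m = ps_conv f (ps_conv g h) m" .
qed

lemma ps_conv_const_left: "ps_conv (ps_const c) f = (\<lambda>m. c * f m)"
proof
  fix m
  have "ps_conv (ps_const c) f m = (\<Sum>k\<in>{k. k \<subseteq># m}. if k = {#} then c * f m else 0)"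
    unfolding ps_conv_def ps_const_def by (rule sum.cong) auto
  also have "\<dots> = c * f m" by (simp add: finite_submultisets)
  finally show "ps_conv (ps_const c) f m = c * f m" .
qed

lemma ps_conv_var_left: "ps_conv (ps_var x) f = (\<lambda>m. if x \<in># m then f (m - {#x#}) else 0)"
proof
  fix m
  have "ps_conv (ps_var x) f m = (\<Sum>k\<in>{k. k \<subseteq># m}. if k = {#x#} then f (m - {#x#}) else 0)"
    unfolding ps_conv_def ps_var_def by (rule sum.cong) auto
  also have "\<dots> = (if x \<in># m then f (m - {#x#}) else 0)"
    by (simp add: finite_submultisets)
  finally show "ps_conv (ps_var x) f m = (if x \<in># m then f (m - {#x#}) else 0)" .
qed

lemma ps_conv_add_left: "ps_conv (\<lambda>m. f m + g m) h = (\<lambda>m. ps_conv f h m + ps_conv g h m)"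
  by (auto simp: ps_conv_def distrib_right sum.distrib)

lemma ps_conv_empty: "ps_conv f g {#} = f {#} * g {#}"
  by (simp add: ps_conv_def)

text \<open>A monomial of degree \<open>d\<close> in the support of the product is a sum of two
  support monomials of degree at most \<open>d\<close>, and each factor has only finitely many of
  those. Since the variables may be infinite in number, this bound is what keeps homogeneous
  components polynomial.\<close>

lemma ps_conv_closed:
  assumes "f \<in> carrier (ps_ring V)" "g \<in> carrier (ps_ring V)"
  shows "ps_conv f g \<in> carrier (ps_ring V)"
proof -
  have ne: "\<exists>k. k \<subseteq># m \<and> f k \<noteq> 0 \<and> g (m - k) \<noteq> 0" if "ps_conv f g m \<noteq> 0" for m
  proof (rule ccontr)
    assume "\<not> ?thesis"
    hence "ps_conv f g m = 0" unfolding ps_conv_def by (intro sum.neutral) auto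
    thus False using that by simp
  qed
  have "set_mset m \<subseteq> V" if "ps_conv f g m \<noteq> 0" for m
  proof -
    from ne[OF that] obtain k where k: "k \<subseteq># m" "f k \<noteq> 0" "g (m - k) \<noteq> 0" by blast
    have "m = k + (m - k)" using k(1) by simp
    moreover have "set_mset k \<subseteq> V" "set_mset (m - k) \<subseteq> V" using k assms by (auto simp: ps_carrier_iff)
    ultimately show ?thesis by (metis set_mset_union Un_least)
  qed
  moreover have "finite {m. size m = d \<and> ps_conv f g m \<noteq> 0}" for d
  proof -
    let ?A = "\<lambda>f. \<Union>i\<le>d. {m. size m = i \<and> f m \<noteq> (0::'b)}"
    have "finite (?A f)" "finite (?A g)" using assms by (auto simp: ps_carrier_iff)
    hence "finite ((\<lambda>(a, b). a + b) ` (?A f \<times> ?A g))" by blast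
    moreover have "{m. size m = d \<and> ps_conv f g m \<noteq> 0} \<subseteq> (\<lambda>(a, b). a + b) ` (?A f \<times> ?A g)"
    proof
      fix m assume "m \<in> {m. size m = d \<and> ps_conv f g m \<noteq> 0}"
      then obtain k where k: "k \<subseteq># m" "f k \<noteq> 0" "g (m - k) \<noteq> 0" "size m = d" using ne by blast
      have "size k \<le> d" "size (m - k) \<le> d"
        using k size_mset_mono[OF k(1)] size_mset_mono[of "m - k" m] by auto
      hence "(k, m - k) \<in> ?A f \<times> ?A g" using k by auto
      moreover have "m = (\<lambda>(a, b). a + b) (k, m - k)" using k(1) by simp
      ultimately show "m \<in> (\<lambda>(a, b). a + b) ` (?A f \<times> ?A g)" by (rule rev_image_eqI)
    qed
    ultimately show ?thesis using finite_subset by blast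
  qed
  ultimately show ?thesis by (auto simp: ps_carrier_iff)
qed

lemma ps_add_closed:
  assumes "f \<in> carrier (ps_ring V)" "g \<in> carrier (ps_ring V)"
  shows "(\<lambda>m. f m + g m) \<in> carrier (ps_ring V)"
proof -
  have "finite {m. size m = d \<and> f m + g m \<noteq> 0}" for d
  proof (rule finite_subset)
    show "finite ({m. size m = d \<and> f m \<noteq> 0} \<union> {m. size m = d \<and> g m \<noteq> 0})"
      using assms by (auto simp: ps_carrier_iff)
  qed auto
  moreover have "set_mset m \<subseteq> V" if "f m + g m \<noteq> 0" for m
    using assms that by (cases "f m = 0") (auto simp: ps_carrier_iff)
  ultimately show ?thesis by (auto simp: ps_carrier_iff)
qed

lemma ps_uminus_closed: "f \<in> carrier (ps_ring V) \<Longrightarrow> (\<lambda>m. - f m) \<in> carrier (ps_ring V)"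
  by (auto simp: ps_carrier_iff)

lemma ps_const_closed: "ps_const c \<in> carrier (ps_ring V)"
proof -
  have "finite {m. size m = d \<and> ps_const c m \<noteq> 0}" for d
    by (rule finite_subset[of _ "{{#}}"]) (auto simp: ps_const_def)
  thus ?thesis by (auto simp: ps_carrier_iff ps_const_def)
qed

lemma ps_var_closed: "x \<in> V \<Longrightarrow> ps_var x \<in> carrier (ps_ring V)"
proof -
  have "finite {m. size m = d \<and> ps_var x m \<noteq> 0}" for d
    by (rule finite_subset[of _ "{{#x#}}"]) (auto simp: ps_var_def)
  thus "x \<in> V \<Longrightarrow> ps_var x \<in> carrier (ps_ring V)" by (auto simp: ps_carrier_iff ps_var_def)
qed

lemma ps_zero_closed: "(\<lambda>m. 0) \<in> carrier (ps_ring V)"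
  by (auto simp: ps_carrier_iff)

lemma ps_cring: "cring (ps_ring V)"
proof (rule cringI)
  show "abelian_group (ps_ring V)"
  proof (rule abelian_groupI)
    fix f assume "f \<in> carrier (ps_ring V)"
    thus "\<exists>y\<in>carrier (ps_ring V). y \<oplus>\<^bsub>ps_ring V\<^esub> f = \<zero>\<^bsub>ps_ring V\<^esub>"
      by (intro bexI[of _ "\<lambda>m. - f m"]) (auto simp: ps_ring_simps ps_uminus_closed)
  qed (auto simp: ps_ring_simps ps_add_closed ps_zero_closed add.assoc add.commute)
  show "comm_monoid (ps_ring V)"
    by (rule comm_monoidI)
      (auto simp: ps_ring_simps ps_conv_closed ps_const_closed ps_conv_assoc ps_conv_const_left
        intro: ps_conv_comm)
qed (auto simp: ps_ring_simps ps_conv_add_left)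

interpretation ps: cring "ps_ring V" for V
  by (rule ps_cring)

lemma ps_a_inv:
  assumes "f \<in> carrier (ps_ring V)" shows "\<ominus>\<^bsub>ps_ring V\<^esub> f = (\<lambda>m. - f m)"
  by (rule ps.minus_equality) (auto simp: ps_ring_simps assms ps_uminus_closed)

lemma ps_minus:
  assumes "f \<in> carrier (ps_ring V)" "g \<in> carrier (ps_ring V)"
  shows "f \<ominus>\<^bsub>ps_ring V\<^esub> g = (\<lambda>m. f m - g m)"
  using assms by (simp add: ps.minus_eq ps_a_inv ps_ring_simps)

lemma ps_conv_sum_left:
  "ps_conv (\<lambda>m. \<Sum>a\<in>A. f a m) g m = (\<Sum>a\<in>A. ps_conv (f a) g m)"
  unfolding ps_conv_def by (simp add: sum_distrib_right) (rule sum.swap)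

section \<open>Order of vanishing and invertible power series\<close>

lemma ps_order_conv:
  assumes "\<And>m. size m < i \<Longrightarrow> f m = 0" "\<And>m. size m < j \<Longrightarrow> g m = 0" "size m < i + j"
  shows "ps_conv f g m = 0"
  unfolding ps_conv_def
proof (rule sum.neutral, safe)
  fix k assume "k \<subseteq># m"
  hence "size m = size k + size (m - k)" by (metis size_union subset_mset.add_diff_inverse)
  hence "size k < i \<or> size (m - k) < j" using assms(3) by linarith
  thus "f k * g (m - k) = 0" using assms by auto
qed

lemma ps_order_pow:
  assumes "f {#} = 0" "size m < i" shows "(f [^]\<^bsub>ps_ring V\<^esub> i) m = 0"
  using assms(2)
proof (induction i arbitrary: m)
  case (Suc i)
  have "ps_conv (f [^]\<^bsub>ps_ring V\<^esub> i) f m = 0"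
    by (rule ps_order_conv[of i _ 1]) (use Suc assms in auto)
  thus ?case by (simp add: ps_ring_simps)
qed simp

lemma ps_const_conv_const: "ps_conv (ps_const a) (ps_const b) = ps_const (a * b)"
  unfolding ps_conv_const_left by (auto simp: ps_const_def)

text \<open>With \<open>h = 1 - c f\<close>, a series without constant term, the inverse of
  \<open>c f\<close> is the geometric series in \<open>h\<close>.\<close>

lemma ps_Units:
  fixes f :: "'x multiset \<Rightarrow> 'r::comm_ring_1"
  assumes f: "f \<in> carrier (ps_ring V)" and c: "f {#} * c = 1"
  shows "f \<in> Units (ps_ring V)"
proof -
  let ?P = "ps_ring V :: ('x multiset \<Rightarrow> 'r) ring"
  define h where "h = (\<lambda>m. ps_const 1 m - c * f m)"
  have cf: "ps_conv (ps_const c) f \<in> carrier ?P" by (intro ps_conv_closed f ps_const_closed)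
  have h_eq: "h = ps_const 1 \<ominus>\<^bsub>?P\<^esub> ps_conv (ps_const c) f"
    unfolding h_def by (subst ps_minus[OF ps_const_closed cf]) (simp add: ps_conv_const_left)
  have hc: "h \<in> carrier ?P"
    unfolding h_eq by (intro ps.minus_closed cf ps_const_closed)
  have h0: "h {#} = 0" using c by (simp add: h_def ps_const_def mult.commute)
  \<comment> \<open>\<open>h ^ k\<close> has order at least \<open>k\<close>, so cutting the
    geometric series off at the degree of the monomial loses nothing.\<close>
  define g where "g = (\<lambda>m. \<Sum>k\<le>size m. (h [^]\<^bsub>?P\<^esub> k) m)"
  have hk: "h [^]\<^bsub>?P\<^esub> k \<in> carrier ?P" for k :: nat using hc by (rule ps.nat_pow_closed)
  have g_ext: "g m = (\<Sum>k\<le>n. (h [^]\<^bsub>?P\<^esub> k) m)" if "size m \<le> n" for m n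
    unfolding g_def using that by (intro sum.mono_neutral_left) (auto intro!: ps_order_pow h0)
  have gc: "g \<in> carrier ?P"
  proof -
    have ne: "\<exists>k\<le>size m. (h [^]\<^bsub>?P\<^esub> k) m \<noteq> 0" if "g m \<noteq> 0" for m
    proof (rule ccontr)
      assume "\<not> ?thesis"
      hence "g m = 0" unfolding g_def by (intro sum.neutral) simp
      thus False using that by simp
    qed
    have "set_mset m \<subseteq> V" if g: "g m \<noteq> 0" for m
    proof -
      from ne[OF g] obtain k :: nat where "(h [^]\<^bsub>?P\<^esub> k) m \<noteq> 0" by blast
      thus ?thesis using hk[of k] by (simp add: ps_carrier_iff)
    qed
    moreover have "finite {m. size m = d \<and> g m \<noteq> 0}" for d
    proof -
      have "finite (\<Union>k\<le>d. {m. size m = d \<and> (h [^]\<^bsub>?P\<^esub> k) m \<noteq> 0})"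
        using hk by (auto simp: ps_carrier_iff)
      moreover have "{m. size m = d \<and> g m \<noteq> 0} \<subseteq> (\<Union>k\<le>d. {m. size m = d \<and> (h [^]\<^bsub>?P\<^esub> k) m \<noteq> 0})"
        using ne by auto
      ultimately show ?thesis using finite_subset by blast
    qed
    ultimately show ?thesis by (auto simp: ps_carrier_iff)
  qed
  have "ps_conv g (ps_conv (ps_const c) f) = ps_const 1"
  proof
    fix m :: "'x multiset"
    have cf_eq: "ps_conv (ps_const c) f = (\<lambda>m. ps_const 1 m + - h m)"
      by (simp add: h_def ps_conv_const_left)
    let ?n = "size m"
    \<comment> \<open>The coefficient at \<open>m\<close> only sees degrees up to
      \<open>size m\<close>, so one fixed truncation of \<open>g\<close> serves every summand; the
      product with \<open>1 - h\<close> then telescopes.\<close>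
    have "ps_conv g (ps_conv (ps_const c) f) m =
        ps_conv (\<lambda>m. \<Sum>k\<le>?n. (h [^]\<^bsub>?P\<^esub> k) m) (ps_conv (ps_const c) f) m"
      unfolding ps_conv_def[of g] ps_conv_def[of "\<lambda>m. \<Sum>k\<le>?n. (h [^]\<^bsub>?P\<^esub> k) m"]
    proof (rule sum.cong[OF refl])
      fix k assume "k \<in> {k. k \<subseteq># m}"
      hence "size k \<le> ?n" by (simp add: size_mset_mono)
      thus "g k * ps_conv (ps_const c) f (m - k) =
          (\<Sum>j\<le>?n. (h [^]\<^bsub>?P\<^esub> j) k) * ps_conv (ps_const c) f (m - k)"
        by (simp only: g_ext)
    qed
    also have "\<dots> = (\<Sum>k\<le>?n. ps_conv (h [^]\<^bsub>?P\<^esub> k) (ps_conv (ps_const c) f) m)"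
      by (rule ps_conv_sum_left)
    also have "\<dots> = (\<Sum>k\<le>?n. (h [^]\<^bsub>?P\<^esub> k) m - (h [^]\<^bsub>?P\<^esub> Suc k) m)"
    proof (rule sum.cong[OF refl])
      fix k :: nat
      have "ps_conv (h [^]\<^bsub>?P\<^esub> k) (ps_conv (ps_const c) f) =
         h [^]\<^bsub>?P\<^esub> k \<otimes>\<^bsub>?P\<^esub> (\<one>\<^bsub>?P\<^esub> \<ominus>\<^bsub>?P\<^esub> h)"
        unfolding ps_minus[OF ps.one_closed hc] by (simp add: ps_ring_simps cf_eq)
      also have "\<dots> = h [^]\<^bsub>?P\<^esub> k \<ominus>\<^bsub>?P\<^esub> h [^]\<^bsub>?P\<^esub> Suc k"
        using hk[of k] hc by (simp add: ps.minus_eq ps.r_distr ps.r_minus)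
      finally show "ps_conv (h [^]\<^bsub>?P\<^esub> k) (ps_conv (ps_const c) f) m
          = (h [^]\<^bsub>?P\<^esub> k) m - (h [^]\<^bsub>?P\<^esub> Suc k) m"
        unfolding ps_minus[OF hk hk] by simp
    qed
    also have "\<dots> = (h [^]\<^bsub>?P\<^esub> (0::nat)) m - (h [^]\<^bsub>?P\<^esub> Suc ?n) m"
      by (rule sum_telescope)
    also have "(h [^]\<^bsub>?P\<^esub> Suc ?n) m = 0" by (rule ps_order_pow) (use h0 in auto)
    finally show "ps_conv g (ps_conv (ps_const c) f) m = ps_const 1 m"
      by (simp add: ps_ring_simps)
  qed
  hence "ps_conv g (ps_const c) \<otimes>\<^bsub>?P\<^esub> f = \<one>\<^bsub>?P\<^esub>"
    by (simp add: ps_ring_simps ps_conv_assoc)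
  moreover have "ps_conv g (ps_const c) \<in> carrier ?P" by (intro ps_conv_closed gc ps_const_closed)
  ultimately show ?thesis using f ps.m_comm[OF f, of "ps_conv g (ps_const c)"]
    unfolding Units_def by auto
qed

section \<open>Linear substitutions on power series\<close>

lemma ps_act_bij:
  assumes "bij w" shows "ps_act w f (image_mset w m) = f m"
proof -
  have "image_mset (inv_into UNIV w) (image_mset w m) = m"
    using assms by (simp add: image_mset.compositionality comp_def bij_is_inj inv_f_f)
  thus ?thesis by (simp add: ps_act_def)
qed

lemma image_mset_bij_ex:
  assumes "bij w" obtains k where "m = image_mset w k"
proof
  show "m = image_mset w (image_mset (inv_into UNIV w) m)"
    using assms by (simp add: image_mset.compositionality comp_def bij_is_surj surj_f_inv_f)
qed

text \<open>\<open>ps_act\<close> is defined through the inverse of \<open>w\<close>. Testing at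
  image monomials, which are all monomials, removes the inverse from later arguments.\<close>

lemma ps_act_eqI:
  assumes "bij w" "\<And>m. g (image_mset w m) = f m" shows "ps_act w f = g"
  by (rule ext) (metis assms image_mset_bij_ex ps_act_bij)

lemma ps_act_comp:
  assumes "bij v" "bij w" shows "ps_act v (ps_act w f) = ps_act (v \<circ> w) f"
proof (rule sym, rule ps_act_eqI)
  show "bij (v \<circ> w)" using assms by (simp add: bij_comp)
  fix m
  have "image_mset (v \<circ> w) m = image_mset v (image_mset w m)"
    by (simp add: image_mset.compositionality)
  thus "ps_act v (ps_act w f) (image_mset (v \<circ> w) m) = f m"
    using assms by (simp add: ps_act_bij)
qed

lemma ps_act_id: "ps_act id f = f"
  by (rule ps_act_eqI) auto

lemma ps_act_add: "ps_act w (\<lambda>m. f m + g m) = (\<lambda>m. ps_act w f m + ps_act w g m)"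
  by (simp add: ps_act_def)

lemma ps_act_const:
  assumes "bij w" shows "ps_act w (ps_const c) = ps_const c"
  by (rule ps_act_eqI[OF assms]) (auto simp: ps_const_def)

lemma ps_act_var:
  assumes "bij w" shows "ps_act w (ps_var x) = ps_var (w x)"
proof (rule ps_act_eqI[OF assms])
  fix m
  have "image_mset w m = image_mset w {#x#} \<longleftrightarrow> m = {#x#}"
    using multiset.inj_map[OF bij_is_inj[OF assms]] by (rule inj_eq)
  thus "ps_var (w x) (image_mset w m) = ps_var x m" by (simp add: ps_var_def)
qed

lemma ps_act_conv:
  assumes "bij w" shows "ps_act w (ps_conv f g) = ps_conv (ps_act w f) (ps_act w g)"
proof (rule ps_act_eqI[OF assms])
  fix m
  let ?v = "image_mset (inv_into UNIV w)"
  have vw: "?v (image_mset w k) = k" for k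
    using assms by (simp add: image_mset.compositionality comp_def bij_is_inj inv_f_f)
  have wv: "image_mset w (?v k) = k" for k
    using assms by (simp add: image_mset.compositionality comp_def bij_is_surj surj_f_inv_f)
  show "ps_conv (ps_act w f) (ps_act w g) (image_mset w m) = ps_conv f g m"
    unfolding ps_conv_def
  proof (rule sum.reindex_bij_witness[of _ "image_mset w" ?v])
    fix k assume "k \<in> {k. k \<subseteq># image_mset w m}"
    hence k: "k \<subseteq># image_mset w m" by simp
    show "image_mset w (?v k) = k" by (rule wv)
    show kv: "?v k \<in> {k. k \<subseteq># m}" using image_mset_subseteq_mono[OF k, of "inv_into UNIV w"] vw by simp
    have "image_mset w (m - ?v k) = image_mset w m - k"
      using kv by (subst image_mset_Diff) (auto simp: wv)
    thus "f (?v k) * g (m - ?v k) = ps_act w f k * ps_act w g (image_mset w m - k)"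
      by (metis ps_act_bij[OF assms] wv)
  qed (auto simp: vw image_mset_subseteq_mono)
qed

lemma ps_act_closed:
  assumes w: "bij w" "w ` V = V" and f: "f \<in> carrier (ps_ring V)"
  shows "ps_act w f \<in> carrier (ps_ring V)"
proof -
  have "set_mset m \<subseteq> V" if "ps_act w f m \<noteq> 0" for m
  proof -
    obtain k where k: "m = image_mset w k" using image_mset_bij_ex[OF w(1)] by metis
    hence "set_mset k \<subseteq> V" using that f w(1) by (auto simp: ps_act_bij ps_carrier_iff)
    thus ?thesis using k w(2) by auto
  qed
  moreover have "finite {m. size m = d \<and> ps_act w f m \<noteq> 0}" for d
  proof -
    have "{m. size m = d \<and> ps_act w f m \<noteq> 0} \<subseteq> image_mset w ` {m. size m = d \<and> f m \<noteq> 0}"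
    proof
      fix m assume m: "m \<in> {m. size m = d \<and> ps_act w f m \<noteq> 0}"
      obtain k where k: "m = image_mset w k" using image_mset_bij_ex[OF w(1)] by metis
      thus "m \<in> image_mset w ` {m. size m = d \<and> f m \<noteq> 0}" using m w(1) by (auto simp: ps_act_bij)
    qed
    moreover have "finite {m. size m = d \<and> f m \<noteq> 0}" using f by (simp add: ps_carrier_iff)
    ultimately show ?thesis by (meson finite_imageI finite_subset)
  qed
  ultimately show ?thesis by (auto simp: ps_carrier_iff)
qed

lemma ps_act_hom:
  assumes "bij w" "w ` V = V" shows "ps_act w \<in> ring_hom (ps_ring V) (ps_ring V)"
  by (rule ring_hom_memI)
    (auto simp: ps_ring_simps ps_act_closed assms ps_act_conv ps_act_add ps_act_const)

section \<open>Localization\<close>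

locale localization_setup = cring A for A (structure) +
  fixes M
  assumes M_sub: "M \<subseteq> carrier A" and M_one: "\<one> \<in> M"
    and M_mult: "s \<in> M \<Longrightarrow> t \<in> M \<Longrightarrow> s \<otimes> t \<in> M"
begin

abbreviation "L \<equiv> localization A M"
abbreviation "fr \<equiv> loc_frac A M"

lemma M_carrier [simp]: "s \<in> M \<Longrightarrow> s \<in> carrier A"
  using M_sub by auto

lemma frac_rel_iff:
  "((a, s), (b, t)) \<in> frac_rel A M \<longleftrightarrow>
     a \<in> carrier A \<and> s \<in> M \<and> b \<in> carrier A \<and> t \<in> M \<and>
     (\<exists>u\<in>M. u \<otimes> (a \<otimes> t) = u \<otimes> (b \<otimes> s))"
proof -
  have "u \<otimes> (a \<otimes> t \<ominus> b \<otimes> s) = \<zero> \<longleftrightarrow> u \<otimes> (a \<otimes> t) = u \<otimes> (b \<otimes> s)"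
    if "a \<in> carrier A" "b \<in> carrier A" "s \<in> M" "t \<in> M" "u \<in> M" for u
  proof -
    have "u \<otimes> (a \<otimes> t \<ominus> b \<otimes> s) = u \<otimes> (a \<otimes> t) \<ominus> u \<otimes> (b \<otimes> s)"
      using that by (simp add: minus_eq r_distr r_minus)
    thus ?thesis using that by (simp add: r_right_minus_eq)
  qed
  thus ?thesis unfolding frac_rel_def by auto
qed

lemma frac_rel_equiv: "equiv (carrier A \<times> M) (frac_rel A M)"
proof (rule equivI)
  show "frac_rel A M \<subseteq> (carrier A \<times> M) \<times> (carrier A \<times> M)"
    unfolding frac_rel_def by auto
  show "refl_on (carrier A \<times> M) (frac_rel A M)"
    by (rule refl_onI) (use M_one in \<open>auto simp: frac_rel_iff\<close>)
  show "sym (frac_rel A M)"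
    by (rule symI) (auto simp: frac_rel_iff, metis)
  show "trans (frac_rel A M)"
  proof (rule transI)
    fix x y z assume xy: "(x, y) \<in> frac_rel A M" and yz: "(y, z) \<in> frac_rel A M"
    obtain a s b t c q where e: "x = (a, s)" "y = (b, t)" "z = (c, q)" by (metis prod.exhaust)
    from xy yz obtain u v where u: "u \<in> M" "u \<otimes> (a \<otimes> t) = u \<otimes> (b \<otimes> s)"
      and v: "v \<in> M" "v \<otimes> (b \<otimes> q) = v \<otimes> (c \<otimes> t)"
      and c: "a \<in> carrier A" "b \<in> carrier A" "c \<in> carrier A" "s \<in> M" "t \<in> M" "q \<in> M"
      unfolding e frac_rel_iff by auto
    \<comment> \<open>The two witnesses times the middle denominator \<open>t\<close> form the
      witness for transitivity.\<close>
    have "(u \<otimes> v \<otimes> t) \<otimes> (a \<otimes> q) = (u \<otimes> (a \<otimes> t)) \<otimes> (v \<otimes> q)"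
      using c u(1) v(1) by (simp add: m_ac)
    also have "\<dots> = (v \<otimes> (b \<otimes> q)) \<otimes> (u \<otimes> s)"
      unfolding u(2) using c u(1) v(1) by (simp add: m_ac)
    also have "\<dots> = (u \<otimes> v \<otimes> t) \<otimes> (c \<otimes> s)"
      unfolding v(2) using c u(1) v(1) by (simp add: m_ac)
    finally show "(x, z) \<in> frac_rel A M"
      unfolding e frac_rel_iff using c u(1) v(1) by (auto intro!: bexI[of _ "u \<otimes> v \<otimes> t"] M_mult)
  qed
qed

lemma fr_eq_iff:
  assumes "a \<in> carrier A" "s \<in> M" "b \<in> carrier A" "t \<in> M"
  shows "fr a s = fr b t \<longleftrightarrow> (\<exists>u\<in>M. u \<otimes> (a \<otimes> t) = u \<otimes> (b \<otimes> s))"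
  unfolding loc_frac_def using assms
  by (subst eq_equiv_class_iff[OF frac_rel_equiv]) (auto simp: frac_rel_iff)

lemma fr_eqI:
  assumes "a \<otimes> t = b \<otimes> s" "a \<in> carrier A" "s \<in> M" "b \<in> carrier A" "t \<in> M"
  shows "fr a s = fr b t"
  using assms M_one by (auto simp: fr_eq_iff)

lemma loc_carrier: "carrier L = {fr a s | a s. a \<in> carrier A \<and> s \<in> M}"
  by (auto simp: localization_def loc_frac_def quotient_def)

lemma fr_closed [simp]: "a \<in> carrier A \<Longrightarrow> s \<in> M \<Longrightarrow> fr a s \<in> carrier L"
  unfolding loc_carrier by blast

lemma fr_cases:
  assumes "x \<in> carrier L" obtains a s where "x = fr a s" "a \<in> carrier A" "s \<in> M"
  using assms unfolding loc_carrier by blast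

text \<open>The product of classes is a union over all pairs of representatives. By congruence every
  pair contributes the same class, so the union collapses to the class of one chosen pair;
  \<open>loc_add\<close> works alike.\<close>

lemma loc_mult:
  assumes "a \<in> carrier A" "s \<in> M" "b \<in> carrier A" "t \<in> M"
  shows "fr a s \<otimes>\<^bsub>L\<^esub> fr b t = fr (a \<otimes> b) (s \<otimes> t)"
proof -
  have "(\<Union>x\<in>frac_rel A M `` {(a, s)}. \<Union>y\<in>frac_rel A M `` {(b, t)}.
      (\<lambda>(a, s) (b, t). fr (a \<otimes> b) (s \<otimes> t)) x y) = (\<lambda>(a, s) (b, t). fr (a \<otimes> b) (s \<otimes> t)) (a, s) (b, t)"
  proof (rule UN_equiv_class2[OF frac_rel_equiv frac_rel_equiv])
    show "congruent2 (frac_rel A M) (frac_rel A M) (\<lambda>(a, s) (b, t). fr (a \<otimes> b) (s \<otimes> t))"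
    proof (rule congruent2I', clarify)
      fix a s a' s' b t b' t'
      assume "((a, s), (a', s')) \<in> frac_rel A M" "((b, t), (b', t')) \<in> frac_rel A M"
      then obtain u v where u: "u \<in> M" "u \<otimes> (a \<otimes> s') = u \<otimes> (a' \<otimes> s)"
        and v: "v \<in> M" "v \<otimes> (b \<otimes> t') = v \<otimes> (b' \<otimes> t)"
        and c: "a \<in> carrier A" "b \<in> carrier A" "a' \<in> carrier A" "b' \<in> carrier A"
          "s \<in> M" "t \<in> M" "s' \<in> M" "t' \<in> M"
        unfolding frac_rel_iff by auto
      have "(u \<otimes> v) \<otimes> ((a \<otimes> b) \<otimes> (s' \<otimes> t')) = (u \<otimes> (a \<otimes> s')) \<otimes> (v \<otimes> (b \<otimes> t'))"
        using c u(1) v(1) by (simp add: m_ac)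
      also have "\<dots> = (u \<otimes> v) \<otimes> ((a' \<otimes> b') \<otimes> (s \<otimes> t))"
        unfolding u(2) v(2) using c u(1) v(1) by (simp add: m_ac)
      finally show "fr (a \<otimes> b) (s \<otimes> t) = fr (a' \<otimes> b') (s' \<otimes> t')"
        using c u(1) v(1) by (auto simp: fr_eq_iff M_mult)
    qed
  qed (use assms in auto)
  thus ?thesis by (simp add: localization_def loc_frac_def[of A M a s] loc_frac_def[of A M b t] split_def)
qed

lemma loc_add:
  assumes "a \<in> carrier A" "s \<in> M" "b \<in> carrier A" "t \<in> M"
  shows "fr a s \<oplus>\<^bsub>L\<^esub> fr b t = fr (a \<otimes> t \<oplus> b \<otimes> s) (s \<otimes> t)"
proof -
  have "(\<Union>x\<in>frac_rel A M `` {(a, s)}. \<Union>y\<in>frac_rel A M `` {(b, t)}.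
      (\<lambda>(a, s) (b, t). fr (a \<otimes> t \<oplus> b \<otimes> s) (s \<otimes> t)) x y) =
      (\<lambda>(a, s) (b, t). fr (a \<otimes> t \<oplus> b \<otimes> s) (s \<otimes> t)) (a, s) (b, t)"
  proof (rule UN_equiv_class2[OF frac_rel_equiv frac_rel_equiv])
    show "congruent2 (frac_rel A M) (frac_rel A M) (\<lambda>(a, s) (b, t). fr (a \<otimes> t \<oplus> b \<otimes> s) (s \<otimes> t))"
    proof (rule congruent2I', clarify)
      fix a s a' s' b t b' t'
      assume "((a, s), (a', s')) \<in> frac_rel A M" "((b, t), (b', t')) \<in> frac_rel A M"
      then obtain u v where u: "u \<in> M" "u \<otimes> (a \<otimes> s') = u \<otimes> (a' \<otimes> s)"
        and v: "v \<in> M" "v \<otimes> (b \<otimes> t') = v \<otimes> (b' \<otimes> t)"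
        and c: "a \<in> carrier A" "b \<in> carrier A" "a' \<in> carrier A" "b' \<in> carrier A"
          "s \<in> M" "t \<in> M" "s' \<in> M" "t' \<in> M"
        unfolding frac_rel_iff by auto
      have "(u \<otimes> v) \<otimes> ((a \<otimes> t \<oplus> b \<otimes> s) \<otimes> (s' \<otimes> t')) =
          (u \<otimes> (a \<otimes> s')) \<otimes> (v \<otimes> t \<otimes> t') \<oplus> (v \<otimes> (b \<otimes> t')) \<otimes> (u \<otimes> s \<otimes> s')"
        using c u(1) v(1) by (simp add: m_ac l_distr r_distr)
      also have "\<dots> = (u \<otimes> v) \<otimes> ((a' \<otimes> t' \<oplus> b' \<otimes> s') \<otimes> (s \<otimes> t))"
        unfolding u(2) v(2) using c u(1) v(1) by (simp add: m_ac l_distr r_distr)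
      finally show "fr (a \<otimes> t \<oplus> b \<otimes> s) (s \<otimes> t) = fr (a' \<otimes> t' \<oplus> b' \<otimes> s') (s' \<otimes> t')"
        using c u(1) v(1) by (auto simp: fr_eq_iff M_mult)
    qed
  qed (use assms in auto)
  thus ?thesis by (simp add: localization_def loc_frac_def[of A M a s] loc_frac_def[of A M b t] split_def)
qed

lemma loc_one: "\<one>\<^bsub>L\<^esub> = fr \<one> \<one>" and loc_zero: "\<zero>\<^bsub>L\<^esub> = fr \<zero> \<one>"
  by (auto simp: localization_def)

lemma loc_cring: "cring L"
proof (rule cringI)
  show "abelian_group L"
  proof (rule abelian_groupI)
    fix x y z assume "x \<in> carrier L" "y \<in> carrier L" "z \<in> carrier L"
    then obtain a s b t c q where e: "x = fr a s" "y = fr b t" "z = fr c q"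
      and [simp]: "a \<in> carrier A" "b \<in> carrier A" "c \<in> carrier A" "s \<in> M" "t \<in> M" "q \<in> M"
      by (metis fr_cases)
    show "x \<oplus>\<^bsub>L\<^esub> y \<in> carrier L" by (simp add: e loc_add M_mult)
    show "x \<oplus>\<^bsub>L\<^esub> y \<oplus>\<^bsub>L\<^esub> z = x \<oplus>\<^bsub>L\<^esub> (y \<oplus>\<^bsub>L\<^esub> z)"
      by (simp add: e loc_add M_mult, rule fr_eqI) (simp_all add: M_mult m_ac a_ac l_distr r_distr)
    show "x \<oplus>\<^bsub>L\<^esub> y = y \<oplus>\<^bsub>L\<^esub> x"
      by (simp add: e loc_add M_mult, rule fr_eqI) (simp_all add: M_mult m_ac a_ac l_distr r_distr)
  next
    fix x assume "x \<in> carrier L"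
    then obtain a s where e: "x = fr a s" and [simp]: "a \<in> carrier A" "s \<in> M" by (metis fr_cases)
    show "\<zero>\<^bsub>L\<^esub> \<oplus>\<^bsub>L\<^esub> x = x" by (simp add: e loc_zero loc_add M_one)
    show "\<exists>y\<in>carrier L. y \<oplus>\<^bsub>L\<^esub> x = \<zero>\<^bsub>L\<^esub>"
    proof (intro bexI[of _ "fr (\<ominus> a) s"])
      show "fr (\<ominus> a) s \<oplus>\<^bsub>L\<^esub> x = \<zero>\<^bsub>L\<^esub>"
        by (simp add: e loc_zero loc_add M_one, rule fr_eqI) (simp_all add: M_mult M_one l_minus l_neg)
    qed simp
  qed (simp add: loc_zero M_one)
  show "comm_monoid L"
  proof (rule comm_monoidI)
    fix x y z assume "x \<in> carrier L" "y \<in> carrier L" "z \<in> carrier L"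
    then obtain a s b t c q where e: "x = fr a s" "y = fr b t" "z = fr c q"
      and [simp]: "a \<in> carrier A" "b \<in> carrier A" "c \<in> carrier A" "s \<in> M" "t \<in> M" "q \<in> M"
      by (metis fr_cases)
    show "x \<otimes>\<^bsub>L\<^esub> y \<in> carrier L" by (simp add: e loc_mult M_mult)
    show "x \<otimes>\<^bsub>L\<^esub> y \<otimes>\<^bsub>L\<^esub> z = x \<otimes>\<^bsub>L\<^esub> (y \<otimes>\<^bsub>L\<^esub> z)" by (simp add: e loc_mult M_mult m_ac)
    show "x \<otimes>\<^bsub>L\<^esub> y = y \<otimes>\<^bsub>L\<^esub> x" by (simp add: e loc_mult M_mult m_ac)
    show "\<one>\<^bsub>L\<^esub> \<otimes>\<^bsub>L\<^esub> x = x" by (simp add: e loc_one loc_mult M_one)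
  qed (simp add: loc_one M_one)
  fix x y z assume "x \<in> carrier L" "y \<in> carrier L" "z \<in> carrier L"
  then obtain a s b t c q where e: "x = fr a s" "y = fr b t" "z = fr c q"
    and [simp]: "a \<in> carrier A" "b \<in> carrier A" "c \<in> carrier A" "s \<in> M" "t \<in> M" "q \<in> M"
    by (metis fr_cases)
  show "(x \<oplus>\<^bsub>L\<^esub> y) \<otimes>\<^bsub>L\<^esub> z = x \<otimes>\<^bsub>L\<^esub> z \<oplus>\<^bsub>L\<^esub> y \<otimes>\<^bsub>L\<^esub> z"
    by (simp add: e loc_add loc_mult M_mult, rule fr_eqI) (simp_all add: M_mult m_ac l_distr r_distr)
qed

lemma fr_hom: "(\<lambda>a. fr a \<one>) \<in> ring_hom A L"
  by (rule ring_hom_memI) (auto simp: loc_add loc_mult loc_one M_one)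

lemma fr_inverse: "s \<in> M \<Longrightarrow> fr s \<one> \<otimes>\<^bsub>L\<^esub> fr \<one> s = \<one>\<^bsub>L\<^esub>"
  by (simp add: loc_mult loc_one M_one) (rule fr_eqI, auto simp: M_one)

context
  fixes \<sigma> \<tau>
  assumes \<sigma>: "\<sigma> \<in> ring_hom A A" and \<tau>: "\<tau> \<in> ring_hom A A"
    and \<sigma>M: "\<And>s. s \<in> M \<Longrightarrow> \<sigma> s \<in> M" and \<tau>M: "\<And>s. s \<in> M \<Longrightarrow> \<tau> s \<in> M"
    and \<sigma>\<tau>: "\<And>a. a \<in> carrier A \<Longrightarrow> \<sigma> (\<tau> a) = a" and \<tau>\<sigma>: "\<And>a. a \<in> carrier A \<Longrightarrow> \<tau> (\<sigma> a) = a"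
begin

text \<open>A ring endomorphism maps a class of fractions into a class. That the image is the whole
  class uses the inverse \<tau>: each representative of the target class is pulled back by
  it.\<close>

lemma map_prod_fr:
  assumes "a \<in> carrier A" "s \<in> M"
  shows "map_prod \<sigma> \<sigma> ` fr a s = fr (\<sigma> a) (\<sigma> s)"
proof -
  have *: "((\<rho> a, \<rho> s), (\<rho> b, \<rho> t)) \<in> frac_rel A M"
    if "((a, s), (b, t)) \<in> frac_rel A M" and \<rho>: "\<rho> \<in> ring_hom A A" "\<And>s. s \<in> M \<Longrightarrow> \<rho> s \<in> M" for a s b t \<rho>
  proof -
    from that(1) obtain u where u: "u \<in> M" "u \<otimes> (a \<otimes> t) = u \<otimes> (b \<otimes> s)"
      and c: "a \<in> carrier A" "b \<in> carrier A" "s \<in> M" "t \<in> M"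
      by (auto simp: frac_rel_iff)
    from u(2) have "\<rho> (u \<otimes> (a \<otimes> t)) = \<rho> (u \<otimes> (b \<otimes> s))" by simp
    hence "\<rho> u \<otimes> (\<rho> a \<otimes> \<rho> t) = \<rho> u \<otimes> (\<rho> b \<otimes> \<rho> s)"
      using c u(1) by (simp add: ring_hom_mult[OF \<rho>(1)])
    thus ?thesis using c u(1) \<rho>(2) ring_hom_closed[OF \<rho>(1)] by (auto simp: frac_rel_iff)
  qed
  show ?thesis
  proof (intro Set.set_eqI iffI)
    fix x assume "x \<in> map_prod \<sigma> \<sigma> ` fr a s"
    then obtain b t where "x = (\<sigma> b, \<sigma> t)" "((a, s), (b, t)) \<in> frac_rel A M"
      by (auto simp: loc_frac_def)
    thus "x \<in> fr (\<sigma> a) (\<sigma> s)" using *[OF _ \<sigma> \<sigma>M] by (auto simp: loc_frac_def)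
  next
    fix x assume "x \<in> fr (\<sigma> a) (\<sigma> s)"
    then obtain b t where x: "x = (b, t)" "((\<sigma> a, \<sigma> s), (b, t)) \<in> frac_rel A M"
      by (cases x) (auto simp: loc_frac_def)
    hence bt: "b \<in> carrier A" "t \<in> M" by (auto simp: frac_rel_iff)
    have "((a, s), (\<tau> b, \<tau> t)) \<in> frac_rel A M"
      using *[OF x(2) \<tau> \<tau>M] assms by (simp add: \<tau>\<sigma>)
    moreover have "x = map_prod \<sigma> \<sigma> (\<tau> b, \<tau> t)" using bt by (simp add: x(1) \<sigma>\<tau>)
    ultimately show "x \<in> map_prod \<sigma> \<sigma> ` fr a s" by (auto simp: loc_frac_def)
  qed
qed

lemma map_prod_hom: "(`) (map_prod \<sigma> \<sigma>) \<in> ring_hom L L"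
proof (rule ring_hom_memI)
  note h = ring_hom_closed[OF \<sigma>] ring_hom_mult[OF \<sigma>] ring_hom_add[OF \<sigma>] ring_hom_one[OF \<sigma>]
  fix x y assume "x \<in> carrier L" "y \<in> carrier L"
  then obtain a s b t where e: "x = fr a s" "y = fr b t"
    and [simp]: "a \<in> carrier A" "b \<in> carrier A" "s \<in> M" "t \<in> M"
    by (metis fr_cases)
  show "map_prod \<sigma> \<sigma> ` x \<in> carrier L" by (simp add: e map_prod_fr \<sigma>M h)
  show "map_prod \<sigma> \<sigma> ` (x \<otimes>\<^bsub>L\<^esub> y) = map_prod \<sigma> \<sigma> ` x \<otimes>\<^bsub>L\<^esub> map_prod \<sigma> \<sigma> ` y"
    by (simp add: e map_prod_fr \<sigma>M h loc_mult M_mult)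
  show "map_prod \<sigma> \<sigma> ` (x \<oplus>\<^bsub>L\<^esub> y) = map_prod \<sigma> \<sigma> ` x \<oplus>\<^bsub>L\<^esub> map_prod \<sigma> \<sigma> ` y"
    by (simp add: e map_prod_fr \<sigma>M h loc_add M_mult)
next
  show "map_prod \<sigma> \<sigma> ` \<one>\<^bsub>L\<^esub> = \<one>\<^bsub>L\<^esub>"
    using ring_hom_one[OF \<sigma>] by (simp add: loc_one map_prod_fr M_one)
qed

end

end

lemma mult_closure_subset:
  assumes "monoid A" "X \<subseteq> carrier A" shows "mult_closure A X \<subseteq> carrier A"
proof
  fix x assume "x \<in> mult_closure A X"
  thus "x \<in> carrier A"
    by induction (use assms in \<open>auto simp: monoid.m_closed monoid.one_closed subset_iff\<close>)
qed

lemma mult_closure_mult: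
  assumes "monoid A" "X \<subseteq> carrier A" "s \<in> mult_closure A X" "t \<in> mult_closure A X"
  shows "s \<otimes>\<^bsub>A\<^esub> t \<in> mult_closure A X"
  using assms(3)
proof induction
  case one
  thus ?case using assms mult_closure_subset[OF assms(1,2)] by (auto simp: monoid.l_one)
next
  case (mult x m)
  have "x \<otimes>\<^bsub>A\<^esub> m \<otimes>\<^bsub>A\<^esub> t = x \<otimes>\<^bsub>A\<^esub> (m \<otimes>\<^bsub>A\<^esub> t)"
    using assms mult mult_closure_subset[OF assms(1,2)] by (intro monoid.m_assoc) auto
  thus ?case using mult by (auto intro: mult_closure.mult)
qed

lemma mult_closure_incl:
  assumes "monoid A" "x \<in> carrier A" "x \<in> X" shows "x \<in> mult_closure A X"
  using mult_closure.mult[OF assms(3) mult_closure.one, of A] monoid.r_one[OF assms(1,2)] by simp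

lemma localization_setupI:
  assumes "cring A" "X \<subseteq> carrier A" shows "localization_setup A (mult_closure A X)"
proof -
  interpret cring A by fact
  show ?thesis
    by unfold_locales
      (use mult_closure_subset[OF monoid_axioms assms(2)] mult_closure_mult[OF monoid_axioms assms(2)]
        in \<open>auto intro: mult_closure.one\<close>)
qed

section \<open>Twisted group algebras\<close>

locale twisted_algebra = K: cring K + G: group G
  for K (structure) and G (structure) +
  fixes act
  assumes act_hom: "u \<in> carrier G \<Longrightarrow> act u \<in> ring_hom K K"
    and act_one: "c \<in> carrier K \<Longrightarrow> act \<one>\<^bsub>G\<^esub> c = c"
    and act_mult: "u \<in> carrier G \<Longrightarrow> v \<in> carrier G \<Longrightarrow> c \<in> carrier K \<Longrightarrow>
       act (u \<otimes>\<^bsub>G\<^esub> v) c = act u (act v c)"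
begin

abbreviation "TA \<equiv> twisted_group_algebra K G act"
abbreviation sc where "sc c \<equiv> tw_elem K c \<one>\<^bsub>G\<^esub>"
abbreviation eta where "eta u \<equiv> tw_elem K \<one>\<^bsub>K\<^esub> u"

lemma act_closed [simp]: "u \<in> carrier G \<Longrightarrow> c \<in> carrier K \<Longrightarrow> act u c \<in> carrier K"
  using ring_hom_closed[OF act_hom] .

lemma act_ring_hom_cring: "u \<in> carrier G \<Longrightarrow> ring_hom_cring K K (act u)"
  using act_hom by (simp add: ring_hom_cring_def ring_hom_cring_axioms_def K.is_cring)

lemma act_simps [simp]:
  assumes "u \<in> carrier G"
  shows "act u \<zero>\<^bsub>K\<^esub> = \<zero>\<^bsub>K\<^esub>" "act u \<one>\<^bsub>K\<^esub> = \<one>\<^bsub>K\<^esub>"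
    "c \<in> carrier K \<Longrightarrow> d \<in> carrier K \<Longrightarrow> act u (c \<otimes>\<^bsub>K\<^esub> d) = act u c \<otimes>\<^bsub>K\<^esub> act u d"
    "c \<in> carrier K \<Longrightarrow> d \<in> carrier K \<Longrightarrow> act u (c \<oplus>\<^bsub>K\<^esub> d) = act u c \<oplus>\<^bsub>K\<^esub> act u d"
    "c \<in> carrier K \<Longrightarrow> act u (\<ominus>\<^bsub>K\<^esub> c) = \<ominus>\<^bsub>K\<^esub> act u c"
proof -
  interpret h: ring_hom_cring K K "act u" by (rule act_ring_hom_cring[OF assms])
  show "act u \<zero>\<^bsub>K\<^esub> = \<zero>\<^bsub>K\<^esub>" "act u \<one>\<^bsub>K\<^esub> = \<one>\<^bsub>K\<^esub>"
    "c \<in> carrier K \<Longrightarrow> d \<in> carrier K \<Longrightarrow> act u (c \<otimes>\<^bsub>K\<^esub> d) = act u c \<otimes>\<^bsub>K\<^esub> act u d"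
    "c \<in> carrier K \<Longrightarrow> d \<in> carrier K \<Longrightarrow> act u (c \<oplus>\<^bsub>K\<^esub> d) = act u c \<oplus>\<^bsub>K\<^esub> act u d"
    "c \<in> carrier K \<Longrightarrow> act u (\<ominus>\<^bsub>K\<^esub> c) = \<ominus>\<^bsub>K\<^esub> act u c" by auto
qed

lemma tw_carrier_iff:
  "f \<in> carrier TA \<longleftrightarrow> (\<forall>u. f u \<in> carrier K) \<and> (\<forall>u. u \<notin> carrier G \<longrightarrow> f u = \<zero>\<^bsub>K\<^esub>) \<and>
     finite {u. f u \<noteq> \<zero>\<^bsub>K\<^esub>}"
  unfolding twisted_group_algebra_def partial_object.simps mem_Collect_eq ..

lemma tw_coeff [simp]: "f \<in> carrier TA \<Longrightarrow> f u \<in> carrier K"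
  and tw_outside: "f \<in> carrier TA \<Longrightarrow> u \<notin> carrier G \<Longrightarrow> f u = \<zero>\<^bsub>K\<^esub>"
  and tw_finite: "f \<in> carrier TA \<Longrightarrow> finite {u. f u \<noteq> \<zero>\<^bsub>K\<^esub>}"
  by (auto simp: tw_carrier_iff)

lemma tw_support: "f \<in> carrier TA \<Longrightarrow> {u. f u \<noteq> \<zero>\<^bsub>K\<^esub>} \<subseteq> carrier G"
  by (auto simp: tw_carrier_iff)

lemma tw_add: "(f \<oplus>\<^bsub>TA\<^esub> g) u = f u \<oplus>\<^bsub>K\<^esub> g u"
  unfolding twisted_group_algebra_def ring_record_simps ..

lemma tw_zero: "\<zero>\<^bsub>TA\<^esub> = (\<lambda>u. \<zero>\<^bsub>K\<^esub>)"
  unfolding twisted_group_algebra_def ring_record_simps ..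

lemma tw_one: "\<one>\<^bsub>TA\<^esub> = eta \<one>\<^bsub>G\<^esub>"
  unfolding twisted_group_algebra_def ring_record_simps ..

lemma tw_mult_gen:
  "(f \<otimes>\<^bsub>TA\<^esub> g) w = finsum K (\<lambda>(u, v). f u \<otimes>\<^bsub>K\<^esub> act u (g v))
     {(u, v). u \<in> carrier G \<and> v \<in> carrier G \<and>
        f u \<noteq> \<zero>\<^bsub>K\<^esub> \<and> g v \<noteq> \<zero>\<^bsub>K\<^esub> \<and> u \<otimes>\<^bsub>G\<^esub> v = w}"
  unfolding twisted_group_algebra_def ring_record_simps ..

lemma tw_mult_outside: "w \<notin> carrier G \<Longrightarrow> (f \<otimes>\<^bsub>TA\<^esub> g) w = \<zero>\<^bsub>K\<^esub>"
proof -
  assume "w \<notin> carrier G"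
  hence "{(u, v). u \<in> carrier G \<and> v \<in> carrier G \<and>
        f u \<noteq> \<zero>\<^bsub>K\<^esub> \<and> g v \<noteq> \<zero>\<^bsub>K\<^esub> \<and> u \<otimes>\<^bsub>G\<^esub> v = w} = {}" by auto
  thus ?thesis by (simp only: tw_mult_gen K.finsum_empty)
qed

text \<open>Solving \<open>u v = w\<close> for \<open>v\<close> turns the defining sum over pairs
  into a sum over \<open>u\<close>. The index set \<open>U\<close> may exceed the support of
  \<open>f\<close>, so that several elements can be summed over a common set.\<close>

lemma tw_mult_eq:
  assumes f: "f \<in> carrier TA" and g: "g \<in> carrier TA" and U: "finite U" "U \<subseteq> carrier G"
    and supp: "\<And>u. u \<in> carrier G \<Longrightarrow> u \<notin> U \<Longrightarrow> f u = \<zero>\<^bsub>K\<^esub>" and w: "w \<in> carrier G"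
  shows "(f \<otimes>\<^bsub>TA\<^esub> g) w = finsum K (\<lambda>u. f u \<otimes>\<^bsub>K\<^esub> act u (g (inv\<^bsub>G\<^esub> u \<otimes>\<^bsub>G\<^esub> w))) U"
proof -
  let ?P = "{(u, v). u \<in> carrier G \<and> v \<in> carrier G \<and>
        f u \<noteq> \<zero>\<^bsub>K\<^esub> \<and> g v \<noteq> \<zero>\<^bsub>K\<^esub> \<and> u \<otimes>\<^bsub>G\<^esub> v = w}"
  let ?U = "{u \<in> U. f u \<noteq> \<zero>\<^bsub>K\<^esub> \<and> g (inv\<^bsub>G\<^esub> u \<otimes>\<^bsub>G\<^esub> w) \<noteq> \<zero>\<^bsub>K\<^esub>}"
  let ?h = "\<lambda>u. (u, inv\<^bsub>G\<^esub> u \<otimes>\<^bsub>G\<^esub> w)"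
  have sub: "u \<in> carrier G" if "u \<in> U" for u using that U by auto
  have P: "?P = ?h ` ?U"
  proof (intro Set.set_eqI iffI)
    fix x assume "x \<in> ?P"
    then obtain u v where x: "x = (u, v)" "u \<in> carrier G" "v \<in> carrier G" "f u \<noteq> \<zero>\<^bsub>K\<^esub>"
      "g v \<noteq> \<zero>\<^bsub>K\<^esub>" "u \<otimes>\<^bsub>G\<^esub> v = w" by auto
    hence "v = inv\<^bsub>G\<^esub> u \<otimes>\<^bsub>G\<^esub> w" using w by (simp add: G.inv_solve_left)
    thus "x \<in> ?h ` ?U" using x supp by auto
  next
    fix x assume "x \<in> ?h ` ?U"
    thus "x \<in> ?P" using w by (auto simp: sub G.m_assoc[symmetric])
  qed
  have "(f \<otimes>\<^bsub>TA\<^esub> g) w = finsum K (\<lambda>(u, v). f u \<otimes>\<^bsub>K\<^esub> act u (g v)) (?h ` ?U)"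
    by (simp only: tw_mult_gen P)
  also have "\<dots> = finsum K (\<lambda>u. (\<lambda>(u, v). f u \<otimes>\<^bsub>K\<^esub> act u (g v)) (?h u)) ?U"
    by (rule K.finsum_reindex) (use f g in \<open>auto simp: sub inj_on_def\<close>)
  also have "\<dots> = finsum K (\<lambda>u. f u \<otimes>\<^bsub>K\<^esub> act u (g (inv\<^bsub>G\<^esub> u \<otimes>\<^bsub>G\<^esub> w))) U"
    by (rule K.add.finprod_mono_neutral_cong_left) (use f g U in \<open>auto simp: sub Pi_def\<close>)
  finally show ?thesis .
qed

lemma tw_mult_closed:
  assumes f: "f \<in> carrier TA" and g: "g \<in> carrier TA"
  shows "f \<otimes>\<^bsub>TA\<^esub> g \<in> carrier TA"
proof -
  let ?F = "{u. f u \<noteq> \<zero>\<^bsub>K\<^esub>}" and ?G = "{u. g u \<noteq> \<zero>\<^bsub>K\<^esub>}"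
  have F: "u \<in> carrier G" if "u \<in> ?F" for u using that tw_support[OF f] by auto
  have mul: "(f \<otimes>\<^bsub>TA\<^esub> g) w = finsum K (\<lambda>u. f u \<otimes>\<^bsub>K\<^esub> act u (g (inv\<^bsub>G\<^esub> u \<otimes>\<^bsub>G\<^esub> w))) ?F"
    if "w \<in> carrier G" for w
    by (rule tw_mult_eq) (use f g that tw_support[OF f] in \<open>auto simp: tw_finite\<close>)
  have "(f \<otimes>\<^bsub>TA\<^esub> g) w \<in> carrier K" for w
  proof (cases "w \<in> carrier G")
    case True
    show ?thesis unfolding mul[OF True] by (rule K.finsum_closed) (use f g F in auto)
  qed (simp add: tw_mult_outside)
  moreover have "finite {w. (f \<otimes>\<^bsub>TA\<^esub> g) w \<noteq> \<zero>\<^bsub>K\<^esub>}"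
  proof (rule finite_subset)
    show "finite ((\<lambda>(u, v). u \<otimes>\<^bsub>G\<^esub> v) ` (?F \<times> ?G))" using f g by (auto simp: tw_finite)
    show "{w. (f \<otimes>\<^bsub>TA\<^esub> g) w \<noteq> \<zero>\<^bsub>K\<^esub>} \<subseteq> (\<lambda>(u, v). u \<otimes>\<^bsub>G\<^esub> v) ` (?F \<times> ?G)"
    proof (rule subsetI, rule ccontr)
      fix w assume w: "w \<in> {w. (f \<otimes>\<^bsub>TA\<^esub> g) w \<noteq> \<zero>\<^bsub>K\<^esub>}"
        and n: "w \<notin> (\<lambda>(u, v). u \<otimes>\<^bsub>G\<^esub> v) ` (?F \<times> ?G)"
      have "{(u, v). u \<in> carrier G \<and> v \<in> carrier G \<and>
        f u \<noteq> \<zero>\<^bsub>K\<^esub> \<and> g v \<noteq> \<zero>\<^bsub>K\<^esub> \<and> u \<otimes>\<^bsub>G\<^esub> v = w} = {}" using n by auto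
      hence "(f \<otimes>\<^bsub>TA\<^esub> g) w = \<zero>\<^bsub>K\<^esub>" by (simp only: tw_mult_gen K.finsum_empty)
      thus False using w by simp
    qed
  qed
  ultimately show ?thesis using tw_mult_outside by (auto simp: tw_carrier_iff)
qed

lemma tw_elem_closed [simp]:
  assumes "c \<in> carrier K" "u \<in> carrier G" shows "tw_elem K c u \<in> carrier TA"
proof -
  have "finite {v. tw_elem K c u v \<noteq> \<zero>\<^bsub>K\<^esub>}"
    by (rule finite_subset[of _ "{u}"]) (auto simp: tw_elem_def)
  thus ?thesis using assms by (auto simp: tw_carrier_iff tw_elem_def)
qed

lemma tw_add_closed:
  assumes f: "f \<in> carrier TA" and g: "g \<in> carrier TA" shows "f \<oplus>\<^bsub>TA\<^esub> g \<in> carrier TA"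
proof -
  have "finite {u. f u \<oplus>\<^bsub>K\<^esub> g u \<noteq> \<zero>\<^bsub>K\<^esub>}"
    by (rule finite_subset[of _ "{u. f u \<noteq> \<zero>\<^bsub>K\<^esub>} \<union> {u. g u \<noteq> \<zero>\<^bsub>K\<^esub>}"]) (use f g in \<open>auto simp: tw_finite\<close>)
  thus ?thesis using f g by (auto simp: tw_carrier_iff tw_add)
qed

lemma tw_elem_mult_left:
  assumes "c \<in> carrier K" "u \<in> carrier G" "g \<in> carrier TA" "w \<in> carrier G"
  shows "(tw_elem K c u \<otimes>\<^bsub>TA\<^esub> g) w = c \<otimes>\<^bsub>K\<^esub> act u (g (inv\<^bsub>G\<^esub> u \<otimes>\<^bsub>G\<^esub> w))"
proof -
  have "(tw_elem K c u \<otimes>\<^bsub>TA\<^esub> g) w =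
      finsum K (\<lambda>x. tw_elem K c u x \<otimes>\<^bsub>K\<^esub> act x (g (inv\<^bsub>G\<^esub> x \<otimes>\<^bsub>G\<^esub> w))) {u}"
    by (rule tw_mult_eq[OF tw_elem_closed]) (use assms in \<open>auto simp: tw_elem_def\<close>)
  thus ?thesis using assms by (simp add: tw_elem_def)
qed

lemma tw_elem_mult_right:
  assumes "c \<in> carrier K" "v \<in> carrier G" and f: "f \<in> carrier TA" and "w \<in> carrier G"
  shows "(f \<otimes>\<^bsub>TA\<^esub> tw_elem K c v) w = f (w \<otimes>\<^bsub>G\<^esub> inv\<^bsub>G\<^esub> v) \<otimes>\<^bsub>K\<^esub> act (w \<otimes>\<^bsub>G\<^esub> inv\<^bsub>G\<^esub> v) c"
proof -
  let ?x = "w \<otimes>\<^bsub>G\<^esub> inv\<^bsub>G\<^esub> v"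
  let ?U = "insert ?x {u. f u \<noteq> \<zero>\<^bsub>K\<^esub>}"
  have U: "u \<in> carrier G" if "u \<in> ?U" for u using that tw_support[OF f] assms by auto
  have x: "inv\<^bsub>G\<^esub> ?x \<otimes>\<^bsub>G\<^esub> w = v" using assms by (simp add: G.inv_mult_group G.m_assoc)
  have ne: "inv\<^bsub>G\<^esub> u \<otimes>\<^bsub>G\<^esub> w = v \<longleftrightarrow> u = ?x" if "u \<in> carrier G" for u
    using that assms G.inv_solve_left'[of v u w] G.inv_solve_right[of u w v] by auto
  have "(f \<otimes>\<^bsub>TA\<^esub> tw_elem K c v) w =
     finsum K (\<lambda>u. f u \<otimes>\<^bsub>K\<^esub> act u (tw_elem K c v (inv\<^bsub>G\<^esub> u \<otimes>\<^bsub>G\<^esub> w))) ?U"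
    by (rule tw_mult_eq) (use assms U tw_finite[OF f] in auto)
  also have "\<dots> = finsum K (\<lambda>u. if ?x = u then f u \<otimes>\<^bsub>K\<^esub> act u c else \<zero>\<^bsub>K\<^esub>) ?U"
    by (rule K.finsum_cong') (use assms U in \<open>auto simp: tw_elem_def ne\<close>)
  also have "\<dots> = f ?x \<otimes>\<^bsub>K\<^esub> act ?x c"
    by (rule K.finsum_singleton) (use assms U tw_finite[OF f] in auto)
  finally show ?thesis .
qed

text \<open>Both sides equal the double sum of \<open>f u * u(g (u^-1 v)) * v(h (v^-1 w))\<close>
  over \<open>u\<close> and \<open>v\<close>; the substitution \<open>v = u t\<close> and
  multiplicativity of the action identify the two ways of summing it.\<close>

lemma tw_assoc:
  assumes f: "f \<in> carrier TA" and g: "g \<in> carrier TA" and h: "h \<in> carrier TA"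
  shows "(f \<otimes>\<^bsub>TA\<^esub> g) \<otimes>\<^bsub>TA\<^esub> h = f \<otimes>\<^bsub>TA\<^esub> (g \<otimes>\<^bsub>TA\<^esub> h)"
proof
  fix w
  show "((f \<otimes>\<^bsub>TA\<^esub> g) \<otimes>\<^bsub>TA\<^esub> h) w = (f \<otimes>\<^bsub>TA\<^esub> (g \<otimes>\<^bsub>TA\<^esub> h)) w"
  proof (cases "w \<in> carrier G")
    case w: True
    let ?F = "{u. f u \<noteq> \<zero>\<^bsub>K\<^esub>}" and ?T = "{u. g u \<noteq> \<zero>\<^bsub>K\<^esub>}"
    let ?V = "(\<lambda>(u, t). u \<otimes>\<^bsub>G\<^esub> t) ` (?F \<times> ?T)"
    have F: "u \<in> carrier G" if "u \<in> ?F" for u using that tw_support[OF f] by auto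
    have T: "u \<in> carrier G" if "u \<in> ?T" for u using that tw_support[OF g] by auto
    have V: "u \<in> carrier G" if "u \<in> ?V" for u using that F T by auto
    have fin: "finite ?F" "finite ?T" "finite ?V" using f g by (auto simp: tw_finite)
    have fg: "(f \<otimes>\<^bsub>TA\<^esub> g) v = finsum K (\<lambda>u. f u \<otimes>\<^bsub>K\<^esub> act u (g (inv\<^bsub>G\<^esub> u \<otimes>\<^bsub>G\<^esub> v))) ?F"
      if "v \<in> carrier G" for v
      by (rule tw_mult_eq) (use f g that fin F in auto)
    have gh: "(g \<otimes>\<^bsub>TA\<^esub> h) v = finsum K (\<lambda>u. g u \<otimes>\<^bsub>K\<^esub> act u (h (inv\<^bsub>G\<^esub> u \<otimes>\<^bsub>G\<^esub> v))) ?T"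
      if "v \<in> carrier G" for v
      by (rule tw_mult_eq) (use g h that fin T in auto)
    have suppV: "(f \<otimes>\<^bsub>TA\<^esub> g) v = \<zero>\<^bsub>K\<^esub>" if "v \<notin> ?V" for v
    proof -
      have "{(u, t). u \<in> carrier G \<and> t \<in> carrier G \<and>
        f u \<noteq> \<zero>\<^bsub>K\<^esub> \<and> g t \<noteq> \<zero>\<^bsub>K\<^esub> \<and> u \<otimes>\<^bsub>G\<^esub> t = v} = {}" using that by auto
      thus ?thesis by (simp only: tw_mult_gen K.finsum_empty)
    qed
    let ?m = "\<lambda>u v. f u \<otimes>\<^bsub>K\<^esub> act u (g (inv\<^bsub>G\<^esub> u \<otimes>\<^bsub>G\<^esub> v)) \<otimes>\<^bsub>K\<^esub> act v (h (inv\<^bsub>G\<^esub> v \<otimes>\<^bsub>G\<^esub> w))"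
    have mc: "?m u v \<in> carrier K" if "u \<in> ?F" "v \<in> ?V" for u v
      using F[OF that(1)] V[OF that(2)] f g h by (intro K.m_closed act_closed tw_coeff) auto
    have "((f \<otimes>\<^bsub>TA\<^esub> g) \<otimes>\<^bsub>TA\<^esub> h) w =
        finsum K (\<lambda>v. (f \<otimes>\<^bsub>TA\<^esub> g) v \<otimes>\<^bsub>K\<^esub> act v (h (inv\<^bsub>G\<^esub> v \<otimes>\<^bsub>G\<^esub> w))) ?V"
      by (rule tw_mult_eq) (use f g h w fin V suppV in \<open>auto simp: tw_mult_closed\<close>)
    also have "\<dots> = finsum K (\<lambda>v. finsum K (\<lambda>u. ?m u v) ?F) ?V"
    proof (rule K.finsum_cong')
      show "(\<lambda>v. finsum K (\<lambda>u. ?m u v) ?F) \<in> ?V \<rightarrow> carrier K"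
        using mc by (intro Pi_I K.finsum_closed) auto
      fix v assume v: "v \<in> ?V"
      show "(f \<otimes>\<^bsub>TA\<^esub> g) v \<otimes>\<^bsub>K\<^esub> act v (h (inv\<^bsub>G\<^esub> v \<otimes>\<^bsub>G\<^esub> w)) = finsum K (\<lambda>u. ?m u v) ?F"
        unfolding fg[OF V[OF v]]
        by (rule K.finsum_ldistr) (use fin V[OF v] F f g h in auto)
    qed simp
    \<comment> \<open>Exchange of two finite sums, by induction on the set that the inner index runs
      through.\<close>
    also have "\<dots> = finsum K (\<lambda>u. finsum K (\<lambda>v. ?m u v) ?V) ?F"
    proof -
      have "finsum K (\<lambda>v. finsum K (\<lambda>u. ?m u v) X) ?V = finsum K (\<lambda>u. finsum K (\<lambda>v. ?m u v) ?V) X"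
        if "finite X" "X \<subseteq> ?F" for X
        using that
      proof (induction X)
        case empty
        thus ?case by simp
      next
        case (insert x X)
        have XV: "\<And>u v. u \<in> insert x X \<Longrightarrow> v \<in> ?V \<Longrightarrow> ?m u v \<in> carrier K"
          using insert.prems mc by blast
        have "finsum K (\<lambda>v. finsum K (\<lambda>u. ?m u v) (insert x X)) ?V =
          finsum K (\<lambda>v. ?m x v \<oplus>\<^bsub>K\<^esub> finsum K (\<lambda>u. ?m u v) X) ?V"
          by (rule K.finsum_cong')
            (use insert.hyps XV in \<open>auto intro!: K.finsum_insert K.finsum_closed K.a_closed simp del: K.finsum_insert\<close>)
        also have "\<dots> = finsum K (\<lambda>v. ?m x v) ?V \<oplus>\<^bsub>K\<^esub> finsum K (\<lambda>v. finsum K (\<lambda>u. ?m u v) X) ?V"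
          by (rule K.finsum_addf) (use XV in \<open>auto intro!: K.finsum_closed\<close>)
        also have "\<dots> = finsum K (\<lambda>v. ?m x v) ?V \<oplus>\<^bsub>K\<^esub> finsum K (\<lambda>u. finsum K (\<lambda>v. ?m u v) ?V) X"
          using insert by auto
        also have "\<dots> = finsum K (\<lambda>u. finsum K (\<lambda>v. ?m u v) ?V) (insert x X)"
          by (rule K.finsum_insert[symmetric])
            (use insert.hyps XV in \<open>auto intro!: K.finsum_closed simp del: K.finsum_insert\<close>)
        finally show ?case .
      qed
      thus ?thesis using fin by blast
    qed
    also have "\<dots> = finsum K (\<lambda>u. f u \<otimes>\<^bsub>K\<^esub> act u ((g \<otimes>\<^bsub>TA\<^esub> h) (inv\<^bsub>G\<^esub> u \<otimes>\<^bsub>G\<^esub> w))) ?F"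
    proof (rule K.finsum_cong')
      show "(\<lambda>u. f u \<otimes>\<^bsub>K\<^esub> act u ((g \<otimes>\<^bsub>TA\<^esub> h) (inv\<^bsub>G\<^esub> u \<otimes>\<^bsub>G\<^esub> w))) \<in> ?F \<rightarrow> carrier K"
        using F f g h by (auto simp: tw_mult_closed)
      fix u assume u: "u \<in> ?F"
      note uG = F[OF u]
      let ?n = "\<lambda>t. g t \<otimes>\<^bsub>K\<^esub> act t (h (inv\<^bsub>G\<^esub> t \<otimes>\<^bsub>G\<^esub> (inv\<^bsub>G\<^esub> u \<otimes>\<^bsub>G\<^esub> w)))"
      \<comment> \<open>For fixed \<open>u\<close> only those \<open>v = u t\<close> with
        \<open>t\<close> in the support of \<open>g\<close> contribute.\<close>
      have "finsum K (\<lambda>v. ?m u v) ?V = finsum K (\<lambda>v. ?m u v) ((\<otimes>\<^bsub>G\<^esub>) u ` ?T)"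
      proof (rule K.add.finprod_mono_neutral_cong_right)
        show "(\<otimes>\<^bsub>G\<^esub>) u ` ?T \<subseteq> ?V" using u by auto
        fix v assume v: "v \<in> ?V - (\<otimes>\<^bsub>G\<^esub>) u ` ?T"
        hence vG: "v \<in> carrier G" using V by blast
        have "g (inv\<^bsub>G\<^esub> u \<otimes>\<^bsub>G\<^esub> v) = \<zero>\<^bsub>K\<^esub>"
        proof (rule ccontr)
          assume "g (inv\<^bsub>G\<^esub> u \<otimes>\<^bsub>G\<^esub> v) \<noteq> \<zero>\<^bsub>K\<^esub>"
          hence "u \<otimes>\<^bsub>G\<^esub> (inv\<^bsub>G\<^esub> u \<otimes>\<^bsub>G\<^esub> v) \<in> (\<otimes>\<^bsub>G\<^esub>) u ` ?T" by blast
          moreover have "u \<otimes>\<^bsub>G\<^esub> (inv\<^bsub>G\<^esub> u \<otimes>\<^bsub>G\<^esub> v) = v" using uG vG by (simp add: G.m_assoc[symmetric])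
          ultimately show False using v by simp
        qed
        thus "?m u v = \<zero>\<^bsub>K\<^esub>" using uG vG f h by simp
      qed (use fin mc u in auto)
      also have "\<dots> = finsum K (\<lambda>t. ?m u (u \<otimes>\<^bsub>G\<^esub> t)) ?T"
      proof (rule K.finsum_reindex)
        show "(\<lambda>v. ?m u v) \<in> (\<otimes>\<^bsub>G\<^esub>) u ` ?T \<rightarrow> carrier K" using u mc by auto
        show "inj_on ((\<otimes>\<^bsub>G\<^esub>) u) ?T" using uG T by (auto simp: inj_on_def)
      qed
      also have "\<dots> = finsum K (\<lambda>t. f u \<otimes>\<^bsub>K\<^esub> act u (?n t)) ?T"
      proof (rule K.finsum_cong')
        show "(\<lambda>t. f u \<otimes>\<^bsub>K\<^esub> act u (?n t)) \<in> ?T \<rightarrow> carrier K" using uG T f g h by auto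
        fix t assume t: "t \<in> ?T"
        have "inv\<^bsub>G\<^esub> u \<otimes>\<^bsub>G\<^esub> (u \<otimes>\<^bsub>G\<^esub> t) = t" using uG T[OF t] by (simp add: G.m_assoc[symmetric])
        moreover have "inv\<^bsub>G\<^esub> (u \<otimes>\<^bsub>G\<^esub> t) \<otimes>\<^bsub>G\<^esub> w = inv\<^bsub>G\<^esub> t \<otimes>\<^bsub>G\<^esub> (inv\<^bsub>G\<^esub> u \<otimes>\<^bsub>G\<^esub> w)"
          using uG T[OF t] w by (simp add: G.inv_mult_group G.m_assoc)
        ultimately show "?m u (u \<otimes>\<^bsub>G\<^esub> t) = f u \<otimes>\<^bsub>K\<^esub> act u (?n t)"
          using uG T[OF t] f g h by (simp add: act_mult K.m_assoc)
      qed simp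
      also have "\<dots> = f u \<otimes>\<^bsub>K\<^esub> finsum K (\<lambda>t. act u (?n t)) ?T"
        by (rule K.finsum_rdistr[symmetric]) (use fin uG T f g h in auto)
      also have "finsum K (\<lambda>t. act u (?n t)) ?T = act u (finsum K ?n ?T)"
      proof -
        interpret r: ring_hom_cring K K "act u" by (rule act_ring_hom_cring[OF uG])
        have "act u (finsum K ?n ?T) = finsum K (act u \<circ> ?n) ?T"
          by (rule r.hom_finsum) (use T g h in auto)
        thus ?thesis by (simp add: comp_def)
      qed
      also have "finsum K ?n ?T = (g \<otimes>\<^bsub>TA\<^esub> h) (inv\<^bsub>G\<^esub> u \<otimes>\<^bsub>G\<^esub> w)"
        by (rule gh[symmetric]) (use uG w in auto)
      finally show "finsum K (\<lambda>v. ?m u v) ?V =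
         f u \<otimes>\<^bsub>K\<^esub> act u ((g \<otimes>\<^bsub>TA\<^esub> h) (inv\<^bsub>G\<^esub> u \<otimes>\<^bsub>G\<^esub> w))" .
    qed simp
    also have "\<dots> = (f \<otimes>\<^bsub>TA\<^esub> (g \<otimes>\<^bsub>TA\<^esub> h)) w"
      by (rule tw_mult_eq[symmetric]) (use f g h w fin F in \<open>auto simp: tw_mult_closed\<close>)
    finally show ?thesis .
  qed (simp add: tw_mult_outside)
qed

lemma tw_l_distr:
  assumes f: "f \<in> carrier TA" and g: "g \<in> carrier TA" and h: "h \<in> carrier TA"
  shows "(f \<oplus>\<^bsub>TA\<^esub> g) \<otimes>\<^bsub>TA\<^esub> h = f \<otimes>\<^bsub>TA\<^esub> h \<oplus>\<^bsub>TA\<^esub> g \<otimes>\<^bsub>TA\<^esub> h"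
proof
  fix w
  let ?U = "{u. f u \<noteq> \<zero>\<^bsub>K\<^esub>} \<union> {u. g u \<noteq> \<zero>\<^bsub>K\<^esub>}"
  have U: "u \<in> carrier G" if "u \<in> ?U" for u using that tw_support[OF f] tw_support[OF g] by auto
  have fin: "finite ?U" using f g by (auto simp: tw_finite)
  show "((f \<oplus>\<^bsub>TA\<^esub> g) \<otimes>\<^bsub>TA\<^esub> h) w = (f \<otimes>\<^bsub>TA\<^esub> h \<oplus>\<^bsub>TA\<^esub> g \<otimes>\<^bsub>TA\<^esub> h) w"
  proof (cases "w \<in> carrier G")
    case w: True
    let ?s = "\<lambda>k. finsum K (\<lambda>u. k u \<otimes>\<^bsub>K\<^esub> act u (h (inv\<^bsub>G\<^esub> u \<otimes>\<^bsub>G\<^esub> w))) ?U"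
    have "((f \<oplus>\<^bsub>TA\<^esub> g) \<otimes>\<^bsub>TA\<^esub> h) w = ?s (f \<oplus>\<^bsub>TA\<^esub> g)"
      by (rule tw_mult_eq) (use f g h w fin U in \<open>auto simp: tw_add_closed tw_add\<close>)
    also have "\<dots> = finsum K (\<lambda>u. f u \<otimes>\<^bsub>K\<^esub> act u (h (inv\<^bsub>G\<^esub> u \<otimes>\<^bsub>G\<^esub> w)) \<oplus>\<^bsub>K\<^esub>
        g u \<otimes>\<^bsub>K\<^esub> act u (h (inv\<^bsub>G\<^esub> u \<otimes>\<^bsub>G\<^esub> w))) ?U"
      by (rule K.finsum_cong') (use f g h U in \<open>auto simp: tw_add K.l_distr\<close>)
    also have "\<dots> = ?s f \<oplus>\<^bsub>K\<^esub> ?s g"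
      by (rule K.finsum_addf) (use f g h U in auto)
    also have "?s f = (f \<otimes>\<^bsub>TA\<^esub> h) w"
      by (rule tw_mult_eq[symmetric]) (use f h w fin U in auto)
    also have "?s g = (g \<otimes>\<^bsub>TA\<^esub> h) w"
      by (rule tw_mult_eq[symmetric]) (use g h w fin U in auto)
    also have "(f \<otimes>\<^bsub>TA\<^esub> h) w \<oplus>\<^bsub>K\<^esub> (g \<otimes>\<^bsub>TA\<^esub> h) w = (f \<otimes>\<^bsub>TA\<^esub> h \<oplus>\<^bsub>TA\<^esub> g \<otimes>\<^bsub>TA\<^esub> h) w"
      by (rule tw_add[symmetric])
    finally show ?thesis .
  qed (simp add: tw_mult_outside tw_add)
qed

lemma tw_r_distr:
  assumes f: "f \<in> carrier TA" and g: "g \<in> carrier TA" and h: "h \<in> carrier TA"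
  shows "h \<otimes>\<^bsub>TA\<^esub> (f \<oplus>\<^bsub>TA\<^esub> g) = h \<otimes>\<^bsub>TA\<^esub> f \<oplus>\<^bsub>TA\<^esub> h \<otimes>\<^bsub>TA\<^esub> g"
proof
  fix w
  let ?U = "{u. h u \<noteq> \<zero>\<^bsub>K\<^esub>}"
  have U: "u \<in> carrier G" if "u \<in> ?U" for u using that tw_support[OF h] by auto
  have fin: "finite ?U" using h by (auto simp: tw_finite)
  show "(h \<otimes>\<^bsub>TA\<^esub> (f \<oplus>\<^bsub>TA\<^esub> g)) w = (h \<otimes>\<^bsub>TA\<^esub> f \<oplus>\<^bsub>TA\<^esub> h \<otimes>\<^bsub>TA\<^esub> g) w"
  proof (cases "w \<in> carrier G")
    case w: True
    let ?s = "\<lambda>k. finsum K (\<lambda>u. h u \<otimes>\<^bsub>K\<^esub> act u (k (inv\<^bsub>G\<^esub> u \<otimes>\<^bsub>G\<^esub> w))) ?U"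
    have e: "(h \<otimes>\<^bsub>TA\<^esub> k) w = ?s k" if "k \<in> carrier TA" for k
      by (rule tw_mult_eq) (use h that w fin U in auto)
    have "?s (f \<oplus>\<^bsub>TA\<^esub> g) = finsum K (\<lambda>u. h u \<otimes>\<^bsub>K\<^esub> act u (f (inv\<^bsub>G\<^esub> u \<otimes>\<^bsub>G\<^esub> w)) \<oplus>\<^bsub>K\<^esub>
        h u \<otimes>\<^bsub>K\<^esub> act u (g (inv\<^bsub>G\<^esub> u \<otimes>\<^bsub>G\<^esub> w))) ?U"
      by (rule K.finsum_cong') (use f g h U in \<open>auto simp: tw_add K.r_distr\<close>)
    also have "\<dots> = ?s f \<oplus>\<^bsub>K\<^esub> ?s g"
      by (rule K.finsum_addf) (use f g h U in auto)
    finally show ?thesis by (simp add: tw_add e f g tw_add_closed)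
  qed (simp add: tw_mult_outside tw_add)
qed

lemma tw_ext:
  assumes "f \<in> carrier TA" "g \<in> carrier TA" "\<And>u. u \<in> carrier G \<Longrightarrow> f u = g u" shows "f = g"
  using assms by (metis tw_outside ext)

lemma tw_ring: "ring TA"
proof (rule ringI)
  show "abelian_group TA"
  proof (rule abelian_groupI)
    fix f assume f: "f \<in> carrier TA"
    hence fin: "finite {u. \<ominus>\<^bsub>K\<^esub> f u \<noteq> \<zero>\<^bsub>K\<^esub>}"
      by (intro finite_subset[OF _ tw_finite[OF f]]) auto
    show "\<exists>g\<in>carrier TA. g \<oplus>\<^bsub>TA\<^esub> f = \<zero>\<^bsub>TA\<^esub>"
      by (rule bexI[of _ "\<lambda>u. \<ominus>\<^bsub>K\<^esub> f u"])
        (use f fin in \<open>auto simp: fun_eq_iff tw_add tw_zero tw_carrier_iff K.l_neg\<close>)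
  qed (auto simp: fun_eq_iff tw_add tw_zero K.a_ac tw_add_closed, auto simp: tw_carrier_iff)
  show "monoid TA"
  proof (rule monoidI)
    show "\<one>\<^bsub>TA\<^esub> \<in> carrier TA" by (simp add: tw_one)
    fix f assume f: "f \<in> carrier TA"
    show "\<one>\<^bsub>TA\<^esub> \<otimes>\<^bsub>TA\<^esub> f = f"
      by (rule tw_ext) (use f in \<open>auto simp: tw_one tw_mult_closed tw_elem_mult_left act_one\<close>)
    show "f \<otimes>\<^bsub>TA\<^esub> \<one>\<^bsub>TA\<^esub> = f"
      by (rule tw_ext) (use f in \<open>auto simp: tw_one tw_mult_closed tw_elem_mult_right\<close>)
  qed (auto simp: tw_mult_closed tw_assoc)
qed (auto simp: tw_l_distr tw_r_distr)

sublocale TA: ring TA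
  by (rule tw_ring)

lemma tw_a_inv: "f \<in> carrier TA \<Longrightarrow> (\<ominus>\<^bsub>TA\<^esub> f) u = \<ominus>\<^bsub>K\<^esub> f u"
  by (metis K.minus_equality TA.a_inv_closed TA.l_neg tw_add tw_coeff tw_zero)

lemma tw_minus:
  "f \<in> carrier TA \<Longrightarrow> g \<in> carrier TA \<Longrightarrow> (f \<ominus>\<^bsub>TA\<^esub> g) u = f u \<ominus>\<^bsub>K\<^esub> g u"
  by (simp add: TA.minus_eq K.minus_eq tw_add tw_a_inv)

lemma tw_finsum:
  assumes "finite X" "\<And>x. x \<in> X \<Longrightarrow> f x \<in> carrier TA"
  shows "finsum TA f X u = finsum K (\<lambda>x. f x u) X"
  using assms
proof (induction X)
  case (insert x X)
  thus ?case by (simp add: TA.finsum_insert K.finsum_insert Pi_def tw_add)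
qed (simp add: tw_zero)

lemma tw_elem_mult:
  assumes [simp]: "c \<in> carrier K" "d \<in> carrier K" "u \<in> carrier G" "v \<in> carrier G"
  shows "tw_elem K c u \<otimes>\<^bsub>TA\<^esub> tw_elem K d v = tw_elem K (c \<otimes>\<^bsub>K\<^esub> act u d) (u \<otimes>\<^bsub>G\<^esub> v)"
proof (rule tw_ext)
  fix w assume w: "w \<in> carrier G"
  have "inv\<^bsub>G\<^esub> u \<otimes>\<^bsub>G\<^esub> w = v \<longleftrightarrow> w = u \<otimes>\<^bsub>G\<^esub> v"
    using w assms by (simp add: G.inv_solve_left')
  thus "(tw_elem K c u \<otimes>\<^bsub>TA\<^esub> tw_elem K d v) w = tw_elem K (c \<otimes>\<^bsub>K\<^esub> act u d) (u \<otimes>\<^bsub>G\<^esub> v) w"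
    using w by (simp add: tw_elem_mult_left) (simp add: tw_elem_def)
qed (auto simp: tw_mult_closed)

lemma eta_mult: "u \<in> carrier G \<Longrightarrow> v \<in> carrier G \<Longrightarrow> eta u \<otimes>\<^bsub>TA\<^esub> eta v = eta (u \<otimes>\<^bsub>G\<^esub> v)"
  by (simp add: tw_elem_mult)

lemma sc_mult: "c \<in> carrier K \<Longrightarrow> d \<in> carrier K \<Longrightarrow> sc c \<otimes>\<^bsub>TA\<^esub> sc d = sc (c \<otimes>\<^bsub>K\<^esub> d)"
  by (simp add: tw_elem_mult act_one)

lemma eta_sc: "u \<in> carrier G \<Longrightarrow> c \<in> carrier K \<Longrightarrow> eta u \<otimes>\<^bsub>TA\<^esub> sc c = sc (act u c) \<otimes>\<^bsub>TA\<^esub> eta u"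
  by (simp add: tw_elem_mult)

lemma sc_add: "c \<in> carrier K \<Longrightarrow> d \<in> carrier K \<Longrightarrow> sc c \<oplus>\<^bsub>TA\<^esub> sc d = sc (c \<oplus>\<^bsub>K\<^esub> d)"
  by (auto simp: fun_eq_iff tw_add tw_elem_def)

lemma sc_one: "sc \<one>\<^bsub>K\<^esub> = \<one>\<^bsub>TA\<^esub>" and sc_zero: "sc \<zero>\<^bsub>K\<^esub> = \<zero>\<^bsub>TA\<^esub>"
  by (auto simp: tw_one tw_zero tw_elem_def)

end

section \<open>Reflections and Weyl groups\<close>

lemma reflection_linear: "linear (reflection \<alpha>)"
  by (rule linearI) (auto simp: reflection_def inner_left_distrib algebra_simps)

lemma inner_coroot: "v \<bullet> coroot \<alpha> = 2 * (v \<bullet> \<alpha>) / (\<alpha> \<bullet> \<alpha>)"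
  by (simp add: coroot_def)

lemma reflection_inner: "reflection \<alpha> x \<bullet> reflection \<alpha> y = x \<bullet> y"
proof (cases "\<alpha> = 0")
  case False
  thus ?thesis
    by (simp add: reflection_def inner_coroot inner_diff_left inner_diff_right inner_commute field_simps)
qed (simp add: reflection_def)

lemma reflection_invol: "reflection \<alpha> (reflection \<alpha> x) = x"
proof (cases "\<alpha> = 0")
  case False
  thus ?thesis
    by (simp add: reflection_def inner_coroot inner_diff_left field_simps)
qed (simp add: reflection_def)

lemma reflection_comp_self: "reflection \<alpha> \<circ> reflection \<alpha> = id"
  by (auto simp: reflection_invol)

lemma reflection_self: "\<alpha> \<noteq> 0 \<Longrightarrow> reflection \<alpha> \<alpha> = - \<alpha>"
  by (simp add: reflection_def inner_coroot scaleR_2)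

section \<open>The Weyl group as a finite group of isometries\<close>

lemma weyl_linear: "w \<in> weyl_group X \<Longrightarrow> linear w"
proof (induction rule: weyl_group.induct)
  case id
  show ?case by (rule linear_id)
next
  case (reflect \<alpha> w)
  show ?case by (rule linear_compose[OF reflect.IH reflection_linear])
qed

lemma weyl_inner: "w \<in> weyl_group X \<Longrightarrow> w x \<bullet> w y = x \<bullet> y"
  by (induction rule: weyl_group.induct) (auto simp: reflection_inner)

lemma weyl_comp: "v \<in> weyl_group X \<Longrightarrow> w \<in> weyl_group X \<Longrightarrow> v \<circ> w \<in> weyl_group X"
  by (induction rule: weyl_group.induct) (auto simp: o_assoc[symmetric] intro: weyl_group.reflect)

lemma weyl_reflection: "\<alpha> \<in> X \<Longrightarrow> reflection \<alpha> \<in> weyl_group X"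
  using weyl_group.reflect[OF _ weyl_group.id] by fastforce

lemma weyl_inverse_ex:
  assumes "w \<in> weyl_group X" shows "\<exists>v\<in>weyl_group X. v \<circ> w = id \<and> w \<circ> v = id"
  using assms
proof induction
  case id
  show ?case by (intro bexI[of _ id] weyl_group.id) simp
next
  case (reflect \<alpha> w)
  then obtain v where v: "v \<in> weyl_group X" "v \<circ> w = id" "w \<circ> v = id" by blast
  have "v \<circ> reflection \<alpha> \<in> weyl_group X" by (intro weyl_comp v weyl_reflection reflect)
  moreover have "(v \<circ> reflection \<alpha>) \<circ> (reflection \<alpha> \<circ> w) = id"
    using v(2) by (auto simp: fun_eq_iff reflection_invol)
  moreover have "(reflection \<alpha> \<circ> w) \<circ> (v \<circ> reflection \<alpha>) = id"
    using v(3) by (auto simp: fun_eq_iff reflection_invol)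
  ultimately show ?case by blast
qed

lemma weyl_bij: "w \<in> weyl_group X \<Longrightarrow> bij w"
  using weyl_inverse_ex o_bij by blast

lemma weyl_inv: "w \<in> weyl_group X \<Longrightarrow> inv_into UNIV w \<in> weyl_group X"
  using weyl_inverse_ex inv_unique_comp by metis

lemma weyl_inv_simps:
  assumes "w \<in> weyl_group X" shows "inv_into UNIV w (w x) = x" "w (inv_into UNIV w x) = x"
  using weyl_bij[OF assms] by (auto simp: bij_is_inj bij_is_surj inv_f_f surj_f_inv_f)

lemma coroot_weyl: "w \<in> weyl_group X \<Longrightarrow> w (coroot \<alpha>) = coroot (w \<alpha>)"
  by (simp add: coroot_def weyl_inner linear_cmul[OF weyl_linear])

lemma reflection_conj:
  assumes "w \<in> weyl_group X" shows "w \<circ> reflection \<alpha> = reflection (w \<alpha>) \<circ> w"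
proof
  fix x
  have "w x \<bullet> coroot (w \<alpha>) = x \<bullet> coroot \<alpha>"
    using weyl_inner[OF assms] coroot_weyl[OF assms] by metis
  thus "(w \<circ> reflection \<alpha>) x = (reflection (w \<alpha>) \<circ> w) x"
    by (simp add: reflection_def linear_diff[OF weyl_linear[OF assms]] linear_cmul[OF weyl_linear[OF assms]])
qed

section \<open>Integer lattices and their preservation under linear maps\<close>

lemma int_lattice_zero: "0 \<in> int_lattice X"
  unfolding int_lattice_def by (rule range_eqI[of _ _ "\<lambda>_. 0"]) simp

lemma int_lattice_add: "x \<in> int_lattice X \<Longrightarrow> y \<in> int_lattice X \<Longrightarrow> x + y \<in> int_lattice X"
proof -
  assume "x \<in> int_lattice X" "y \<in> int_lattice X"
  then obtain c d where "x = (\<Sum>x\<in>X. of_int (c x) *\<^sub>R x)" "y = (\<Sum>x\<in>X. of_int (d x) *\<^sub>R x)"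
    by (auto simp: int_lattice_def)
  thus ?thesis unfolding int_lattice_def
    by (intro range_eqI[of _ _ "\<lambda>x. c x + d x"]) (simp add: scaleR_left_distrib sum.distrib)
qed

lemma int_lattice_scale: "x \<in> int_lattice X \<Longrightarrow> of_int k *\<^sub>R x \<in> int_lattice X"
proof -
  assume "x \<in> int_lattice X"
  then obtain c where "x = (\<Sum>x\<in>X. of_int (c x) *\<^sub>R x)" by (auto simp: int_lattice_def)
  thus ?thesis unfolding int_lattice_def
    by (intro range_eqI[of _ _ "\<lambda>x. k * c x"]) (simp add: scaleR_right.sum)
qed

lemma int_lattice_uminus: "x \<in> int_lattice X \<Longrightarrow> - x \<in> int_lattice X"
  using int_lattice_scale[of x X "-1"] by simp

lemma int_lattice_incl: "finite X \<Longrightarrow> x \<in> X \<Longrightarrow> x \<in> int_lattice X"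
  unfolding int_lattice_def
  by (rule range_eqI[of _ _ "\<lambda>y. if y = x then 1 else 0"]) (simp add: if_distrib[of "\<lambda>c. of_int c *\<^sub>R _"] cong: if_cong)

lemma int_lattice_sum: "(\<And>i. i \<in> I \<Longrightarrow> f i \<in> int_lattice X) \<Longrightarrow> sum f I \<in> int_lattice X"
  by (induction I rule: infinite_finite_induct) (auto intro: int_lattice_zero int_lattice_add)

lemma int_lattice_linear:
  assumes "linear w" "\<And>x. x \<in> X \<Longrightarrow> w x \<in> int_lattice Y" "x \<in> int_lattice X"
  shows "w x \<in> int_lattice Y"
proof -
  obtain c where x: "x = (\<Sum>x\<in>X. of_int (c x) *\<^sub>R x)"
    using assms(3) by (auto simp: int_lattice_def)
  show ?thesis
    unfolding x linear_sum[OF assms(1)] linear_cmul[OF assms(1)]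
    by (intro int_lattice_sum int_lattice_scale assms(2))
qed

locale root_sys =
  fixes \<Phi> :: "'v::euclidean_space set"
  assumes rs: "root_system \<Phi>"
begin

abbreviation "W \<equiv> weyl_group \<Phi>"
abbreviation "RtL \<equiv> root_lattice \<Phi>"
abbreviation "CrL \<equiv> coroot_lattice \<Phi>"

lemma finite_roots: "finite \<Phi>" and span_roots: "span \<Phi> = UNIV" and root_nonzero: "\<alpha> \<in> \<Phi> \<Longrightarrow> \<alpha> \<noteq> 0"
  and reflection_roots: "\<alpha> \<in> \<Phi> \<Longrightarrow> reflection \<alpha> ` \<Phi> = \<Phi>"
  and roots_int: "\<alpha> \<in> \<Phi> \<Longrightarrow> \<beta> \<in> \<Phi> \<Longrightarrow> \<beta> \<bullet> coroot \<alpha> \<in> \<int>"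
  and roots_reduced: "\<alpha> \<in> \<Phi> \<Longrightarrow> c *\<^sub>R \<alpha> \<in> \<Phi> \<Longrightarrow> c = 1 \<or> c = -1"
  using rs by (auto simp: root_system_def)

lemma weyl_roots: "w \<in> W \<Longrightarrow> w ` \<Phi> = \<Phi>"
proof (induction rule: weyl_group.induct)
  case (reflect \<alpha> w)
  have "(reflection \<alpha> \<circ> w) ` \<Phi> = reflection \<alpha> ` w ` \<Phi>" by (rule image_comp[symmetric])
  thus ?case using reflect by (simp add: reflection_roots)
qed simp

lemma weyl_root: "w \<in> W \<Longrightarrow> \<alpha> \<in> \<Phi> \<Longrightarrow> w \<alpha> \<in> \<Phi>"
  using weyl_roots by blast

lemma uminus_root: "\<alpha> \<in> \<Phi> \<Longrightarrow> - \<alpha> \<in> \<Phi>"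
  using weyl_root[OF weyl_reflection, of \<alpha> \<alpha>] reflection_self[OF root_nonzero] by auto

lemma weyl_eqI:
  assumes "v \<in> W" "w \<in> W" "\<And>\<alpha>. \<alpha> \<in> \<Phi> \<Longrightarrow> v \<alpha> = w \<alpha>" shows "v = w"
proof
  fix x
  show "v x = w x"
    by (rule linear_eq_on_span[OF weyl_linear[OF assms(1)] weyl_linear[OF assms(2)] assms(3)])
      (auto simp: span_roots)
qed

text \<open>The roots span, so an element of \<open>W\<close> is determined by its restriction to
  the finite set of roots, which it maps to itself.\<close>

lemma finite_weyl: "finite W"
proof (rule finite_imageD)
  have "(\<lambda>w. restrict w \<Phi>) ` W \<subseteq> \<Phi> \<rightarrow>\<^sub>E \<Phi>" using weyl_root by auto
  thus "finite ((\<lambda>w. restrict w \<Phi>) ` W)"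
    using finite_PiE[OF finite_roots, of "\<lambda>_. \<Phi>"] finite_roots finite_subset by blast
  show "inj_on (\<lambda>w. restrict w \<Phi>) W"
  proof (rule inj_onI)
    fix v w assume "v \<in> W" "w \<in> W" "restrict v \<Phi> = restrict w \<Phi>"
    thus "v = w" by (intro weyl_eqI) (simp_all, metis restrict_apply')
  qed
qed

lemma RtL_root: "\<alpha> \<in> \<Phi> \<Longrightarrow> \<alpha> \<in> RtL"
  by (rule int_lattice_incl[OF finite_roots])

lemma CrL_coroot: "\<alpha> \<in> \<Phi> \<Longrightarrow> coroot \<alpha> \<in> CrL"
  by (rule int_lattice_incl) (auto simp: finite_roots)

lemma RtL_weyl: "w \<in> W \<Longrightarrow> x \<in> RtL \<Longrightarrow> w x \<in> RtL"
  by (rule int_lattice_linear[OF weyl_linear _ , of w \<Phi>]) (simp_all add: RtL_root weyl_root)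

lemma CrL_weyl: "w \<in> W \<Longrightarrow> x \<in> CrL \<Longrightarrow> w x \<in> CrL"
proof -
  assume w: "w \<in> W" and x: "x \<in> CrL"
  show "w x \<in> CrL"
  proof (rule int_lattice_linear[OF weyl_linear[OF w] _ x])
    fix y assume "y \<in> coroot ` \<Phi>"
    then obtain \<alpha> where "\<alpha> \<in> \<Phi>" "y = coroot \<alpha>" by blast
    thus "w y \<in> CrL" using CrL_coroot[OF weyl_root[OF w]] by (simp add: coroot_weyl[OF w])
  qed
qed

lemma RtL_weyl_image: "w \<in> W \<Longrightarrow> w ` RtL = RtL"
proof (intro equalityI subsetI)
  fix x assume w: "w \<in> W" and x: "x \<in> RtL"
  have "inv_into UNIV w x \<in> RtL" by (rule RtL_weyl[OF weyl_inv[OF w] x])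
  thus "x \<in> w ` RtL" using weyl_inv_simps(2)[OF w, of x] by (metis image_eqI)
qed (auto simp: RtL_weyl)

lemma RtL_int: "x \<in> RtL \<Longrightarrow> \<alpha> \<in> \<Phi> \<Longrightarrow> x \<bullet> coroot \<alpha> \<in> \<int>"
proof -
  assume "x \<in> RtL" and \<alpha>: "\<alpha> \<in> \<Phi>"
  then obtain c where x: "x = (\<Sum>x\<in>\<Phi>. of_int (c x) *\<^sub>R x)" by (auto simp: int_lattice_def)
  show "x \<bullet> coroot \<alpha> \<in> \<int>"
    unfolding x inner_sum_left inner_scaleR_left
    by (intro Ints_sum Ints_mult roots_int Ints_of_int \<alpha>)
qed

lemma affine_weyl_group_group: "group (affine_weyl_group \<Phi>)"
proof (rule groupI)
  fix x y assume "x \<in> carrier (affine_weyl_group \<Phi>)" "y \<in> carrier (affine_weyl_group \<Phi>)"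
  thus "x \<otimes>\<^bsub>affine_weyl_group \<Phi>\<^esub> y \<in> carrier (affine_weyl_group \<Phi>)"
    by (auto simp: affine_weyl_group_def intro: int_lattice_add CrL_weyl weyl_comp)
next
  show "\<one>\<^bsub>affine_weyl_group \<Phi>\<^esub> \<in> carrier (affine_weyl_group \<Phi>)"
    by (auto simp: affine_weyl_group_def int_lattice_zero weyl_group.id)
next
  fix x y z assume "x \<in> carrier (affine_weyl_group \<Phi>)"
  thus "x \<otimes>\<^bsub>affine_weyl_group \<Phi>\<^esub> y \<otimes>\<^bsub>affine_weyl_group \<Phi>\<^esub> z =
     x \<otimes>\<^bsub>affine_weyl_group \<Phi>\<^esub> (y \<otimes>\<^bsub>affine_weyl_group \<Phi>\<^esub> z)"
    by (auto simp: affine_weyl_group_def split_def linear_add[OF weyl_linear] o_assoc)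
next
  fix x assume "x \<in> carrier (affine_weyl_group \<Phi>)"
  then obtain \<mu> w where x: "x = (\<mu>, w)" "\<mu> \<in> CrL" "w \<in> W" by (auto simp: affine_weyl_group_def)
  show "\<one>\<^bsub>affine_weyl_group \<Phi>\<^esub> \<otimes>\<^bsub>affine_weyl_group \<Phi>\<^esub> x = x"
    by (auto simp: affine_weyl_group_def x)
  have "(- inv_into UNIV w \<mu>, inv_into UNIV w) \<in> carrier (affine_weyl_group \<Phi>)"
    using x by (auto simp: affine_weyl_group_def int_lattice_uminus CrL_weyl weyl_inv)
  moreover have "(- inv_into UNIV w \<mu>, inv_into UNIV w) \<otimes>\<^bsub>affine_weyl_group \<Phi>\<^esub> x = \<one>\<^bsub>affine_weyl_group \<Phi>\<^esub>"
    using x by (auto simp: affine_weyl_group_def fun_eq_iff weyl_inv_simps)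
  ultimately show "\<exists>y\<in>carrier (affine_weyl_group \<Phi>). y \<otimes>\<^bsub>affine_weyl_group \<Phi>\<^esub> x = \<one>\<^bsub>affine_weyl_group \<Phi>\<^esub>"
    by blast
qed

end

subsection \<open>Nontrivial Weyl group elements move the lattice along a root\<close>

text \<open>A real subspace is not a finite union of proper subspaces. Starting from
  \<open>x\<close>, which is good for \<open>X\<close>, and \<open>y\<close>, which is good for
  \<alpha>, each \<beta> not orthogonal to \<open>y\<close> excludes one point of the line
  \<open>x + t y\<close>.\<close>

lemma regular_vector_ex:
  assumes "finite X" "subspace U" "\<And>\<alpha>. \<alpha> \<in> X \<Longrightarrow> \<exists>x\<in>U. \<alpha> \<bullet> x \<noteq> 0"
  shows "\<exists>x\<in>U. \<forall>\<alpha>\<in>X. \<alpha> \<bullet> x \<noteq> (0::real)"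
  using assms(1,3)
proof (induction X)
  case empty
  thus ?case using subspace_0[OF assms(2)] by blast
next
  case (insert \<alpha> X)
  then obtain x y where x: "x \<in> U" "\<forall>\<beta>\<in>X. \<beta> \<bullet> x \<noteq> 0" and y: "y \<in> U" "\<alpha> \<bullet> y \<noteq> 0" by blast
  \<comment> \<open>If \<beta> is orthogonal to \<open>y\<close>, the quotient is 0 by the
    convention for division, and excluding \<open>t = 0\<close> as well does no harm.\<close>
  let ?bad = "insert (- (\<alpha> \<bullet> x) / (\<alpha> \<bullet> y)) ((\<lambda>\<beta>. - (\<beta> \<bullet> x) / (\<beta> \<bullet> y)) ` X)"
  have "finite ?bad" using insert.hyps by simp
  then obtain t where t: "t \<notin> ?bad" using ex_new_if_finite infinite_UNIV_char_0 by blast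
  have "\<beta> \<bullet> (x + t *\<^sub>R y) \<noteq> 0" if \<beta>: "\<beta> \<in> insert \<alpha> X" for \<beta>
  proof (cases "\<beta> \<bullet> y = 0")
    case True
    hence "\<beta> \<in> X" using \<beta> y by auto
    thus ?thesis using x True by (auto simp: inner_right_distrib)
  next
    case False
    have "t \<noteq> - (\<beta> \<bullet> x) / (\<beta> \<bullet> y)" using t \<beta> by auto
    thus ?thesis using False by (auto simp: inner_right_distrib field_simps)
  qed
  moreover have "x + t *\<^sub>R y \<in> U" using x y assms(2) by (intro subspace_add subspace_scale)
  ultimately show ?case by blast
qed

text \<open>Words are kept as explicit lists because the stabilizer argument below needs a
  representation of minimal length.\<close>

definition word :: "'v::euclidean_space list \<Rightarrow> 'v \<Rightarrow> 'v" where
  "word ds = foldr (\<lambda>\<delta> f. reflection \<delta> \<circ> f) ds id"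

lemma word_simps: "word [] = id" "word (\<delta> # ds) = reflection \<delta> \<circ> word ds"
  by (auto simp: word_def)

lemma word_append: "word (ds @ es) = word ds \<circ> word es"
  by (induction ds) (auto simp: word_simps o_assoc)

lemma word_in_weyl: "set ds \<subseteq> X \<Longrightarrow> word ds \<in> weyl_group X"
  by (induction ds) (auto simp: word_simps intro: weyl_group.intros)

lemma weyl_word_ex: "w \<in> weyl_group X \<Longrightarrow> \<exists>ds. set ds \<subseteq> X \<and> w = word ds"
proof (induction rule: weyl_group.induct)
  case id
  show ?case by (rule exI[of _ "[]"]) (simp add: word_simps)
next
  case (reflect \<alpha> w)
  then obtain ds where "set ds \<subseteq> X" "w = word ds" by blast
  thus ?case using reflect.hyps by (intro exI[of _ "\<alpha> # ds"]) (simp add: word_simps)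
qed

lemma weyl_mono: "X \<subseteq> Y \<Longrightarrow> w \<in> weyl_group X \<Longrightarrow> w \<in> weyl_group Y"
  by (rotate_tac, induction rule: weyl_group.induct) (auto intro: weyl_group.intros)

locale based_root_sys = root_sys \<Phi> for \<Phi> :: "'v::euclidean_space set" +
  fixes \<Delta>
  assumes sr: "simple_roots \<Phi> \<Delta>"
begin

lemma simple_root: "\<delta> \<in> \<Delta> \<Longrightarrow> \<delta> \<in> \<Phi>" and simple_indep: "independent \<Delta>"
  and root_cone: "\<alpha> \<in> \<Phi> \<Longrightarrow> \<alpha> \<in> nat_cone \<Delta> \<or> - \<alpha> \<in> nat_cone \<Delta>"
  using sr by (auto simp: simple_roots_def)

lemma finite_simple: "finite \<Delta>"
  by (rule finite_subset[OF _ finite_roots]) (use simple_root in blast)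

text \<open>The coordinate along \<delta> with respect to the simple roots. Its extension beyond
  their span is an arbitrary choice; it is only evaluated where the expansion in simple roots fixes
  the value.\<close>

definition co :: "'v \<Rightarrow> 'v \<Rightarrow> real" where
  "co \<delta> = (SOME f. linear f \<and> (\<forall>\<epsilon>\<in>\<Delta>. f \<epsilon> = (if \<epsilon> = \<delta> then 1 else 0)))"

lemma co: "linear (co \<delta>)" "\<epsilon> \<in> \<Delta> \<Longrightarrow> co \<delta> \<epsilon> = (if \<epsilon> = \<delta> then 1 else 0)"
proof -
  have "\<exists>f. linear f \<and> (\<forall>\<epsilon>\<in>\<Delta>. f \<epsilon> = (if \<epsilon> = \<delta> then 1 else (0::real)))"
    by (rule linear_independent_extend[OF simple_indep])
  from someI_ex[OF this] show "linear (co \<delta>)" "\<epsilon> \<in> \<Delta> \<Longrightarrow> co \<delta> \<epsilon> = (if \<epsilon> = \<delta> then 1 else 0)"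
    by (auto simp: co_def)
qed

lemma cone_expand:
  assumes "\<alpha> \<in> nat_cone \<Delta>"
  shows "\<alpha> = (\<Sum>\<delta>\<in>\<Delta>. co \<delta> \<alpha> *\<^sub>R \<delta>)" "\<delta> \<in> \<Delta> \<Longrightarrow> co \<delta> \<alpha> \<in> \<nat>"
proof -
  obtain c :: "'v \<Rightarrow> nat" where c: "\<alpha> = (\<Sum>x\<in>\<Delta>. of_nat (c x) *\<^sub>R x)"
    using assms by (auto simp: nat_cone_def)
  have co_c: "co \<delta> \<alpha> = of_nat (c \<delta>)" if "\<delta> \<in> \<Delta>" for \<delta>
  proof -
    have "co \<delta> \<alpha> = (\<Sum>x\<in>\<Delta>. of_nat (c x) * (if x = \<delta> then 1 else 0))"
      unfolding c by (simp add: linear_sum[OF co(1)] linear_cmul[OF co(1)] co(2))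
    also have "\<dots> = (\<Sum>x\<in>\<Delta>. if x = \<delta> then of_nat (c x) else 0)" by (rule sum.cong) auto
    finally show ?thesis using that finite_simple by simp
  qed
  have "(\<Sum>\<delta>\<in>\<Delta>. co \<delta> \<alpha> *\<^sub>R \<delta>) = (\<Sum>x\<in>\<Delta>. of_nat (c x) *\<^sub>R x)"
    by (rule sum.cong) (simp_all add: co_c)
  with c show "\<alpha> = (\<Sum>\<delta>\<in>\<Delta>. co \<delta> \<alpha> *\<^sub>R \<delta>)" by (rule trans[OF _ sym])
  show "\<delta> \<in> \<Delta> \<Longrightarrow> co \<delta> \<alpha> \<in> \<nat>" by (simp add: co_c)
qed

section \<open>Positive roots and simple reflections\<close>

definition pos :: "'v \<Rightarrow> bool" where "pos \<alpha> \<longleftrightarrow> \<alpha> \<in> \<Phi> \<and> \<alpha> \<in> nat_cone \<Delta>"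

lemma pos_or_neg: "\<alpha> \<in> \<Phi> \<Longrightarrow> pos \<alpha> \<or> pos (- \<alpha>)"
  using root_cone uminus_root by (auto simp: pos_def)

lemma pos_root: "pos \<alpha> \<Longrightarrow> \<alpha> \<in> \<Phi>" by (simp add: pos_def)

lemma pos_co_nonneg: "pos \<alpha> \<Longrightarrow> \<delta> \<in> \<Delta> \<Longrightarrow> co \<delta> \<alpha> \<ge> 0"
  using cone_expand(2)[of \<alpha> \<delta>] by (auto simp: pos_def Nats_def)

lemma pos_co_ex: "pos \<alpha> \<Longrightarrow> \<exists>\<delta>\<in>\<Delta>. co \<delta> \<alpha> > 0"
proof (rule ccontr)
  assume a: "pos \<alpha>" "\<not> (\<exists>\<delta>\<in>\<Delta>. co \<delta> \<alpha> > 0)"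
  hence "co \<delta> \<alpha> = 0" if "\<delta> \<in> \<Delta>" for \<delta> using pos_co_nonneg[OF a(1) that] that by force
  hence "\<alpha> = 0" using cone_expand(1)[of \<alpha>] a(1) by (simp add: pos_def)
  thus False using a root_nonzero pos_root by blast
qed

text \<open>The coordinates of a root all have the same sign, so one strictly positive coordinate
  decides.\<close>

lemma posI: "\<alpha> \<in> \<Phi> \<Longrightarrow> \<delta> \<in> \<Delta> \<Longrightarrow> co \<delta> \<alpha> > 0 \<Longrightarrow> pos \<alpha>"
  using pos_or_neg[of \<alpha>] pos_co_nonneg[of "- \<alpha>" \<delta>] linear_neg[OF co(1), of \<delta> \<alpha>] by auto

lemma not_pos_neg: "pos \<alpha> \<Longrightarrow> \<not> pos (- \<alpha>)"
proof
  assume a: "pos \<alpha>" "pos (- \<alpha>)"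
  obtain \<delta> where "\<delta> \<in> \<Delta>" "co \<delta> \<alpha> > 0" using pos_co_ex[OF a(1)] by blast
  thus False using pos_co_nonneg[OF a(2)] linear_neg[OF co(1), of \<delta> \<alpha>] by force
qed

lemma simple_pos: "\<delta> \<in> \<Delta> \<Longrightarrow> pos \<delta>"
  by (rule posI[of _ \<delta>]) (auto simp: simple_root co(2))

lemma pos_inner_expand:
  assumes "pos \<alpha>" shows "\<alpha> \<bullet> x = (\<Sum>\<delta>\<in>\<Delta>. co \<delta> \<alpha> * (\<delta> \<bullet> x))"
proof -
  have "\<alpha> \<bullet> x = (\<Sum>\<delta>\<in>\<Delta>. co \<delta> \<alpha> *\<^sub>R \<delta>) \<bullet> x"
    using cone_expand(1)[of \<alpha>] assms by (simp add: pos_def)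
  thus ?thesis by (simp add: inner_sum_left)
qed

lemma pos_inner:
  assumes "pos \<alpha>" "\<And>\<delta>. \<delta> \<in> \<Delta> \<Longrightarrow> \<delta> \<bullet> x > 0" shows "\<alpha> \<bullet> x > 0"
proof -
  obtain \<epsilon> where \<epsilon>: "\<epsilon> \<in> \<Delta>" "co \<epsilon> \<alpha> > 0" using pos_co_ex[OF assms(1)] by blast
  have "\<alpha> \<bullet> x = (\<Sum>\<delta>\<in>\<Delta>. co \<delta> \<alpha> * (\<delta> \<bullet> x))" by (rule pos_inner_expand[OF assms(1)])
  also have "\<dots> > 0"
    by (rule sum_pos2[OF finite_simple \<epsilon>(1)])
      (use \<epsilon> assms(2) pos_co_nonneg[OF assms(1)] in \<open>auto intro!: mult_nonneg_nonneg simp: less_imp_le\<close>)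
  finally show ?thesis .
qed

text \<open>The reflection in \<delta> changes only the coordinate at \<delta>. As the system is
  reduced, a positive root other than \<delta> has a positive coordinate elsewhere, and that one
  survives.\<close>

lemma reflection_pos:
  assumes "pos \<alpha>" "\<delta> \<in> \<Delta>" "\<alpha> \<noteq> \<delta>" shows "pos (reflection \<delta> \<alpha>)"
proof -
  have "\<exists>\<epsilon>\<in>\<Delta>. \<epsilon> \<noteq> \<delta> \<and> co \<epsilon> \<alpha> > 0"
  proof (rule ccontr)
    assume n: "\<not> ?thesis"
    have z: "co \<epsilon> \<alpha> = 0" if "\<epsilon> \<in> \<Delta>" "\<epsilon> \<noteq> \<delta>" for \<epsilon>
      using n that pos_co_nonneg[OF assms(1) that(1)] by force
    have "\<alpha> = (\<Sum>\<epsilon>\<in>\<Delta>. co \<epsilon> \<alpha> *\<^sub>R \<epsilon>)" using assms(1) cone_expand(1) by (simp add: pos_def)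
    also have "\<dots> = (\<Sum>\<epsilon>\<in>\<Delta>. if \<epsilon> = \<delta> then co \<delta> \<alpha> *\<^sub>R \<delta> else 0)"
      by (rule sum.cong) (auto simp: z)
    also have "\<dots> = co \<delta> \<alpha> *\<^sub>R \<delta>" using finite_simple assms(2) by simp
    finally have e: "\<alpha> = co \<delta> \<alpha> *\<^sub>R \<delta>" .
    hence "co \<delta> \<alpha> = 1 \<or> co \<delta> \<alpha> = -1"
      using roots_reduced[OF simple_root[OF assms(2)], of "co \<delta> \<alpha>"] pos_root[OF assms(1)] by simp
    moreover have "co \<delta> \<alpha> \<ge> 0" by (rule pos_co_nonneg[OF assms(1,2)])
    ultimately have "co \<delta> \<alpha> = 1" by auto
    thus False using e assms(3) by simp
  qed
  then obtain \<epsilon> where \<epsilon>: "\<epsilon> \<in> \<Delta>" "\<epsilon> \<noteq> \<delta>" "co \<epsilon> \<alpha> > 0" by blast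
  have "co \<epsilon> (reflection \<delta> \<alpha>) = co \<epsilon> \<alpha>"
    unfolding reflection_def using \<epsilon> assms(2)
    by (simp add: linear_diff[OF co(1)] linear_cmul[OF co(1)] co(2))
  moreover have "reflection \<delta> \<alpha> \<in> \<Phi>"
    by (rule weyl_root[OF weyl_reflection[OF simple_root[OF assms(2)]] pos_root[OF assms(1)]])
  ultimately show ?thesis using posI[OF _ \<epsilon>(1)] \<epsilon>(3) by simp
qed

text \<open>The vector \<rho> represents the height functional. It serves twice: as an induction
  measure on positive roots, and to select a dominant vector in a Weyl orbit.\<close>

lemma height_ex: "\<exists>\<rho>. \<forall>\<delta>\<in>\<Delta>. \<rho> \<bullet> \<delta> = 1"
proof -
  obtain f :: "'v \<Rightarrow> real" where f: "linear f" "\<forall>\<delta>\<in>\<Delta>. f \<delta> = 1"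
    using linear_independent_extend[OF simple_indep, of "\<lambda>_. 1"] by blast
  have "f x = adjoint f 1 \<bullet> x" for x
    using adjoint_works[OF f(1), of x 1] by (simp add: inner_commute)
  thus ?thesis using f by metis
qed

text \<open>Descent on the height. A positive root \<alpha> pairs positively with some simple
  \<delta>, since otherwise its expansion would give a nonpositive square length; reflecting in
  \<delta> keeps it positive when it is not simple and lowers its height.\<close>

lemma pos_conj_simple:
  assumes "pos \<alpha>" shows "\<exists>w\<in>weyl_group \<Delta>. \<exists>\<delta>\<in>\<Delta>. \<alpha> = w \<delta>"
proof -
  obtain \<rho> where \<rho>: "\<And>\<delta>. \<delta> \<in> \<Delta> \<Longrightarrow> \<rho> \<bullet> \<delta> = 1" using height_ex by blast
  show ?thesis using assms
  proof (induction "nat \<lfloor>\<rho> \<bullet> \<alpha>\<rfloor>" arbitrary: \<alpha> rule: less_induct)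
    case less
    show ?case
    proof (cases "\<alpha> \<in> \<Delta>")
      case True
      thus ?thesis using weyl_group.id[of \<Delta>] by (metis id_apply)
    next
      case False
      have \<alpha>: "\<alpha> \<in> \<Phi>" using less.prems by (rule pos_root)
      have "\<exists>\<delta>\<in>\<Delta>. \<delta> \<bullet> \<alpha> > 0"
      proof (rule ccontr)
        assume n: "\<not> ?thesis"
        have "\<alpha> \<bullet> \<alpha> = (\<Sum>\<delta>\<in>\<Delta>. co \<delta> \<alpha> * (\<delta> \<bullet> \<alpha>))"
          by (rule pos_inner_expand[OF less.prems])
        also have "\<dots> \<le> 0"
          by (rule sum_nonpos) (use n pos_co_nonneg[OF less.prems] in \<open>auto intro!: mult_nonneg_nonpos simp: not_less\<close>)
        finally show False using root_nonzero[OF \<alpha>] inner_gt_zero_iff[of \<alpha>] by linarith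
      qed
      then obtain \<delta> where \<delta>: "\<delta> \<in> \<Delta>" "\<delta> \<bullet> \<alpha> > 0" by blast
      let ?c = "\<alpha> \<bullet> coroot \<delta>"
      have "?c > 0" using \<delta> root_nonzero[OF simple_root[OF \<delta>(1)]]
        by (simp add: inner_coroot inner_commute)
      moreover have "?c \<in> \<int>" by (rule roots_int[OF simple_root[OF \<delta>(1)] \<alpha>])
      \<comment> \<open>Integrality upgrades a positive pairing to a pairing of at least 1, so the
        height drops by at least 1 and its floor strictly decreases.\<close>
      ultimately have c1: "?c \<ge> 1" by (auto elim!: Ints_cases)
      let ?\<beta> = "reflection \<delta> \<alpha>"
      have p: "pos ?\<beta>" by (rule reflection_pos) (use less.prems \<delta> False in auto)
      have "\<rho> \<bullet> ?\<beta> > 0"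
        using pos_inner[OF p, of \<rho>] \<rho> by (simp add: inner_commute)
      moreover have "\<rho> \<bullet> ?\<beta> \<le> \<rho> \<bullet> \<alpha> - 1"
        using c1 \<rho>[OF \<delta>(1)] by (simp add: reflection_def inner_diff_right)
      ultimately have "nat \<lfloor>\<rho> \<bullet> ?\<beta>\<rfloor> < nat \<lfloor>\<rho> \<bullet> \<alpha>\<rfloor>" by linarith
      from less.hyps[OF this p] obtain w \<epsilon> where w: "w \<in> weyl_group \<Delta>" "\<epsilon> \<in> \<Delta>" "?\<beta> = w \<epsilon>" by blast
      have "\<alpha> = (reflection \<delta> \<circ> w) \<epsilon>" using w(3) reflection_invol[of \<delta> \<alpha>] by simp
      moreover have "reflection \<delta> \<circ> w \<in> weyl_group \<Delta>" using w \<delta> by (intro weyl_group.reflect)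
      ultimately show ?thesis using w by blast
    qed
  qed
qed

lemma root_conj_simple:
  assumes "\<alpha> \<in> \<Phi>" shows "\<exists>w\<in>weyl_group \<Delta>. \<exists>\<delta>\<in>\<Delta>. \<alpha> = w \<delta>"
  using pos_or_neg[OF assms]
proof
  assume "pos (- \<alpha>)"
  then obtain w \<delta> where w: "w \<in> weyl_group \<Delta>" "\<delta> \<in> \<Delta>" "- \<alpha> = w \<delta>" using pos_conj_simple by blast
  have "\<alpha> = (w \<circ> reflection \<delta>) \<delta>"
    using w reflection_self[OF root_nonzero[OF simple_root[OF w(2)]]] linear_neg[OF weyl_linear[OF w(1)]]
    by (metis add.inverse_inverse comp_apply)
  moreover have "w \<circ> reflection \<delta> \<in> weyl_group \<Delta>" using w by (intro weyl_comp weyl_reflection)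
  ultimately show ?thesis using w by blast
qed (rule pos_conj_simple)

text \<open>The reflection in \<open>w \<delta>\<close> is the conjugate by \<open>w\<close> of the
  reflection in \<delta>, and every root is \<open>w \<delta>\<close> with \<delta> simple and
  \<open>w\<close> a product of simple reflections.\<close>

lemma weyl_simple: "W = weyl_group \<Delta>"
proof
  have refl: "reflection \<alpha> \<in> weyl_group \<Delta>" if \<alpha>: "\<alpha> \<in> \<Phi>" for \<alpha>
  proof -
    obtain w \<delta> where w: "w \<in> weyl_group \<Delta>" "\<delta> \<in> \<Delta>" "\<alpha> = w \<delta>" using root_conj_simple[OF \<alpha>] by blast
    have "reflection \<alpha> = w \<circ> reflection \<delta> \<circ> inv_into UNIV w"
      using w by (auto simp: reflection_conj fun_eq_iff weyl_inv_simps[OF w(1)])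
    thus ?thesis using w by (auto intro: weyl_comp weyl_inv weyl_reflection)
  qed
  show "W \<subseteq> weyl_group \<Delta>"
  proof
    fix w assume "w \<in> W"
    thus "w \<in> weyl_group \<Delta>" by induction (intro weyl_group.id weyl_comp refl; assumption)+
  qed
  show "weyl_group \<Delta> \<subseteq> W" using weyl_mono[of \<Delta> \<Phi>] simple_root by blast
qed

text \<open>The exchange condition. Reading the word from the right, the image of the positive root
  \<delta> becomes negative at some letter \<epsilon>. A simple reflection makes only its own root
  negative, so the image just before is \<epsilon> itself and this letter can be deleted.\<close>

lemma word_exchange:
  assumes "set ds \<subseteq> \<Delta>" "\<delta> \<in> \<Delta>" "pos (- word ds \<delta>)"
  shows "\<exists>es. set es \<subseteq> \<Delta> \<and> Suc (length es) = length ds \<and> word es = word ds \<circ> reflection \<delta>"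
  using assms
proof (induction ds)
  case Nil
  thus ?case using not_pos_neg[OF simple_pos[of \<delta>]] by (simp add: word_simps)
next
  case (Cons \<epsilon> ds)
  have root: "word ds \<delta> \<in> \<Phi>"
  proof -
    have "word ds \<in> W" using Cons.prems simple_root by (intro word_in_weyl) auto
    thus ?thesis by (rule weyl_root[OF _ simple_root[OF Cons.prems(2)]])
  qed
  show ?case
  proof (cases "pos (word ds \<delta>)")
    case True
    \<comment> \<open>The root is positive before and negative after the reflection in \<epsilon>,
      which leaves only \<epsilon>.\<close>
    have "word ds \<delta> = \<epsilon>"
      using reflection_pos[OF True, of \<epsilon>] Cons.prems not_pos_neg by (auto simp: word_simps)
    hence "word ds \<circ> reflection \<delta> = reflection \<epsilon> \<circ> word ds"
      using reflection_conj[OF word_in_weyl[of ds \<Delta>], of \<delta>] Cons.prems by simp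
    hence "word ds = word (\<epsilon> # ds) \<circ> reflection \<delta>"
      by (simp add: word_simps o_assoc[symmetric]) (simp add: o_assoc reflection_comp_self)
    thus ?thesis using Cons.prems by (intro exI[of _ ds]) auto
  next
    case False
    hence p: "pos (- word ds \<delta>)" using pos_or_neg[OF root] by blast
    have "set ds \<subseteq> \<Delta>" using Cons.prems(1) by simp
    from Cons.IH[OF this Cons.prems(2) p] obtain es
      where "set es \<subseteq> \<Delta>" "Suc (length es) = length ds" "word es = word ds \<circ> reflection \<delta>" by blast
    thus ?thesis using Cons.prems by (intro exI[of _ "\<epsilon> # es"]) (auto simp: word_simps o_assoc)
  qed
qed

text \<open>Take a shortest word for \<open>u\<close>. If \<delta> is its last letter, minimality
  makes \<open>u \<delta>\<close> a negative root, which pairs negatively with \<open>x\<close>; but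
  the pairing of \<open>u \<delta>\<close> with \<open>x = u x\<close> equals that of \<delta> with
  \<open>x\<close>, which is positive.\<close>

lemma dominant_stabilizer:
  assumes x: "\<And>\<delta>. \<delta> \<in> \<Delta> \<Longrightarrow> \<delta> \<bullet> x > 0" and u: "u \<in> W" "u x = x"
  shows "u = id"
proof -
  define P where "P = (\<lambda>ds. set ds \<subseteq> \<Delta> \<and> u = word ds)"
  have "\<exists>ds. P ds" using weyl_word_ex[of u \<Delta>] u(1) by (simp add: weyl_simple P_def)
  then obtain ds where ds: "P ds" and min: "\<And>es. P es \<Longrightarrow> length ds \<le> length es"
    using ex_has_least_nat[of P _ length] by metis
  show ?thesis
  proof (cases ds rule: rev_cases)
    case Nil
    thus ?thesis using ds by (simp add: P_def word_simps)
  next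
    case (snoc ds' \<delta>)
    have d: "set ds' \<subseteq> \<Delta>" "\<delta> \<in> \<Delta>" "u = word ds' \<circ> reflection \<delta>"
      using ds snoc by (auto simp: P_def word_append word_simps)
    have "\<not> pos (- word ds' \<delta>)"
    proof
      assume "pos (- word ds' \<delta>)"
      then obtain es where "set es \<subseteq> \<Delta>" "Suc (length es) = length ds'" "word es = u"
        using word_exchange[OF d(1,2)] d(3) by auto
      hence "length ds \<le> length es" using min by (auto simp: P_def)
      thus False using snoc \<open>Suc (length es) = length ds'\<close> by simp
    qed
    moreover have "u \<delta> = - word ds' \<delta>"
      using d linear_neg[OF weyl_linear[OF word_in_weyl[OF d(1)]]]
        reflection_self[OF root_nonzero[OF simple_root[OF d(2)]]] by simp
    moreover have "u \<delta> \<in> \<Phi>" by (rule weyl_root[OF u(1) simple_root[OF d(2)]])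
    ultimately have "pos (- u \<delta>)" using pos_or_neg by metis
    hence "(- u \<delta>) \<bullet> x > 0" using x by (rule pos_inner)
    hence "u \<delta> \<bullet> u x < 0" using u(2) by simp
    hence "\<delta> \<bullet> x < 0" using weyl_inner[OF u(1)] by simp
    thus ?thesis using x[OF d(2)] by simp
  qed
qed

text \<open>The orbit point of maximal height is strictly dominant, and conjugating \<open>u\<close>
  into the stabilizer of that point reduces the claim to the dominant case.\<close>

lemma regular_stabilizer:
  assumes x: "\<And>\<alpha>. \<alpha> \<in> \<Phi> \<Longrightarrow> \<alpha> \<bullet> x \<noteq> 0" and u: "u \<in> W" "u x = x"
  shows "u = id"
proof -
  obtain \<rho> where \<rho>: "\<And>\<delta>. \<delta> \<in> \<Delta> \<Longrightarrow> \<rho> \<bullet> \<delta> = 1" using height_ex by blast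
  have "finite ((\<lambda>v. \<rho> \<bullet> v x) ` W)" "(\<lambda>v. \<rho> \<bullet> v x) ` W \<noteq> {}"
    using finite_weyl weyl_group.id[of \<Phi>] by auto
  from Max_in[OF this] obtain v where v: "v \<in> W" "Max ((\<lambda>v. \<rho> \<bullet> v x) ` W) = \<rho> \<bullet> v x" by auto
  have max: "\<rho> \<bullet> v' x \<le> \<rho> \<bullet> v x" if "v' \<in> W" for v'
    using Max_ge[of "(\<lambda>v. \<rho> \<bullet> v x) ` W" "\<rho> \<bullet> v' x"] that finite_weyl v(2) by auto
  \<comment> \<open>Maximality compared with the further reflection in \<delta> gives a nonnegative
    pairing; regularity of \<open>x\<close> excludes zero.\<close>
  have dom: "\<delta> \<bullet> v x > 0" if \<delta>: "\<delta> \<in> \<Delta>" for \<delta>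
  proof -
    have \<delta>\<Phi>: "\<delta> \<in> \<Phi>" using \<delta> by (rule simple_root)
    have "\<rho> \<bullet> (reflection \<delta> \<circ> v) x \<le> \<rho> \<bullet> v x" by (rule max[OF weyl_group.reflect[OF \<delta>\<Phi> v(1)]])
    hence "(v x) \<bullet> coroot \<delta> \<ge> 0" using \<rho>[OF \<delta>] by (simp add: reflection_def inner_diff_right)
    hence "2 * (v x \<bullet> \<delta>) / (\<delta> \<bullet> \<delta>) \<ge> 0" by (simp only: inner_coroot)
    moreover have "\<delta> \<bullet> \<delta> > 0" using root_nonzero[OF \<delta>\<Phi>] by simp
    ultimately have "v x \<bullet> \<delta> \<ge> 0" by (simp only: zero_le_divide_iff) linarith
    hence "\<delta> \<bullet> v x \<ge> 0" by (subst inner_commute)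
    moreover have "\<delta> \<bullet> v x = inv_into UNIV v \<delta> \<bullet> x"
      using weyl_inner[OF weyl_inv[OF v(1)], of \<delta> "v x"] by (simp add: weyl_inv_simps[OF v(1)])
    moreover have "inv_into UNIV v \<delta> \<in> \<Phi>" by (rule weyl_root[OF weyl_inv[OF v(1)] \<delta>\<Phi>])
    ultimately show ?thesis using x by force
  qed
  have "v \<circ> u \<circ> inv_into UNIV v = id"
    by (rule dominant_stabilizer[of "v x"])
      (use dom u v in \<open>auto intro!: weyl_comp weyl_inv simp: weyl_inv_simps[OF v(1)]\<close>)
  hence "v (u (inv_into UNIV v (v y))) = v y" for y by (metis comp_apply id_apply)
  hence "v (u y) = v y" for y by (simp add: weyl_inv_simps[OF v(1)])
  hence "u y = y" for y using weyl_bij[OF v(1)] by (metis bij_is_inj injD)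
  thus ?thesis by auto
qed

lemma weyl_pow: "u \<in> W \<Longrightarrow> u ^^ k \<in> W"
  by (induction k) (auto intro: weyl_group.id weyl_comp)

lemma weyl_finite_order:
  assumes u: "u \<in> W" shows "\<exists>m>0. u ^^ m = id"
proof -
  have "\<not> inj_on (\<lambda>k. u ^^ k) (UNIV :: nat set)"
    using finite_weyl weyl_pow[OF u] by (metis finite_imageD finite_subset image_subsetI infinite_UNIV_nat)
  then obtain i j where ij: "i < j" "u ^^ i = u ^^ j"
    unfolding inj_on_def by (metis nat_neq_iff)
  have "u ^^ j = (u ^^ i) \<circ> (u ^^ (j - i))" using ij(1) by (simp add: funpow_add[symmetric])
  hence "(u ^^ i) ((u ^^ (j - i)) x) = (u ^^ i) x" for x using ij(2) by (metis comp_apply)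
  hence "(u ^^ (j - i)) x = x" for x
    using weyl_bij[OF weyl_pow[OF u]] by (metis bij_is_inj injD)
  hence "u ^^ (j - i) = id" by auto
  thus ?thesis using ij(1) by (intro exI[of _ "j - i"]) auto
qed

text \<open>
  If no root is killed by averaging over the cyclic group of \<open>u\<close>, then the averages supply a
  regular vector fixed by \<open>u\<close>.
\<close>

lemma weyl_moves_along_root:
  assumes u: "u \<in> W" "u \<noteq> id"
  shows "\<exists>x\<in>RtL. \<exists>\<alpha>\<in>\<Phi>. \<exists>m::nat. m > 0 \<and> x - u x = of_nat m *\<^sub>R \<alpha>"
proof -
  obtain m where m: "m > 0" "u ^^ m = id" using weyl_finite_order[OF u(1)] by blast
  define avg where "avg = (\<lambda>\<alpha>. \<Sum>k<m. (u ^^ k) \<alpha>)"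
  note lin = weyl_linear[OF u(1)]
  have ump: "u ((u ^^ k) \<alpha>) = (u ^^ Suc k) \<alpha>" for k \<alpha> by simp
  have shift: "(\<Sum>k<m. (u ^^ Suc k) \<alpha>) = avg \<alpha>" for \<alpha>
  proof -
    have "(\<Sum>k<Suc m. (u ^^ k) \<alpha>) = \<alpha> + (\<Sum>k<m. (u ^^ Suc k) \<alpha>)"
      by (subst sum.lessThan_Suc_shift) simp
    moreover have "(\<Sum>k<Suc m. (u ^^ k) \<alpha>) = avg \<alpha> + \<alpha>" using m by (simp add: avg_def)
    ultimately show ?thesis by simp
  qed
  have fix_avg: "u (avg \<alpha>) = avg \<alpha>" for \<alpha>
    unfolding avg_def linear_sum[OF lin] ump shift by (simp add: avg_def)
  have "\<exists>\<alpha>\<in>\<Phi>. avg \<alpha> = 0"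
  proof (rule ccontr)
    assume n: "\<not> ?thesis"
    let ?U = "{x. u x = x}"
    have "subspace ?U"
      by (rule subspaceI) (auto simp: linear_0[OF lin] linear_add[OF lin] linear_cmul[OF lin])
    moreover have "\<exists>x\<in>?U. \<alpha> \<bullet> x \<noteq> 0" if \<alpha>: "\<alpha> \<in> \<Phi>" for \<alpha>
    proof -
      have pk: "(u ^^ k) (avg \<alpha>) = avg \<alpha>" for k by (induction k) (auto simp: fix_avg)
      \<comment> \<open>The square length of the average is \<open>m\<close> times its pairing with
        \<alpha>, since the average is fixed by \<open>u\<close>. Hence a nonzero average is a fixed
        vector not orthogonal to \<alpha>.\<close>
      have "avg \<alpha> \<bullet> avg \<alpha> = (\<Sum>k<m. (u ^^ k) \<alpha> \<bullet> (u ^^ k) (avg \<alpha>))"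
        unfolding pk by (simp add: avg_def inner_sum_left)
      also have "\<dots> = of_nat m * (\<alpha> \<bullet> avg \<alpha>)"
        by (simp add: weyl_inner[OF weyl_pow[OF u(1)]])
      finally have "\<alpha> \<bullet> avg \<alpha> \<noteq> 0" using n \<alpha> by auto
      thus ?thesis using fix_avg by blast
    qed
    ultimately obtain x where "u x = x" "\<forall>\<alpha>\<in>\<Phi>. \<alpha> \<bullet> x \<noteq> 0"
      using regular_vector_ex[OF finite_roots, of ?U] by blast
    hence "u = id" using regular_stabilizer u(1) by blast
    thus False using u(2) by simp
  qed
  then obtain \<alpha> where \<alpha>: "\<alpha> \<in> \<Phi>" "avg \<alpha> = 0" by blast
  \<comment> \<open>Summation by parts: weighting the orbit of \<alpha> by \<open>k\<close> gives
    \<open>u \<kappa> - \<kappa> = m \<alpha> - avg \<alpha>\<close>, and the average vanishes for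
    the chosen root. So \<open>- \<kappa>\<close> is the required lattice vector.\<close>
  define \<kappa> where "\<kappa> = (\<Sum>k<m. of_nat k *\<^sub>R (u ^^ k) \<alpha>)"
  have "\<kappa> \<in> RtL" unfolding \<kappa>_def
  proof (rule int_lattice_sum)
    fix k
    have "(u ^^ k) \<alpha> \<in> RtL" by (rule RtL_root[OF weyl_root[OF weyl_pow[OF u(1)] \<alpha>(1)]])
    from int_lattice_scale[OF this, of "int k"] show "of_nat k *\<^sub>R (u ^^ k) \<alpha> \<in> RtL" by simp
  qed
  hence "- \<kappa> \<in> RtL" by (rule int_lattice_uminus)
  moreover have "- \<kappa> - u (- \<kappa>) = of_nat m *\<^sub>R \<alpha>"
  proof -
    have "u \<kappa> = (\<Sum>k<m. of_nat k *\<^sub>R (u ^^ Suc k) \<alpha>)"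
      unfolding \<kappa>_def by (simp add: linear_sum[OF lin] linear_cmul[OF lin])
    also have "\<dots> = (\<Sum>k<m. of_nat (Suc k) *\<^sub>R (u ^^ Suc k) \<alpha> - (u ^^ Suc k) \<alpha>)"
      by (rule sum.cong) (auto simp: algebra_simps)
    also have "\<dots> = (\<Sum>k<m. of_nat (Suc k) *\<^sub>R (u ^^ Suc k) \<alpha>) - avg \<alpha>"
      unfolding sum_subtractf shift ..
    also have "(\<Sum>k<m. of_nat (Suc k) *\<^sub>R (u ^^ Suc k) \<alpha>) = (\<Sum>k<Suc m. of_nat k *\<^sub>R (u ^^ k) \<alpha>)"
      by (subst sum.lessThan_Suc_shift) simp
    also have "\<dots> = \<kappa> + of_nat m *\<^sub>R \<alpha>" using m by (simp add: \<kappa>_def)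
    finally show ?thesis using \<alpha>(2) linear_neg[OF lin, of \<kappa>] by simp
  qed
  ultimately show ?thesis using \<alpha>(1) m(1) by blast
qed

end

text \<open>The span \<open>U\<close> of the orbit is stable under reflections, so for
  \<open>x\<close> in \<open>U\<close> the vector \<open>x - s(x)\<close>, a multiple of the root,
  is in \<open>U\<close>. Hence each root lies in \<open>U\<close> or is orthogonal to it, and
  irreducibility rules out the second kind.\<close>

lemma irreducible_orbit_spans:
  assumes irr: "irreducible_root_system \<Phi>" and \<theta>: "\<theta> \<in> \<Phi>"
  shows "span ((\<lambda>v. v \<theta>) ` weyl_group \<Phi>) = UNIV"
proof -
  interpret root_sys \<Phi> by unfold_locales (use irr in \<open>simp add: irreducible_root_system_def\<close>)
  let ?U = "span ((\<lambda>v. v \<theta>) ` W)"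
  have stable: "reflection \<alpha> x \<in> ?U" if "\<alpha> \<in> \<Phi>" "x \<in> ?U" for \<alpha> x
  proof -
    have "reflection \<alpha> ` ?U = span (reflection \<alpha> ` (\<lambda>v. v \<theta>) ` W)"
      by (rule linear_span_image[OF reflection_linear, symmetric])
    also have "reflection \<alpha> ` (\<lambda>v. v \<theta>) ` W \<subseteq> (\<lambda>v. v \<theta>) ` W"
    proof
      fix y assume "y \<in> reflection \<alpha> ` (\<lambda>v. v \<theta>) ` W"
      then obtain v where "v \<in> W" "y = (reflection \<alpha> \<circ> v) \<theta>" by auto
      thus "y \<in> (\<lambda>v. v \<theta>) ` W" using weyl_group.reflect[OF that(1)] by blast
    qed
    hence "span (reflection \<alpha> ` (\<lambda>v. v \<theta>) ` W) \<subseteq> ?U" by (rule span_mono)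
    finally show ?thesis using that by blast
  qed
  let ?A = "{\<alpha>\<in>\<Phi>. \<alpha> \<in> ?U}" and ?B = "{\<alpha>\<in>\<Phi>. \<forall>x\<in>?U. \<alpha> \<bullet> x = 0}"
  have "\<alpha> \<in> ?A \<union> ?B" if \<alpha>: "\<alpha> \<in> \<Phi>" for \<alpha>
  proof (rule ccontr)
    assume n: "\<alpha> \<notin> ?A \<union> ?B"
    then obtain x where x: "x \<in> ?U" "\<alpha> \<bullet> x \<noteq> 0" using \<alpha> by blast
    have "x - reflection \<alpha> x \<in> ?U" by (intro span_diff stable x \<alpha>)
    hence "(x \<bullet> coroot \<alpha>) *\<^sub>R \<alpha> \<in> ?U" by (simp add: reflection_def)
    hence "(1 / (x \<bullet> coroot \<alpha>)) *\<^sub>R ((x \<bullet> coroot \<alpha>) *\<^sub>R \<alpha>) \<in> ?U" by (rule span_scale)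
    moreover have "x \<bullet> coroot \<alpha> \<noteq> 0" using x root_nonzero[OF \<alpha>] by (simp add: inner_coroot inner_commute)
    ultimately have "\<alpha> \<in> ?U" by simp
    thus False using n \<alpha> by blast
  qed
  hence AB: "?A \<union> ?B = \<Phi>" by blast
  have "id \<theta> \<in> ?U" by (intro span_base imageI weyl_group.id)
  hence A: "?A \<noteq> {}" using \<theta> by auto
  have "\<alpha> \<notin> ?B" if "\<alpha> \<in> ?A" for \<alpha>
    using that root_nonzero[of \<alpha>] by (auto intro!: bexI[of _ \<alpha>])
  hence disj: "?A \<inter> ?B = {}" by blast
  have orth: "\<forall>a\<in>?A. \<forall>b\<in>?B. a \<bullet> b = 0" by (auto simp: inner_commute)
  have "?B = {}"
  proof (rule ccontr)
    assume "?B \<noteq> {}"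
    hence "\<exists>A B. A \<noteq> {} \<and> B \<noteq> {} \<and> A \<union> B = \<Phi> \<and> A \<inter> B = {} \<and> (\<forall>a\<in>A. \<forall>b\<in>B. a \<bullet> b = 0)"
      using A AB disj orth by (intro exI[of _ ?A] exI[of _ ?B] conjI)
    thus False using irr by (simp add: irreducible_root_system_def)
  qed
  hence "\<Phi> \<subseteq> ?U" using AB by blast
  hence "span \<Phi> \<subseteq> ?U" using span_minimal[OF _ subspace_span] by blast
  thus ?thesis using span_roots by auto
qed

section \<open>Formal group algebras\<close>

text \<open>Coefficients of a sum or product in degree below \<open>d\<close> depend only on
  coefficients of the terms or factors in degree below \<open>d\<close>, so approximations from
  \<open>J\<close> are carried along by the ideal operations.\<close>

lemma ps_closure_ideal:
  assumes "ideal J (ps_ring V)" shows "ideal (ps_closure V J) (ps_ring V)"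
proof -
  interpret J: ideal J "ps_ring V" by fact
  have Jc: "g \<in> J \<Longrightarrow> g \<in> carrier (ps_ring V)" for g using J.Icarr .
  have mult: "ps_conv x f \<in> ps_closure V J" if f: "f \<in> ps_closure V J" and x: "x \<in> carrier (ps_ring V)" for f x
  proof -
    have "\<exists>g\<in>J. \<forall>m. size m < d \<longrightarrow> ps_conv x f m = g m" for d
    proof -
      obtain g where g: "g \<in> J" "\<And>m. size m < d \<Longrightarrow> f m = g m" using f by (auto simp: ps_closure_def)
      have "ps_conv x g \<in> J" using J.I_l_closed[OF g(1) x] by (simp add: ps_ring_simps)
      moreover have "ps_conv x f m = ps_conv x g m" if "size m < d" for m
        unfolding ps_conv_def
      proof (rule sum.cong[OF refl])
        fix k assume "k \<in> {k. k \<subseteq># m}"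
        hence "size (m - k) < d" using that size_mset_mono[of "m - k" m] by auto
        thus "x k * f (m - k) = x k * g (m - k)" using g by simp
      qed
      ultimately show ?thesis by blast
    qed
    thus ?thesis using f x by (auto simp: ps_closure_def ps_conv_closed)
  qed
  show ?thesis
  proof (rule idealI)
    show "ring (ps_ring V)" by (rule ps.ring_axioms)
    show "subgroup (ps_closure V J) (add_monoid (ps_ring V))"
    proof (rule ps.add.subgroupI)
      show "ps_closure V J \<subseteq> carrier (ps_ring V)" by (auto simp: ps_closure_def)
      have "(\<lambda>m. 0) \<in> J" using J.zero_closed by (simp add: ps_ring_simps)
      thus "ps_closure V J \<noteq> {}" using ps_zero_closed[of V] by (fastforce simp: ps_closure_def)
    next
      fix f assume f: "f \<in> ps_closure V J"
      hence fc: "f \<in> carrier (ps_ring V)" by (simp add: ps_closure_def)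
      have "\<exists>g\<in>J. \<forall>m. size m < d \<longrightarrow> - f m = g m" for d
      proof -
        obtain g where g: "g \<in> J" "\<And>m. size m < d \<Longrightarrow> f m = g m" using f by (auto simp: ps_closure_def)
        have "(\<lambda>m. - g m) \<in> J" using J.a_inv_closed[OF g(1)] ps_a_inv[OF Jc[OF g(1)]] by simp
        thus ?thesis using g by (intro bexI[of _ "\<lambda>m. - g m"]) auto
      qed
      thus "\<ominus>\<^bsub>ps_ring V\<^esub> f \<in> ps_closure V J"
        using fc by (simp add: ps_closure_def ps_a_inv ps_uminus_closed)
    next
      fix f f' assume f: "f \<in> ps_closure V J" "f' \<in> ps_closure V J"
      have "\<exists>g\<in>J. \<forall>m. size m < d \<longrightarrow> f m + f' m = g m" for d
      proof -
        obtain g where g: "g \<in> J" "\<And>m. size m < d \<Longrightarrow> f m = g m"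
          using f(1) unfolding ps_closure_def by blast
        obtain g' where g': "g' \<in> J" "\<And>m. size m < d \<Longrightarrow> f' m = g' m"
          using f(2) unfolding ps_closure_def by blast
        have "(\<lambda>m. g m + g' m) \<in> J" using J.a_closed[OF g(1) g'(1)] by (simp add: ps_ring_simps)
        thus ?thesis using g g' by (intro bexI[of _ "\<lambda>m. g m + g' m"]) auto
      qed
      thus "f \<oplus>\<^bsub>ps_ring V\<^esub> f' \<in> ps_closure V J"
        using f by (auto simp: ps_closure_def ps_ring_simps ps_add_closed)
    qed
    show "x \<otimes>\<^bsub>ps_ring V\<^esub> f \<in> ps_closure V J" if "f \<in> ps_closure V J" "x \<in> carrier (ps_ring V)" for f x
      using mult[OF that] by (simp add: ps_ring_simps)
    show "f \<otimes>\<^bsub>ps_ring V\<^esub> x \<in> ps_closure V J" if "f \<in> ps_closure V J" "x \<in> carrier (ps_ring V)" for f x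
      using mult[OF that] by (simp add: ps_ring_simps ps_conv_comm[of f])
  qed
qed

lemma ps_closure_incl: "J \<subseteq> carrier (ps_ring V) \<Longrightarrow> J \<subseteq> ps_closure V J"
  by (auto simp: ps_closure_def)

section \<open>Substitution into a formal group law and its lowest coefficients\<close>

lemma finite_pairs: "finite {(i, j). i + j \<le> (n::nat)}"
  by (rule finite_subset[of _ "{..n} \<times> {..n}"]) auto

lemma fgl_subst_closed:
  assumes "f \<in> carrier (ps_ring V)" "g \<in> carrier (ps_ring V)"
  shows "fgl_subst V F f g \<in> carrier (ps_ring V)"
proof -
  let ?t = "\<lambda>i j. f [^]\<^bsub>ps_ring V\<^esub> (i::nat) \<otimes>\<^bsub>ps_ring V\<^esub> g [^]\<^bsub>ps_ring V\<^esub> (j::nat)"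
  have t: "?t i j \<in> carrier (ps_ring V)" for i j using assms by simp
  have ne: "\<exists>i j. i + j \<le> size m \<and> ?t i j m \<noteq> 0" if m: "fgl_subst V F f g m \<noteq> 0" for m
  proof (rule ccontr)
    assume n: "\<not> ?thesis"
    have "fgl_subst V F f g m = 0"
      unfolding fgl_subst_def by (rule sum.neutral) (use n in auto)
    thus False using m by simp
  qed
  have "set_mset m \<subseteq> V" if m: "fgl_subst V F f g m \<noteq> 0" for m
  proof -
    from ne[OF m] obtain i j where "?t i j m \<noteq> 0" by blast
    thus ?thesis using t[of i j] by (simp add: ps_carrier_iff)
  qed
  moreover have "finite {m. size m = d \<and> fgl_subst V F f g m \<noteq> 0}" for d
  proof (rule finite_subset)
    show "finite (\<Union>i\<le>d. \<Union>j\<le>d. {m. size m = d \<and> ?t i j m \<noteq> 0})"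
      using t by (auto simp: ps_carrier_iff)
    show "{m. size m = d \<and> fgl_subst V F f g m \<noteq> 0} \<subseteq> (\<Union>i\<le>d. \<Union>j\<le>d. {m. size m = d \<and> ?t i j m \<noteq> 0})"
    proof
      fix m assume m: "m \<in> {m. size m = d \<and> fgl_subst V F f g m \<noteq> 0}"
      then obtain i j where "i + j \<le> d" "?t i j m \<noteq> 0" using ne[of m] by auto
      thus "m \<in> (\<Union>i\<le>d. \<Union>j\<le>d. {m. size m = d \<and> ?t i j m \<noteq> 0})" using m by fastforce
    qed
  qed
  ultimately show ?thesis by (auto simp: ps_carrier_iff)
qed

lemma fgl_subst_empty: "fgl_subst V F f g {#} = F 0 0"
proof -
  have "{(i, j). i + j \<le> (0::nat)} = {(0, 0)}" by auto
  thus ?thesis by (simp add: fgl_subst_def ps_ring_simps ps_conv_empty ps_const_def)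
qed

text \<open>The terms with \<open>j = 0\<close> add up to \<open>f\<close>, and every other term
  contains the variable. This exhibits \<open>x_nu\<close> as a factor of
  \<open>x_(mu + nu) - x_mu\<close>, with an explicit cofactor whose constant term can be read
  off.\<close>

lemma fgl_subst_split:
  fixes f :: "'x multiset \<Rightarrow> 'r::comm_ring_1"
  assumes F0: "\<And>i. F i 0 = (if i = 1 then 1 else 0)"
    and f: "f \<in> carrier (ps_ring V)" "f {#} = 0" and x: "x \<in> V"
  shows "fgl_subst V F f (ps_var x) =
     f \<oplus>\<^bsub>ps_ring V\<^esub> ps_var x \<otimes>\<^bsub>ps_ring V\<^esub> fgl_subst V (\<lambda>i j. F i (Suc j)) f (ps_var x)"
proof
  fix m :: "'x multiset"
  let ?P = "ps_ring V :: ('x multiset \<Rightarrow> 'r) ring" and ?v = "ps_var x :: 'x multiset \<Rightarrow> 'r"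
  have v: "?v \<in> carrier ?P" using x by (rule ps_var_closed)
  let ?t = "\<lambda>i j. f [^]\<^bsub>?P\<^esub> (i::nat) \<otimes>\<^bsub>?P\<^esub> ?v [^]\<^bsub>?P\<^esub> (j::nat)"
  let ?n = "size m"
  let ?A = "(\<lambda>i. (i, 0::nat)) ` {..?n}" and ?B = "(\<lambda>(i, j). (i, Suc j)) ` {(i, j). i + Suc j \<le> ?n}"
  have fin: "finite {(i, j). i + Suc j \<le> ?n}"
    by (rule finite_subset[OF _ finite_pairs[of ?n]]) auto
  have split: "{(i, j). i + j \<le> ?n} = ?A \<union> ?B"
  proof (intro equalityI subsetI)
    fix p assume p: "p \<in> {(i, j). i + j \<le> ?n}"
    obtain i j where ij: "p = (i, j)" by (cases p)
    show "p \<in> ?A \<union> ?B" using p ij by (cases j) (auto simp: image_iff)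
  qed auto
  have "fgl_subst V F f ?v m =
      (\<Sum>(i, j)\<in>?A. F i j * ?t i j m) + (\<Sum>(i, j)\<in>?B. F i j * ?t i j m)"
    unfolding fgl_subst_def split by (rule sum.union_disjoint) (use fin in auto)
  also have "(\<Sum>(i, j)\<in>?A. F i j * ?t i j m) = (\<Sum>i\<le>?n. F i 0 * ?t i 0 m)"
    by (subst sum.reindex) (auto simp: inj_on_def)
  also have "\<dots> = (\<Sum>i\<le>?n. if i = 1 then f m else 0)"
    by (rule sum.cong) (use f in \<open>auto simp: F0\<close>)
  \<comment> \<open>The index \<open>i = 1\<close> is within range only if \<open>m\<close> is
    nonempty; at the empty monomial \<open>f\<close> vanishes by assumption.\<close>
  also have "\<dots> = f m"
    using f(2) by (cases "m = {#}") (auto simp: Suc_le_eq)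
  also have "(\<Sum>(i, j)\<in>?B. F i j * ?t i j m) =
      (\<Sum>(i, j)\<in>{(i, j). i + Suc j \<le> ?n}. F i (Suc j) * ?t i (Suc j) m)"
    by (subst sum.reindex) (auto simp: inj_on_def split_def)
  also have "\<dots> = (?v \<otimes>\<^bsub>?P\<^esub> fgl_subst V (\<lambda>i j. F i (Suc j)) f ?v) m"
  proof -
    have t: "?t i (Suc j) = ps_conv ?v (?t i j)" for i j
    proof -
      have "?t i (Suc j) = ?v \<otimes>\<^bsub>?P\<^esub> ?t i j" using f v by (simp add: ps.m_ac)
      thus ?thesis by (simp only: ps_ring_simps)
    qed
    show ?thesis
    proof (cases "x \<in># m")
      case True
      \<comment> \<open>Removing one \<open>x\<close> from \<open>m\<close> lowers the degree bound
        by one, which matches the shift from \<open>j\<close> to \<open>Suc j\<close>.\<close>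
      hence "{(i, j). i + Suc j \<le> ?n} = {(i, j). i + j \<le> size (m - {#x#})}"
        by (auto simp: size_Diff_singleton)
          (metis Suc_le_mono Suc_pred add_Suc_right nonempty_has_size size_empty empty_iff set_mset_empty)+
      thus ?thesis using True unfolding t
        by (simp add: ps_ring_simps(1) ps_conv_var_left fgl_subst_def)
    next
      case False
      thus ?thesis unfolding t by (simp add: ps_ring_simps(1) ps_conv_var_left split_def)
    qed
  qed
  finally show "fgl_subst V F f ?v m = (f \<oplus>\<^bsub>?P\<^esub> ?v \<otimes>\<^bsub>?P\<^esub> fgl_subst V (\<lambda>i j. F i (Suc j)) f ?v) m"
    by (simp add: ps_ring_simps(4))
qed

lemma ps_var_pow:
  "(ps_var x :: 'x multiset \<Rightarrow> 'r::comm_ring_1) [^]\<^bsub>ps_ring V\<^esub> (i::nat) =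
     (\<lambda>m. if m = replicate_mset i x then 1 else 0)"
proof (induction i)
  case 0
  show ?case by (simp add: ps_ring_simps ps_const_def)
next
  case (Suc i)
  have "(ps_var x :: 'x multiset \<Rightarrow> 'r) [^]\<^bsub>ps_ring V\<^esub> Suc i =
      ps_conv (ps_var x) (ps_var x [^]\<^bsub>ps_ring V\<^esub> i)"
    by (simp add: ps_ring_simps(1) ps_conv_comm)
  also have "\<dots> = (\<lambda>m. if m = replicate_mset (Suc i) x then 1 else 0)"
    unfolding Suc ps_conv_var_left by (auto simp: fun_eq_iff dest: multi_member_split)
  finally show ?case .
qed

text \<open>Comparison of the coefficients of \<open>x ^ i\<close> in the unit axiom
  \<open>F(x, 0) = x\<close>.\<close>

lemma fgl_coeff_zero:
  assumes "formal_group_law F" shows "F i 0 = (if i = 1 then 1 else 0)"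
proof -
  let ?P = "ps_ring (UNIV :: nat set) :: (nat multiset \<Rightarrow> 'a) ring"
  have e: "fgl_subst UNIV F (ps_var 0) \<zero>\<^bsub>?P\<^esub> = ps_var 0"
    using assms by (simp add: formal_group_law_def Let_def)
  let ?m = "replicate_mset i (0::nat)"
  have "fgl_subst UNIV F (ps_var 0) \<zero>\<^bsub>?P\<^esub> ?m =
      (\<Sum>p\<in>{(i', j). i' + j \<le> i}. if p = (i, 0) then F i 0 else 0)"
    unfolding fgl_subst_def size_replicate_mset
  proof (rule sum.cong[OF refl], clarify)
    fix a b :: nat
    assume "a + b \<le> i"
    show "F a b * (ps_var 0 [^]\<^bsub>?P\<^esub> a \<otimes>\<^bsub>?P\<^esub> \<zero>\<^bsub>?P\<^esub> [^]\<^bsub>?P\<^esub> b) ?m = (if (a, b) = (i, 0) then F i 0 else 0)"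
    proof (cases b)
      case 0
      have "ps_var 0 [^]\<^bsub>?P\<^esub> a \<otimes>\<^bsub>?P\<^esub> \<zero>\<^bsub>?P\<^esub> [^]\<^bsub>?P\<^esub> (0::nat) = ps_var 0 [^]\<^bsub>?P\<^esub> a"
        by (simp add: ps_var_closed)
      thus ?thesis unfolding 0 by (auto simp: ps_var_pow dest: arg_cong[of _ _ size])
    next
      case (Suc b')
      have "ps_var 0 [^]\<^bsub>?P\<^esub> a \<otimes>\<^bsub>?P\<^esub> \<zero>\<^bsub>?P\<^esub> [^]\<^bsub>?P\<^esub> b = \<zero>\<^bsub>?P\<^esub>"
        unfolding Suc by (simp add: ps_var_closed)
      thus ?thesis using Suc by (simp add: ps_ring_simps(3))
    qed
  qed
  also have "\<dots> = F i 0"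
  proof -
    have "finite {(i', j). i' + j \<le> i}" by (rule finite_pairs)
    thus ?thesis by (subst sum.delta) auto
  qed
  finally have "F i 0 = ps_var 0 ?m" using e by simp
  also have "\<dots> = (if i = 1 then 1 else 0)"
  proof -
    have "replicate_mset i (0::nat) = {#0#} \<longleftrightarrow> i = 1"
      by (metis One_nat_def replicate_mset_Suc replicate_mset_0 size_replicate_mset)
    thus ?thesis by (simp add: ps_var_def)
  qed
  finally show ?thesis .
qed

text \<open>Commutativity, compared at the monomial consisting of the second variable, makes the two
  linear coefficients equal; one of them is 1 by the unit axiom.\<close>

lemma fgl_coeff_one:
  assumes "formal_group_law F" shows "F 0 1 = 1"
proof -
  let ?P = "ps_ring (UNIV :: nat set) :: (nat multiset \<Rightarrow> 'a) ring"
  have e: "fgl_subst UNIV F (ps_var 0) (ps_var 1) = fgl_subst UNIV F (ps_var 1) (ps_var (0::nat))"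
    using assms by (simp add: formal_group_law_def Let_def)
  have p: "{(i, j). i + j \<le> Suc 0} = {(0, 0), (0, 1), (1, 0)}" by auto
  have vars: "ps_var x \<in> carrier ?P" for x by (simp add: ps_var_closed)
  have "fgl_subst UNIV F (ps_var a) (ps_var b) {#1#} =
     F 0 1 * (ps_var b {#1#} :: 'a) + F 1 0 * ps_var a {#1#}" for a b :: nat
    using vars[of a] vars[of b]
    by (simp add: fgl_subst_def p) (simp add: ps_ring_simps(2) ps_const_def)
  from this[of 0 1] this[of 1 0] e have "F 0 1 = F 1 0" by (simp add: ps_var_def)
  thus ?thesis using fgl_coeff_zero[OF assms, of 1] by simp
qed

text \<open>Bijectivity is required on the whole ambient group, because \<open>ps_act\<close>
  inverts \<open>w\<close> there and not only on the lattice.\<close>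

definition lattice_aut :: "'v::ab_group_add set \<Rightarrow> ('v \<Rightarrow> 'v) \<Rightarrow> bool" where
  "lattice_aut \<Lambda> w \<longleftrightarrow> bij w \<and> w ` \<Lambda> = \<Lambda> \<and> (\<forall>x y. w (x + y) = w x + w y)"

section \<open>The formal group algebra of a lattice and the action of lattice automorphisms\<close>

lemma ps_act_pow:
  assumes "bij w" "w ` V = V" "f \<in> carrier (ps_ring V)"
  shows "ps_act w (f [^]\<^bsub>ps_ring V\<^esub> (i::nat)) = ps_act w f [^]\<^bsub>ps_ring V\<^esub> i"
  by (induction i) (use assms in \<open>auto simp: ps_ring_simps ps_act_const ps_act_conv\<close>)

lemma ps_act_fgl_subst:
  assumes w: "bij w" "w ` V = V" and f: "f \<in> carrier (ps_ring V)" "g \<in> carrier (ps_ring V)"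
  shows "ps_act w (fgl_subst V F f g) = fgl_subst V F (ps_act w f) (ps_act w g)"
proof (rule ps_act_eqI[OF w(1)])
  fix m
  have "(ps_act w f [^]\<^bsub>ps_ring V\<^esub> i \<otimes>\<^bsub>ps_ring V\<^esub> ps_act w g [^]\<^bsub>ps_ring V\<^esub> j) (image_mset w m) =
      (f [^]\<^bsub>ps_ring V\<^esub> i \<otimes>\<^bsub>ps_ring V\<^esub> g [^]\<^bsub>ps_ring V\<^esub> j) m" for i j :: nat
    using ps_act_bij[OF w(1), of "f [^]\<^bsub>ps_ring V\<^esub> i \<otimes>\<^bsub>ps_ring V\<^esub> g [^]\<^bsub>ps_ring V\<^esub> j" m]
    by (simp add: ps_ring_simps(1) ps_act_conv[OF w(1)] ps_act_pow[OF w] f)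
  thus "fgl_subst V F (ps_act w f) (ps_act w g) (image_mset w m) = fgl_subst V F f g m"
    by (simp add: fgl_subst_def)
qed

text \<open>The conditions on the coefficients express \<open>F(x, y) = x + y G(x, y)\<close> with
  \<open>G\<close> of constant term 1, the form in which the group law enters all computations
  below.\<close>

locale formal_group_algebra =
  fixes F :: "nat \<Rightarrow> nat \<Rightarrow> 'r::comm_ring_1" and \<Lambda> :: "'v::real_vector set"
  assumes lat_zero: "0 \<in> \<Lambda>" and lat_add: "x \<in> \<Lambda> \<Longrightarrow> y \<in> \<Lambda> \<Longrightarrow> x + y \<in> \<Lambda>"
    and lat_uminus: "x \<in> \<Lambda> \<Longrightarrow> - x \<in> \<Lambda>"
    and F_zero: "F i 0 = (if i = 1 then 1 else 0)" and F_one: "F 0 1 = 1"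
begin

abbreviation P where "P \<equiv> ps_ring \<Lambda> :: ('v multiset \<Rightarrow> 'r) ring"
abbreviation I where "I \<equiv> fga_ideal F \<Lambda>"
abbreviation S where "S \<equiv> fga F \<Lambda>"
abbreviation X where "X \<equiv> fga_var F \<Lambda>"
abbreviation q where "q f \<equiv> I +>\<^bsub>P\<^esub> f"

definition fga_gens where
  "fga_gens = {ps_var 0} \<union> {ps_var (\<mu> + \<nu>) \<ominus>\<^bsub>P\<^esub> fgl_subst \<Lambda> F (ps_var \<mu>) (ps_var \<nu>) | \<mu> \<nu>.
     \<mu> \<in> \<Lambda> \<and> \<nu> \<in> \<Lambda>}"

lemma fga_ideal_eq: "I = ps_closure \<Lambda> (Idl\<^bsub>P\<^esub> fga_gens)"
  by (simp add: fga_ideal_def fga_gens_def)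

lemma fga_gens_sub: "fga_gens \<subseteq> carrier P"
  using lat_zero by (auto simp: fga_gens_def ps_var_closed lat_add fgl_subst_closed)

sublocale I: ideal I P
  unfolding fga_ideal_eq by (intro ps_closure_ideal ps.genideal_ideal fga_gens_sub)

lemma fga_gens_in: "g \<in> fga_gens \<Longrightarrow> g \<in> I"
proof -
  interpret J: ideal "Idl\<^bsub>P\<^esub> fga_gens" P by (intro ps.genideal_ideal fga_gens_sub)
  show "g \<in> fga_gens \<Longrightarrow> g \<in> I"
    unfolding fga_ideal_eq
    using ps_closure_incl[of "Idl\<^bsub>P\<^esub> fga_gens" \<Lambda>] ps.genideal_self[OF fga_gens_sub] J.a_subset by blast
qed

sublocale S: cring S
  unfolding fga_def by (rule I.quotient_is_cring[OF ps_cring])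

lemma q_hom: "(\<lambda>f. q f) \<in> ring_hom P S"
  unfolding fga_def by (rule I.rcos_ring_hom)

lemma q_ring_hom_cring: "ring_hom_cring P S (\<lambda>f. q f)"
  by (simp add: ring_hom_cring_def ring_hom_cring_axioms_def ps_cring S.is_cring q_hom)

sublocale q: ring_hom_cring P S "\<lambda>f. q f"
  by (rule q_ring_hom_cring)

lemma S_cases:
  assumes "s \<in> carrier S" obtains f where "f \<in> carrier P" "s = q f"
  using assms by (auto simp: fga_def FactRing_def A_RCOSETS_def' a_r_coset_def')

lemma q_eqI:
  assumes "f \<in> carrier P" "g \<in> carrier P" "(\<lambda>m. f m - g m) \<in> I" shows "q f = q g"
proof -
  have "f \<ominus>\<^bsub>P\<^esub> g \<in> I" using assms by (simp add: ps_minus)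
  thus ?thesis using ps.quotient_eq_iff_same_a_r_cos[OF I.is_ideal assms(1,2)] by simp
qed

lemma q_eqD:
  assumes "f \<in> carrier P" "g \<in> carrier P" "q f = q g" shows "(\<lambda>m. f m - g m) \<in> I"
  using ps.quotient_eq_iff_same_a_r_cos[OF I.is_ideal assms(1,2)] assms by (simp add: ps_minus)

lemma X_eq: "X \<mu> = q (ps_var \<mu>)"
  by (simp add: fga_var_def)

lemma X_closed: "\<mu> \<in> \<Lambda> \<Longrightarrow> X \<mu> \<in> carrier S"
  unfolding X_eq by (rule q.hom_closed) (rule ps_var_closed)

lemma q_Units:
  assumes "f \<in> carrier P" "f {#} * c = 1" shows "q f \<in> Units S"
proof -
  obtain g where g: "g \<in> carrier P" "g \<otimes>\<^bsub>P\<^esub> f = \<one>\<^bsub>P\<^esub>"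
    using ps_Units[OF assms] unfolding Units_def by auto
  have "q g \<otimes>\<^bsub>S\<^esub> q f = \<one>\<^bsub>S\<^esub>" using q.hom_mult[OF g(1) assms(1)] g(2) q.hom_one by simp
  thus ?thesis using assms g S.m_comm[of "q g" "q f"] unfolding Units_def by auto
qed

text \<open>The cofactor is the shifted series of \<open>fgl_subst_split\<close>; its constant term
  is the coefficient \<open>F 0 1\<close>.\<close>

lemma X_add:
  assumes "\<mu> \<in> \<Lambda>" "\<nu> \<in> \<Lambda>"
  shows "\<exists>h\<in>carrier P. h {#} = 1 \<and> X (\<mu> + \<nu>) = X \<mu> \<oplus>\<^bsub>S\<^esub> X \<nu> \<otimes>\<^bsub>S\<^esub> q h"
proof -
  let ?h = "fgl_subst \<Lambda> (\<lambda>i j. F i (Suc j)) (ps_var \<mu>) (ps_var \<nu>)"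
  have c: "ps_var \<mu> \<in> carrier P" "ps_var \<nu> \<in> carrier P" "ps_var (\<mu> + \<nu>) \<in> carrier P"
    using assms by (auto simp: ps_var_closed lat_add)
  have hc: "?h \<in> carrier P" using c by (simp add: fgl_subst_closed)
  have Fc: "fgl_subst \<Lambda> F (ps_var \<mu>) (ps_var \<nu>) \<in> carrier P" using c by (simp add: fgl_subst_closed)
  have "ps_var (\<mu> + \<nu>) \<ominus>\<^bsub>P\<^esub> fgl_subst \<Lambda> F (ps_var \<mu>) (ps_var \<nu>) \<in> I"
    using assms by (intro fga_gens_in) (auto simp: fga_gens_def)
  hence "X (\<mu> + \<nu>) = q (fgl_subst \<Lambda> F (ps_var \<mu>) (ps_var \<nu>))"
    unfolding X_eq using ps.quotient_eq_iff_same_a_r_cos[OF I.is_ideal c(3) Fc] by simp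
  also have "fgl_subst \<Lambda> F (ps_var \<mu>) (ps_var \<nu>) = ps_var \<mu> \<oplus>\<^bsub>P\<^esub> ps_var \<nu> \<otimes>\<^bsub>P\<^esub> ?h"
    by (rule fgl_subst_split) (use c assms F_zero in \<open>auto simp: ps_var_def\<close>)
  also have "q \<dots> = X \<mu> \<oplus>\<^bsub>S\<^esub> X \<nu> \<otimes>\<^bsub>S\<^esub> q ?h"
    using c hc by (simp only: X_eq q.hom_add q.hom_mult ps.m_closed)
  finally show ?thesis using hc F_one by (intro bexI[of _ ?h]) (auto simp: fgl_subst_empty)
qed

text \<open>Cofactors add up when \<nu> is added repeatedly, so the constant term counts the
  copies.\<close>

lemma X_add_nat:
  assumes "\<mu> \<in> \<Lambda>" "\<nu> \<in> \<Lambda>"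
  shows "\<exists>h\<in>carrier P. h {#} = of_nat n \<and> \<mu> + of_nat n *\<^sub>R \<nu> \<in> \<Lambda> \<and>
    X (\<mu> + of_nat n *\<^sub>R \<nu>) = X \<mu> \<oplus>\<^bsub>S\<^esub> X \<nu> \<otimes>\<^bsub>S\<^esub> q h"
proof (induction n)
  case 0
  have z: "ps_const 0 = \<zero>\<^bsub>P\<^esub>" by (auto simp: ps_ring_simps ps_const_def)
  have "q \<zero>\<^bsub>P\<^esub> = \<zero>\<^bsub>S\<^esub>" by (rule q.hom_zero)
  thus ?case using assms
    by (intro bexI[of _ "ps_const 0"]) (auto simp: X_closed z ps_const_closed, simp add: ps_ring_simps)
next
  case (Suc n)
  then obtain h where h: "h \<in> carrier P" "h {#} = of_nat n" "\<mu> + of_nat n *\<^sub>R \<nu> \<in> \<Lambda>"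
    "X (\<mu> + of_nat n *\<^sub>R \<nu>) = X \<mu> \<oplus>\<^bsub>S\<^esub> X \<nu> \<otimes>\<^bsub>S\<^esub> q h" by blast
  obtain h' where h': "h' \<in> carrier P" "h' {#} = 1"
    "X (\<mu> + of_nat n *\<^sub>R \<nu> + \<nu>) = X (\<mu> + of_nat n *\<^sub>R \<nu>) \<oplus>\<^bsub>S\<^esub> X \<nu> \<otimes>\<^bsub>S\<^esub> q h'"
    using X_add[OF h(3) assms(2)] by blast
  have e: "\<mu> + of_nat (Suc n) *\<^sub>R \<nu> = \<mu> + of_nat n *\<^sub>R \<nu> + \<nu>" by (simp add: algebra_simps)
  have "X (\<mu> + of_nat (Suc n) *\<^sub>R \<nu>) = X \<mu> \<oplus>\<^bsub>S\<^esub> X \<nu> \<otimes>\<^bsub>S\<^esub> q (h \<oplus>\<^bsub>P\<^esub> h')"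
    unfolding e h'(3) h(4)
    using h(1) h'(1) assms X_closed by (simp add: S.r_distr S.a_assoc)
  moreover have "(h \<oplus>\<^bsub>P\<^esub> h') {#} = of_nat (Suc n)" using h h' by (simp add: ps_ring_simps)
  moreover have "\<mu> + of_nat (Suc n) *\<^sub>R \<nu> \<in> \<Lambda>" unfolding e by (intro lat_add h assms)
  ultimately show ?case using h(1) h'(1) by (intro bexI[of _ "h \<oplus>\<^bsub>P\<^esub> h'"]) auto
qed

lemma lat_scale_nat: "\<nu> \<in> \<Lambda> \<Longrightarrow> of_nat n *\<^sub>R \<nu> \<in> \<Lambda>"
  using X_add_nat[OF lat_zero, of \<nu> n] by auto

text \<open>For \<nu> a root and \<open>k\<close> the pairing of \<mu> with its coroot, this is the
  divisibility of \<open>x_mu - x_(s mu)\<close> by \<open>x_nu\<close>, together with the constant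
  term of the quotient. For negative \<open>k\<close> the addition formula is read backwards and the
  cofactor negated.\<close>

lemma X_diff_int:
  assumes "\<mu> \<in> \<Lambda>" "\<nu> \<in> \<Lambda>"
  shows "\<exists>h\<in>carrier P. h {#} = of_int k \<and> X \<mu> = X (\<mu> - of_int k *\<^sub>R \<nu>) \<oplus>\<^bsub>S\<^esub> X \<nu> \<otimes>\<^bsub>S\<^esub> q h"
proof (cases "k \<ge> 0")
  case True
  define n where "n = nat k"
  have k: "k = int n" using True by (simp add: n_def)
  have "\<mu> - of_nat n *\<^sub>R \<nu> \<in> \<Lambda>"
    using lat_add[OF assms(1) lat_uminus[OF lat_scale_nat[OF assms(2)]], of n] by simp
  from X_add_nat[OF this assms(2), of n] show ?thesis by (auto simp: k)
next
  case False
  define n where "n = nat (- k)"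
  have k: "k = - int n" using False by (simp add: n_def)
  obtain h where h: "h \<in> carrier P" "h {#} = of_nat n" "\<mu> + of_nat n *\<^sub>R \<nu> \<in> \<Lambda>"
    "X (\<mu> + of_nat n *\<^sub>R \<nu>) = X \<mu> \<oplus>\<^bsub>S\<^esub> X \<nu> \<otimes>\<^bsub>S\<^esub> q h" using X_add_nat[OF assms] by blast
  have cl: "X \<mu> \<in> carrier S" "X \<nu> \<in> carrier S" "q h \<in> carrier S" using assms X_closed h(1) by auto
  have "X \<mu> = X (\<mu> + of_nat n *\<^sub>R \<nu>) \<oplus>\<^bsub>S\<^esub> X \<nu> \<otimes>\<^bsub>S\<^esub> q (\<ominus>\<^bsub>P\<^esub> h)"
    unfolding h(4) using h(1) cl by (simp add: S.r_minus S.a_assoc S.r_neg)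
  moreover have "(\<ominus>\<^bsub>P\<^esub> h) {#} = - of_nat n" using h by (simp add: ps_a_inv)
  ultimately show ?thesis using h(1) by (intro bexI[of _ "\<ominus>\<^bsub>P\<^esub> h"]) (auto simp: k)
qed

lemma lattice_aut_zero: "lattice_aut \<Lambda> w \<Longrightarrow> w 0 = 0"
  unfolding lattice_aut_def by (metis add_cancel_right_right)

text \<open>Additivity of \<open>w\<close> sends each generator of the ideal to a generator, so the
  preimage of the generated ideal contains that ideal. The action preserves degrees and therefore
  passes to the closure.\<close>

lemma ps_act_ideal:
  assumes w: "lattice_aut \<Lambda> w" and f: "f \<in> I" shows "ps_act w f \<in> I"
proof -
  have b: "bij w" "w ` \<Lambda> = \<Lambda>" and lin: "\<And>x y. w (x + y) = w x + w y"
    using w by (auto simp: lattice_aut_def)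
  let ?J = "Idl\<^bsub>P\<^esub> fga_gens"
  interpret h: ring_hom_ring P P "ps_act w"
    by (rule ring_hom_ringI2) (use ps.ring_axioms ps_act_hom[OF b] in auto)
  interpret J: ideal ?J P by (intro ps.genideal_ideal fga_gens_sub)
  have "ideal {r \<in> carrier P. ps_act w r \<in> ?J} P" by (rule h.ideal_vimage[OF J.is_ideal])
  moreover have "fga_gens \<subseteq> {r \<in> carrier P. ps_act w r \<in> ?J}"
  proof
    fix g assume g: "g \<in> fga_gens"
    have "ps_act w g \<in> fga_gens"
    proof (cases "g = ps_var 0")
      case True
      thus ?thesis by (simp add: ps_act_var[OF b(1)] lattice_aut_zero[OF w] fga_gens_def)
    next
      case False
      then obtain \<mu> \<nu> where mn: "\<mu> \<in> \<Lambda>" "\<nu> \<in> \<Lambda>"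
        and ge: "g = ps_var (\<mu> + \<nu>) \<ominus>\<^bsub>P\<^esub> fgl_subst \<Lambda> F (ps_var \<mu>) (ps_var \<nu>)"
        using g by (auto simp: fga_gens_def)
      have wmn: "w \<mu> \<in> \<Lambda>" "w \<nu> \<in> \<Lambda>" using mn b(2) by auto
      have c: "ps_var \<mu> \<in> carrier P" "ps_var \<nu> \<in> carrier P" "ps_var (\<mu> + \<nu>) \<in> carrier P"
        using mn by (auto simp: ps_var_closed lat_add)
      have "ps_act w g = ps_var (w \<mu> + w \<nu>) \<ominus>\<^bsub>P\<^esub> fgl_subst \<Lambda> F (ps_var (w \<mu>)) (ps_var (w \<nu>))"
        unfolding ge using c
        by (simp add: ps.minus_eq fgl_subst_closed ps_act_fgl_subst[OF b] ps_act_var[OF b(1)] lin)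
      thus ?thesis using wmn by (auto simp: fga_gens_def)
    qed
    thus "g \<in> {r \<in> carrier P. ps_act w r \<in> ?J}"
      using g fga_gens_sub ps.genideal_self[OF fga_gens_sub] by blast
  qed
  ultimately have J: "?J \<subseteq> {r \<in> carrier P. ps_act w r \<in> ?J}" by (rule ps.genideal_minimal)
  have fc: "f \<in> carrier P" using f by (rule I.Icarr)
  have "\<exists>g\<in>?J. \<forall>m. size m < d \<longrightarrow> ps_act w f m = g m" for d
  proof -
    obtain g where g: "g \<in> ?J" "\<And>m. size m < d \<Longrightarrow> f m = g m"
      using f unfolding fga_ideal_eq ps_closure_def by blast
    have "ps_act w f m = ps_act w g m" if "size m < d" for m using g(2) that by (simp add: ps_act_def)
    moreover have "ps_act w g \<in> ?J" using J g(1) by blast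
    ultimately show ?thesis by blast
  qed
  thus ?thesis unfolding fga_ideal_eq ps_closure_def using ps_act_closed[OF b fc] by blast
qed

lemma lattice_aut_inv: 
  assumes w: "lattice_aut \<Lambda> w" shows "lattice_aut \<Lambda> (inv_into UNIV w)"
proof -
  have b: "bij w" "w ` \<Lambda> = \<Lambda>" "\<And>x y. w (x + y) = w x + w y" using w by (auto simp: lattice_aut_def)
  have "inv_into UNIV w ` \<Lambda> = \<Lambda>" using b by (metis bij_is_inj image_inv_f_f)
  moreover have "inv_into UNIV w (x + y) = inv_into UNIV w x + inv_into UNIV w y" for x y
    using b by (metis bij_inv_eq_iff)
  ultimately show ?thesis using b(1) by (simp add: lattice_aut_def bij_imp_bij_inv)
qed

lemma ps_act_inv:
  assumes "bij w" shows "ps_act w (ps_act (inv_into UNIV w) f) = f" "ps_act (inv_into UNIV w) (ps_act w f) = f"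
proof -
  have "w \<circ> inv_into UNIV w = id" "inv_into UNIV w \<circ> w = id"
    using assms by (auto simp: bij_is_inj bij_is_surj surj_iff[symmetric])
  thus "ps_act w (ps_act (inv_into UNIV w) f) = f" "ps_act (inv_into UNIV w) (ps_act w f) = f"
    using assms by (simp_all add: ps_act_comp ps_act_id bij_imp_bij_inv)
qed

text \<open>The action on the quotient is the image of a coset. That this image is a full coset
  needs \<open>w\<close> to map the ideal onto itself, for which the inverse automorphism is used as
  well.\<close>

lemma fga_act_q:
  assumes w: "lattice_aut \<Lambda> w" shows "fga_act w (q f) = q (ps_act w f)"
proof -
  have b: "bij w" using w by (simp add: lattice_aut_def)
  have "ps_act w ` I = I"
  proof (intro equalityI subsetI)
    fix f assume "f \<in> I"
    hence "ps_act (inv_into UNIV w) f \<in> I" by (rule ps_act_ideal[OF lattice_aut_inv[OF w]])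
    thus "f \<in> ps_act w ` I" using ps_act_inv(1)[OF b, of f] by (metis image_eqI)
  qed (auto simp: ps_act_ideal[OF w])
  moreover have "fga_act w (q f) = (\<lambda>i m. i m + ps_act w f m) ` ps_act w ` I"
    unfolding fga_act_def a_r_coset_def' by (auto simp: ps_ring_simps ps_act_add image_iff)
  moreover have "q (ps_act w f) = (\<lambda>i m. i m + ps_act w f m) ` I"
    unfolding a_r_coset_def' by (auto simp: ps_ring_simps)
  ultimately show ?thesis by simp
qed

lemma fga_act_X: "lattice_aut \<Lambda> w \<Longrightarrow> fga_act w (X \<mu>) = X (w \<mu>)"
  unfolding X_eq by (simp add: fga_act_q ps_act_var lattice_aut_def)

lemma fga_act_hom:
  assumes w: "lattice_aut \<Lambda> w" shows "fga_act w \<in> ring_hom S S"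
proof (rule ring_hom_memI)
  have b: "bij w" "w ` \<Lambda> = \<Lambda>" using w by (auto simp: lattice_aut_def)
  interpret h: ring_hom_ring P P "ps_act w"
    by (rule ring_hom_ringI2) (use ps.ring_axioms ps_act_hom[OF b] in auto)
  show "fga_act w \<one>\<^bsub>S\<^esub> = \<one>\<^bsub>S\<^esub>"
    using fga_act_q[OF w, of "\<one>\<^bsub>P\<^esub>"] h.hom_one q.hom_one by simp
  fix s assume "s \<in> carrier S"
  then obtain f where f: "f \<in> carrier P" "s = q f" by (rule S_cases)
  show "fga_act w s \<in> carrier S" using f by (simp add: fga_act_q[OF w])
  fix t assume "t \<in> carrier S"
  then obtain g where g: "g \<in> carrier P" "t = q g" by (rule S_cases)
  show "fga_act w (s \<otimes>\<^bsub>S\<^esub> t) = fga_act w s \<otimes>\<^bsub>S\<^esub> fga_act w t"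
    using f g by (simp add: fga_act_q[OF w] q.hom_mult[symmetric] del: q.hom_mult)
  show "fga_act w (s \<oplus>\<^bsub>S\<^esub> t) = fga_act w s \<oplus>\<^bsub>S\<^esub> fga_act w t"
    using f g by (simp add: fga_act_q[OF w] q.hom_add[symmetric] del: q.hom_add)
qed

lemma fga_act_comp:
  assumes "lattice_aut \<Lambda> v" "lattice_aut \<Lambda> w" "s \<in> carrier S"
  shows "fga_act v (fga_act w s) = fga_act (v \<circ> w) s"
  using assms(1,2) unfolding fga_act_def image_comp
  by (simp add: comp_def ps_act_comp lattice_aut_def)

lemma fga_act_id: "fga_act id s = s"
  by (simp add: fga_act_def ps_act_id)

end

section \<open>Affine Demazure algebras over twisted group algebras\<close>

lemma generate_ring_mono:
  assumes "A \<subseteq> B" shows "generate_ring R A \<subseteq> generate_ring R B"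
proof
  fix h assume "h \<in> generate_ring R A"
  thus "h \<in> generate_ring R B" by induction (use assms in \<open>auto intro: generate_ring.intros\<close>)
qed

text \<open>Reconciles the denominator at \<open>- \<theta>\<close> in the affine generator with the
  reflection, which is written with \<theta>.\<close>

lemma reflection_uminus: "reflection (- \<alpha>) = reflection \<alpha>"
  by (auto simp: reflection_def coroot_def fun_eq_iff)

text \<open>
  \<open>Sc\<close> is the image of \<open>S\<close> in \<open>K\<close>, \<open>xi\<close> and \<open>Yi\<close> are the inverses of \<open>x\<close> and \<open>Y\<close> at roots,
  \<open>Y l\<close> is \<open>y\<^sub>l\<close>, and \<open>\<kappa>\<close> is \<open>1 / |W|\<close>.
\<close>

locale demazure_core = based_root_sys \<Phi> \<Delta> + twisted_algebra K "affine_weyl_group \<Phi>" act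
  for \<Phi> \<Delta> :: "'v::euclidean_space set" and K :: "('k, 'm) ring_scheme" and act +
  fixes ac :: "('v \<Rightarrow> 'v) \<Rightarrow> 'k \<Rightarrow> 'k" and Sc :: "'k set" and x xi Y Yi :: "'v \<Rightarrow> 'k" and \<theta> :: 'v and \<kappa> :: 'k
  assumes irr: "irreducible_root_system \<Phi>" and \<theta>: "\<theta> \<in> \<Phi>"
    and act_ac: "act (\<mu>, w) = ac w"
    and Sc_sub: "subring Sc K"
    and x_Sc: "\<alpha> \<in> \<Phi> \<Longrightarrow> x \<alpha> \<in> Sc"
    and xi_closed: "\<alpha> \<in> \<Phi> \<Longrightarrow> xi \<alpha> \<in> carrier K"
    and x_xi: "\<alpha> \<in> \<Phi> \<Longrightarrow> x \<alpha> \<otimes>\<^bsub>K\<^esub> xi \<alpha> = \<one>\<^bsub>K\<^esub>"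
    and ac_xi: "w \<in> weyl_group \<Phi> \<Longrightarrow> \<alpha> \<in> \<Phi> \<Longrightarrow> ac w (xi \<alpha>) = xi (w \<alpha>)"
    and Y_Sc: "l \<in> root_lattice \<Phi> \<Longrightarrow> Y l \<in> Sc"
    and ac_Y: "w \<in> weyl_group \<Phi> \<Longrightarrow> l \<in> root_lattice \<Phi> \<Longrightarrow> ac w (Y l) = Y (w l)"
    and Yi_closed: "\<alpha> \<in> \<Phi> \<Longrightarrow> Yi \<alpha> \<in> carrier K"
    and Y_Yi: "\<alpha> \<in> \<Phi> \<Longrightarrow> Y \<alpha> \<otimes>\<^bsub>K\<^esub> Yi \<alpha> = \<one>\<^bsub>K\<^esub>"
    and ac_Yi: "w \<in> weyl_group \<Phi> \<Longrightarrow> \<alpha> \<in> \<Phi> \<Longrightarrow> ac w (Yi \<alpha>) = Yi (w \<alpha>)"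
    and Yi_xi: "\<alpha> \<in> \<Phi> \<Longrightarrow> \<exists>u\<in>Sc. Yi \<alpha> = u \<otimes>\<^bsub>K\<^esub> xi \<alpha>"
    and Y_reflection: "\<alpha> \<in> \<Phi> \<Longrightarrow> l \<in> root_lattice \<Phi> \<Longrightarrow>
      \<exists>n\<in>carrier K. (\<forall>w\<in>weyl_group \<Phi>. ac w n = n) \<and>
        Y l \<ominus>\<^bsub>K\<^esub> Y (reflection \<alpha> l) = n \<otimes>\<^bsub>K\<^esub> Y \<alpha>"
    and Y_diff_unit: "l \<in> root_lattice \<Phi> \<Longrightarrow> l' \<in> root_lattice \<Phi> \<Longrightarrow> \<alpha> \<in> \<Phi> \<Longrightarrow> m > 0 \<Longrightarrow>
      l - l' = of_nat m *\<^sub>R \<alpha> \<Longrightarrow> Y l \<ominus>\<^bsub>K\<^esub> Y l' \<in> Units K"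
    and \<kappa>_Sc: "\<kappa> \<in> Sc" and \<kappa>_sum: "finsum K (\<lambda>w. \<kappa>) (weyl_group \<Phi>) = \<one>\<^bsub>K\<^esub>"
begin

abbreviation amul (infixl "\<boxtimes>" 70) where "f \<boxtimes> g \<equiv> f \<otimes>\<^bsub>TA\<^esub> g"
abbreviation aadd (infixl "\<boxplus>" 65) where "f \<boxplus> g \<equiv> f \<oplus>\<^bsub>TA\<^esub> g"
abbreviation asub (infixl "\<boxminus>" 65) where "f \<boxminus> g \<equiv> f \<ominus>\<^bsub>TA\<^esub> g"
abbreviation GG where "GG \<equiv> affine_weyl_group \<Phi>"
abbreviation e where "e w \<equiv> eta (0, w)"
abbreviation tr where "tr \<nu> \<equiv> eta (\<nu>, id)"
abbreviation dem where "dem c u \<equiv> sc c \<boxtimes> (\<one>\<^bsub>TA\<^esub> \<boxminus> eta u)"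

lemma GG_simps:
  "carrier GG = CrL \<times> W" "\<one>\<^bsub>GG\<^esub> = (0, id)"
  "(\<mu>, w) \<otimes>\<^bsub>GG\<^esub> (\<nu>, v) = (\<mu> + w \<nu>, w \<circ> v)"
  by (auto simp: affine_weyl_group_def)

lemma GG_inv:
  assumes "\<mu> \<in> CrL" "w \<in> W"
  shows "inv\<^bsub>GG\<^esub> (\<mu>, w) = (- inv_into UNIV w \<mu>, inv_into UNIV w)"
proof (rule G.inv_equality)
  show "(- inv_into UNIV w \<mu>, inv_into UNIV w) \<otimes>\<^bsub>GG\<^esub> (\<mu>, w) = \<one>\<^bsub>GG\<^esub>"
    using assms by (auto simp: GG_simps fun_eq_iff weyl_inv_simps)
qed (use assms in \<open>auto simp: GG_simps int_lattice_uminus CrL_weyl weyl_inv\<close>)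

lemma W_GG [simp]: "w \<in> W \<Longrightarrow> (0, w) \<in> carrier GG"
  by (auto simp: GG_simps int_lattice_zero)

lemma tr_GG: "\<nu> \<in> CrL \<Longrightarrow> (\<nu>, id) \<in> carrier GG"
  by (auto simp: GG_simps weyl_group.id)

lemma e_closed [simp]: "w \<in> W \<Longrightarrow> e w \<in> carrier TA"
  by simp

lemma e_mult: "v \<in> W \<Longrightarrow> w \<in> W \<Longrightarrow> e v \<boxtimes> e w = e (v \<circ> w)"
  using eta_mult[OF W_GG W_GG, of v w] by (simp add: GG_simps(3) linear_0[OF weyl_linear[of v \<Phi>]])

lemma e_id: "e id = \<one>\<^bsub>TA\<^esub>"
  by (simp add: tw_one GG_simps)

lemma e_inv: "w \<in> W \<Longrightarrow> e w \<boxtimes> e (inv_into UNIV w) = \<one>\<^bsub>TA\<^esub>"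
  "w \<in> W \<Longrightarrow> e (inv_into UNIV w) \<boxtimes> e w = \<one>\<^bsub>TA\<^esub>"
proof -
  assume w: "w \<in> W"
  have "w \<circ> inv_into UNIV w = id" "inv_into UNIV w \<circ> w = id"
    by (auto simp: fun_eq_iff weyl_inv_simps[OF w])
  thus "e w \<boxtimes> e (inv_into UNIV w) = \<one>\<^bsub>TA\<^esub>" "e (inv_into UNIV w) \<boxtimes> e w = \<one>\<^bsub>TA\<^esub>"
    using w by (simp_all only: e_mult weyl_inv e_id)
qed

lemma ac_closed [simp]: "w \<in> W \<Longrightarrow> c \<in> carrier K \<Longrightarrow> ac w c \<in> carrier K"
  using act_closed[OF W_GG] by (simp add: act_ac)

lemma e_sc: "w \<in> W \<Longrightarrow> c \<in> carrier K \<Longrightarrow> e w \<boxtimes> sc c = sc (ac w c) \<boxtimes> e w"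
  using eta_sc[OF W_GG] by (simp add: act_ac)

lemma Sc_carrier: "c \<in> Sc \<Longrightarrow> c \<in> carrier K"
  using subringE(1)[OF Sc_sub] by blast

lemma x_closed: "\<alpha> \<in> \<Phi> \<Longrightarrow> x \<alpha> \<in> carrier K" and Y_closed: "l \<in> RtL \<Longrightarrow> Y l \<in> carrier K"
  by (auto intro: Sc_carrier x_Sc Y_Sc)

lemma TA_minus_distr:
  assumes "a \<in> carrier TA" "b \<in> carrier TA" "c \<in> carrier TA"
  shows "a \<boxtimes> (b \<boxminus> c) = a \<boxtimes> b \<boxminus> a \<boxtimes> c" "(b \<boxminus> c) \<boxtimes> a = b \<boxtimes> a \<boxminus> c \<boxtimes> a"
  using assms by (simp_all add: TA.minus_eq TA.r_distr TA.l_distr TA.r_minus TA.l_minus)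

lemma sc_uminus: "c \<in> carrier K \<Longrightarrow> sc (\<ominus>\<^bsub>K\<^esub> c) = \<ominus>\<^bsub>TA\<^esub> sc c"
  by (metis TA.minus_equality K.l_neg K.a_inv_closed sc_add sc_zero tw_elem_closed G.one_closed)

lemma sc_minus: "c \<in> carrier K \<Longrightarrow> d \<in> carrier K \<Longrightarrow> sc (c \<ominus>\<^bsub>K\<^esub> d) = sc c \<boxminus> sc d"
  by (simp only: K.minus_eq TA.minus_eq sc_add[symmetric] sc_uminus K.a_inv_closed)

subsection \<open>The Demazure algebras\<close>

abbreviation X0 where "X0 \<equiv> dem (xi (- \<theta>)) (coroot \<theta>, reflection \<theta>)"
abbreviation Xs where "Xs \<alpha> \<equiv> dem (xi \<alpha>) (0, reflection \<alpha>)"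

definition DW where "DW = generate_ring TA ((\<lambda>c. sc c) ` Sc \<union> (\<lambda>\<alpha>. Xs \<alpha>) ` \<Delta>)"
definition H where "H = generate_ring TA ((\<lambda>c. sc c) ` Sc \<union> insert X0 ((\<lambda>\<alpha>. Xs \<alpha>) ` \<Delta>))"

lemma coroot_refl_GG: "(coroot \<theta>, reflection \<theta>) \<in> carrier GG"
  using \<theta> by (auto simp: GG_simps CrL_coroot weyl_reflection)

lemma X0_closed: "X0 \<in> carrier TA"
  using \<theta> coroot_refl_GG by (simp add: xi_closed uminus_root)

lemma Xs_closed: "\<alpha> \<in> \<Phi> \<Longrightarrow> Xs \<alpha> \<in> carrier TA"
  by (simp add: xi_closed weyl_reflection)

lemma H_gens: "(\<lambda>c. sc c) ` Sc \<union> insert X0 ((\<lambda>\<alpha>. Xs \<alpha>) ` \<Delta>) \<subseteq> carrier TA"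
  using X0_closed Xs_closed simple_root Sc_carrier by auto

lemma DW_H: "f \<in> DW \<Longrightarrow> f \<in> H"
  unfolding DW_def H_def
  using generate_ring_mono[of "(\<lambda>c. sc c) ` Sc \<union> (\<lambda>\<alpha>. Xs \<alpha>) ` \<Delta>"
      "(\<lambda>c. sc c) ` Sc \<union> insert X0 ((\<lambda>\<alpha>. Xs \<alpha>) ` \<Delta>)" TA] by blast

lemma H_sub: "subring H TA"
  unfolding H_def by (rule TA.generate_ring_is_subring[OF H_gens])

lemma DW_sub: "subring DW TA"
  unfolding DW_def by (rule TA.generate_ring_is_subring) (use H_gens in blast)

lemma H_closed: "f \<in> H \<Longrightarrow> f \<in> carrier TA"
  using subringE(1)[OF H_sub] by blast

lemma H_ops: "\<one>\<^bsub>TA\<^esub> \<in> H" "f \<in> H \<Longrightarrow> g \<in> H \<Longrightarrow> f \<boxtimes> g \<in> H" "f \<in> H \<Longrightarrow> g \<in> H \<Longrightarrow> f \<boxplus> g \<in> H"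
  "f \<in> H \<Longrightarrow> \<ominus>\<^bsub>TA\<^esub> f \<in> H" "f \<in> H \<Longrightarrow> g \<in> H \<Longrightarrow> f \<boxminus> g \<in> H" "\<zero>\<^bsub>TA\<^esub> \<in> H"
  using subringE[OF H_sub] by (auto simp: TA.minus_eq)

lemma DW_ops: "\<one>\<^bsub>TA\<^esub> \<in> DW" "f \<in> DW \<Longrightarrow> g \<in> DW \<Longrightarrow> f \<boxtimes> g \<in> DW" "f \<in> DW \<Longrightarrow> g \<in> DW \<Longrightarrow> f \<boxplus> g \<in> DW"
  "f \<in> DW \<Longrightarrow> \<ominus>\<^bsub>TA\<^esub> f \<in> DW" "f \<in> DW \<Longrightarrow> g \<in> DW \<Longrightarrow> f \<boxminus> g \<in> DW"
  using subringE[OF DW_sub] by (auto simp: TA.minus_eq)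

lemma sc_DW: "c \<in> Sc \<Longrightarrow> sc c \<in> DW"
  unfolding DW_def by (rule generate_ring.incl) blast

lemma sc_H: "c \<in> Sc \<Longrightarrow> sc c \<in> H"
  by (intro DW_H sc_DW)

lemma X0_H: "X0 \<in> H"
  unfolding H_def by (rule generate_ring.incl) blast

lemma H_induct [consumes 1, case_names one sc X0 Xs uminus add mult]:
  assumes "h \<in> H" "P \<one>\<^bsub>TA\<^esub>" "\<And>c. c \<in> Sc \<Longrightarrow> P (sc c)" "P X0" "\<And>\<alpha>. \<alpha> \<in> \<Delta> \<Longrightarrow> P (Xs \<alpha>)"
    "\<And>h. h \<in> H \<Longrightarrow> P h \<Longrightarrow> P (\<ominus>\<^bsub>TA\<^esub> h)"
    "\<And>g h. g \<in> H \<Longrightarrow> h \<in> H \<Longrightarrow> P g \<Longrightarrow> P h \<Longrightarrow> P (g \<boxplus> h)"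
    "\<And>g h. g \<in> H \<Longrightarrow> h \<in> H \<Longrightarrow> P g \<Longrightarrow> P h \<Longrightarrow> P (g \<boxtimes> h)"
  shows "P h"
  using assms(1) unfolding H_def
proof (induction rule: generate_ring.induct)
  case (incl h)
  thus ?case using assms(3,4,5) by blast
qed (use assms(2,6-8)[unfolded H_def] in blast)+

text \<open>Multiplying the Demazure element by \<open>x_alpha\<close> cancels its denominator; so
  the algebras contain the group elements belonging to their generators.\<close>

lemma eta_from_dem:
  assumes "\<alpha> \<in> \<Phi>" "u \<in> carrier GG"
  shows "eta u = \<one>\<^bsub>TA\<^esub> \<boxminus> sc (x \<alpha>) \<boxtimes> dem (xi \<alpha>) u"
proof -
  have "sc (x \<alpha>) \<boxtimes> dem (xi \<alpha>) u = (sc (x \<alpha>) \<boxtimes> sc (xi \<alpha>)) \<boxtimes> (\<one>\<^bsub>TA\<^esub> \<boxminus> eta u)"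
    using assms by (intro TA.m_assoc[symmetric]) (auto simp: x_closed xi_closed)
  also have "\<dots> = \<one>\<^bsub>TA\<^esub> \<boxminus> eta u"
    using assms by (simp add: sc_mult x_closed xi_closed x_xi sc_one)
  finally show ?thesis using assms(2)
    by (simp add: TA.minus_eq TA.minus_add TA.r_neg2)
qed

lemma e_DW: assumes "w \<in> W" shows "e w \<in> DW"
proof -
  have "w \<in> weyl_group \<Delta>" using assms by (simp add: weyl_simple)
  thus ?thesis
  proof induction
    case id
    show ?case using DW_ops(1) by (simp only: e_id)
  next
    case (reflect \<alpha> w)
    have a: "\<alpha> \<in> \<Phi>" by (rule simple_root[OF reflect.hyps(1)])
    have "Xs \<alpha> \<in> DW" unfolding DW_def by (rule generate_ring.incl) (use reflect.hyps in blast)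
    hence "e (reflection \<alpha>) \<in> DW"
      by (subst eta_from_dem[OF a W_GG[OF weyl_reflection[OF a]]])
        (rule DW_ops(5)[OF DW_ops(1) DW_ops(2)[OF sc_DW[OF x_Sc[OF a]]]])
    moreover have "e (reflection \<alpha> \<circ> w) = e (reflection \<alpha>) \<boxtimes> e w"
      using reflect.hyps by (intro e_mult[symmetric] weyl_reflection a) (simp add: weyl_simple)
    ultimately show ?case using reflect.IH by (simp only: DW_ops(2))
  qed
qed

lemma e_H: "w \<in> W \<Longrightarrow> e w \<in> H"
  by (intro DW_H e_DW)

lemma e_conj:
  assumes "w \<in> W" "\<alpha> \<in> \<Phi>"
  shows "e w \<boxtimes> e (reflection \<alpha>) = e (reflection (w \<alpha>)) \<boxtimes> e w"
  using assms by (simp only: e_mult weyl_reflection reflection_conj weyl_root)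

lemma e_dem:
  assumes w: "w \<in> W" and a: "\<alpha> \<in> \<Phi>" and c: "c \<in> carrier K"
  shows "e w \<boxtimes> dem c (0, reflection \<alpha>) = dem (ac w c) (0, reflection (w \<alpha>)) \<boxtimes> e w"
proof -
  have r: "reflection \<alpha> \<in> W" "reflection (w \<alpha>) \<in> W"
    by (rule weyl_reflection[OF a], rule weyl_reflection[OF weyl_root[OF w a]])
  have "e w \<boxtimes> dem c (0, reflection \<alpha>) = (e w \<boxtimes> sc c) \<boxtimes> (\<one>\<^bsub>TA\<^esub> \<boxminus> e (reflection \<alpha>))"
    using w r c by (intro TA.m_assoc[symmetric]) auto
  also have "\<dots> = sc (ac w c) \<boxtimes> (e w \<boxtimes> (\<one>\<^bsub>TA\<^esub> \<boxminus> e (reflection \<alpha>)))"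
    unfolding e_sc[OF w c] using w r c by (intro TA.m_assoc) auto
  also have "e w \<boxtimes> (\<one>\<^bsub>TA\<^esub> \<boxminus> e (reflection \<alpha>)) = (\<one>\<^bsub>TA\<^esub> \<boxminus> e (reflection (w \<alpha>))) \<boxtimes> e w"
    using w r by (simp add: TA_minus_distr e_conj[OF w a])
  also have "sc (ac w c) \<boxtimes> \<dots> = dem (ac w c) (0, reflection (w \<alpha>)) \<boxtimes> e w"
    using w r c by (intro TA.m_assoc[symmetric]) auto
  finally show ?thesis .
qed

text \<open>Every root is Weyl conjugate to a simple one, and conjugation by \<open>e w\<close>,
  which lies in \<open>D_W\<close>, carries the Demazure element of \<alpha> to that of
  \<open>w \<alpha>\<close>.\<close>

lemma Xs_DW: assumes "\<beta> \<in> \<Phi>" shows "Xs \<beta> \<in> DW"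
proof -
  obtain w \<alpha> where w: "w \<in> W" "\<alpha> \<in> \<Delta>" "\<beta> = w \<alpha>" using root_conj_simple[OF assms] by (auto simp: weyl_simple)
  have a: "\<alpha> \<in> \<Phi>" by (rule simple_root[OF w(2)])
  have X: "Xs \<alpha> \<in> DW" unfolding DW_def by (rule generate_ring.incl) (use w in blast)
  have "Xs \<beta> = Xs \<beta> \<boxtimes> (e w \<boxtimes> e (inv_into UNIV w))"
    using Xs_closed[OF assms] by (simp only: e_inv(1)[OF w(1)] TA.r_one)
  also have "\<dots> = (Xs \<beta> \<boxtimes> e w) \<boxtimes> e (inv_into UNIV w)"
    using w Xs_closed[OF assms] weyl_inv[OF w(1)] by (intro TA.m_assoc[symmetric]) auto
  also have "Xs \<beta> \<boxtimes> e w = e w \<boxtimes> Xs \<alpha>"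
    using e_dem[OF w(1) a xi_closed[OF a]] by (simp add: ac_xi[OF w(1) a] w(3))
  also have "(e w \<boxtimes> Xs \<alpha>) \<boxtimes> e (inv_into UNIV w) \<in> DW"
    by (intro DW_ops e_DW X w weyl_inv)
  finally show ?thesis .
qed

lemma eta_theta_H: "eta (coroot \<theta>, reflection \<theta>) \<in> H"
  by (subst eta_from_dem[OF uminus_root[OF \<theta>] coroot_refl_GG])
    (rule H_ops(5)[OF H_ops(1) H_ops(2)[OF sc_H[OF x_Sc[OF uminus_root[OF \<theta>]]] X0_H]])

text \<open>The translation is the product of the affine reflection \<open>s_0\<close> and the
  reflection in \<theta>, both available as group elements of the algebra.\<close>

lemma tr_theta_H: "tr (coroot \<theta>) \<in> H"
proof -
  have m: "- \<theta> \<in> \<Phi>" by (rule uminus_root[OF \<theta>])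
  have r: "reflection \<theta> \<in> W" by (rule weyl_reflection[OF \<theta>])
  have "eta (coroot \<theta>, reflection \<theta>) \<in> H" by (rule eta_theta_H)
  hence "eta (coroot \<theta>, reflection \<theta>) \<boxtimes> e (reflection \<theta>) \<in> H" by (intro H_ops e_H r)
  moreover have "eta (coroot \<theta>, reflection \<theta>) \<boxtimes> e (reflection \<theta>) = tr (coroot \<theta>)"
    using eta_mult[OF coroot_refl_GG W_GG[OF r]]
    by (simp add: GG_simps linear_0[OF reflection_linear] reflection_comp_self del: o_apply)
  ultimately show ?thesis by simp
qed

text \<open>Conjugation by \<open>v\<close> moves the translation along the Weyl orbit. These
  translations are the test elements for centrality in \<open>Z_fixed\<close>.\<close>

lemma tr_orbit_H: assumes v: "v \<in> W" shows "tr (v (coroot \<theta>)) \<in> H"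
proof -
  have c: "coroot \<theta> \<in> CrL" "v (coroot \<theta>) \<in> CrL"
    by (rule CrL_coroot[OF \<theta>], rule CrL_weyl[OF v CrL_coroot[OF \<theta>]])
  have i: "inv_into UNIV v \<in> W" by (rule weyl_inv[OF v])
  have id: "v \<circ> inv_into UNIV v = id" by (auto simp: fun_eq_iff weyl_inv_simps[OF v])
  have "e v \<boxtimes> tr (coroot \<theta>) = eta (v (coroot \<theta>), v)"
    using eta_mult[OF W_GG[OF v] tr_GG[OF c(1)]] by (simp add: GG_simps)
  hence "e v \<boxtimes> tr (coroot \<theta>) \<boxtimes> e (inv_into UNIV v) = tr (v (coroot \<theta>))"
    using eta_mult[OF _ W_GG[OF i], of "(v (coroot \<theta>), v)"] c v
    by (simp add: GG_simps linear_0[OF weyl_linear[OF v]] id)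
  moreover have "e v \<boxtimes> tr (coroot \<theta>) \<boxtimes> e (inv_into UNIV v) \<in> H"
    by (intro H_ops e_H tr_theta_H v i)
  ultimately show ?thesis by simp
qed

subsection \<open>The projection onto translations\<close>

definition p :: "('v \<times> ('v \<Rightarrow> 'v) \<Rightarrow> 'k) \<Rightarrow> 'v \<times> ('v \<Rightarrow> 'v) \<Rightarrow> 'k" where
  "p f = (\<lambda>(\<mu>, w). if w = id then finsum K (\<lambda>v. f (\<mu>, v)) W else \<zero>\<^bsub>K\<^esub>)"

lemma p_apply: "p f (\<mu>, w) = (if w = id then finsum K (\<lambda>v. f (\<mu>, v)) W else \<zero>\<^bsub>K\<^esub>)"
  by (simp add: p_def)

lemma p_closed [simp]: assumes f: "f \<in> carrier TA" shows "p f \<in> carrier TA"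
proof -
  have cl: "finsum K (\<lambda>v. f (\<mu>, v)) W \<in> carrier K" for \<mu> using f by (intro K.finsum_closed) auto
  have z: "finsum K (\<lambda>v. f (\<mu>, v)) W = \<zero>\<^bsub>K\<^esub>" if "\<And>v. f (\<mu>, v) = \<zero>\<^bsub>K\<^esub>" for \<mu>
    using that by simp
  have "p f u \<in> carrier K" for u by (cases u) (simp add: p_apply cl)
  moreover have "p f u = \<zero>\<^bsub>K\<^esub>" if u: "u \<notin> carrier GG" for u
  proof (cases u)
    case (Pair \<mu> w)
    show ?thesis
    proof (cases "w = id")
      case True
      hence "\<mu> \<notin> CrL" using u Pair weyl_group.id[of \<Phi>] by (simp add: GG_simps)
      hence "f (\<mu>, v) = \<zero>\<^bsub>K\<^esub>" for v by (intro tw_outside[OF f]) (simp add: GG_simps)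
      thus ?thesis by (simp add: Pair p_apply)
    qed (simp add: Pair p_apply)
  qed
  moreover have "finite {u. p f u \<noteq> \<zero>\<^bsub>K\<^esub>}"
  proof (rule finite_subset)
    show "finite ((\<lambda>(\<mu>, v). (\<mu>, id)) ` {u. f u \<noteq> \<zero>\<^bsub>K\<^esub>})" using tw_finite[OF f] by simp
    show "{u. p f u \<noteq> \<zero>\<^bsub>K\<^esub>} \<subseteq> (\<lambda>(\<mu>, v). (\<mu>, id)) ` {u. f u \<noteq> \<zero>\<^bsub>K\<^esub>}"
    proof
      fix u assume u: "u \<in> {u. p f u \<noteq> \<zero>\<^bsub>K\<^esub>}"
      obtain \<mu> w where uw: "u = (\<mu>, w)" by (cases u)
      have w: "w = id" using u by (auto simp: uw p_apply split: if_splits)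
      have "finsum K (\<lambda>v. f (\<mu>, v)) W \<noteq> \<zero>\<^bsub>K\<^esub>" using u by (simp add: uw w p_apply)
      hence "\<exists>v. f (\<mu>, v) \<noteq> \<zero>\<^bsub>K\<^esub>" using z[of \<mu>] by blast
      then obtain v where "f (\<mu>, v) \<noteq> \<zero>\<^bsub>K\<^esub>" ..
      thus "u \<in> (\<lambda>(\<mu>, v). (\<mu>, id)) ` {u. f u \<noteq> \<zero>\<^bsub>K\<^esub>}"
        by (intro image_eqI[of _ _ "(\<mu>, v)"]) (auto simp: uw w)
    qed
  qed
  ultimately show ?thesis unfolding tw_carrier_iff by blast
qed

lemma p_ext:
  assumes "f \<in> carrier TA" "g \<in> carrier TA" "\<And>\<mu> w. \<mu> \<in> CrL \<Longrightarrow> w \<in> W \<Longrightarrow> f (\<mu>, w) = g (\<mu>, w)"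
  shows "f = g"
  by (rule tw_ext) (use assms in \<open>auto simp: GG_simps\<close>)

lemma p_add: "f \<in> carrier TA \<Longrightarrow> g \<in> carrier TA \<Longrightarrow> p (f \<boxplus> g) = p f \<boxplus> p g"
  by (auto simp: fun_eq_iff p_apply tw_add K.finsum_addf)

lemma p_sc:
  assumes c: "c \<in> carrier K" and f: "f \<in> carrier TA" shows "p (sc c \<boxtimes> f) = sc c \<boxtimes> p f"
proof (rule p_ext)
  fix \<mu> w assume mw: "\<mu> \<in> CrL" "w \<in> W"
  have id: "id \<in> W" by (rule weyl_group.id)
  have l: "(sc c \<boxtimes> g) (\<mu>, v) = c \<otimes>\<^bsub>K\<^esub> g (\<mu>, v)" if "v \<in> W" "g \<in> carrier TA" for v g
  proof -
    have "(\<mu>, v) \<in> carrier GG" using that mw by (simp add: GG_simps(1))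
    thus ?thesis using tw_elem_mult_left[OF c G.one_closed that(2)] that by (simp add: act_one)
  qed
  have "finsum K (\<lambda>v. (sc c \<boxtimes> f) (\<mu>, v)) W = finsum K (\<lambda>v. c \<otimes>\<^bsub>K\<^esub> f (\<mu>, v)) W"
    by (rule K.finsum_cong') (use l f c in auto)
  also have "\<dots> = c \<otimes>\<^bsub>K\<^esub> finsum K (\<lambda>v. f (\<mu>, v)) W"
    by (rule K.finsum_rdistr[symmetric]) (use f c finite_weyl in auto)
  finally have sum: "finsum K (\<lambda>v. (sc c \<boxtimes> f) (\<mu>, v)) W = c \<otimes>\<^bsub>K\<^esub> finsum K (\<lambda>v. f (\<mu>, v)) W" .
  show "p (sc c \<boxtimes> f) (\<mu>, w) = (sc c \<boxtimes> p f) (\<mu>, w)"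
  proof (cases "w = id")
    case True
    thus ?thesis using l[OF id p_closed[OF f]] sum by (simp only: p_apply if_True refl)
  next
    case False
    thus ?thesis using l[OF mw(2) p_closed[OF f]] c by (simp add: p_apply)
  qed
next
  show "sc c \<boxtimes> p f \<in> carrier TA" by (intro TA.m_closed tw_elem_closed p_closed c f G.one_closed)
  show "p (sc c \<boxtimes> f) \<in> carrier TA" by (intro TA.m_closed tw_elem_closed p_closed c f G.one_closed)
qed

lemma p_uminus: "f \<in> carrier TA \<Longrightarrow> p (\<ominus>\<^bsub>TA\<^esub> f) = \<ominus>\<^bsub>TA\<^esub> p f"
proof -
  assume f: "f \<in> carrier TA"
  have n: "\<ominus>\<^bsub>TA\<^esub> g = sc (\<ominus>\<^bsub>K\<^esub> \<one>\<^bsub>K\<^esub>) \<boxtimes> g" if g: "g \<in> carrier TA" for g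
  proof -
    have "sc (\<ominus>\<^bsub>K\<^esub> \<one>\<^bsub>K\<^esub>) = \<ominus>\<^bsub>TA\<^esub> \<one>\<^bsub>TA\<^esub>"
      using sc_uminus[OF K.one_closed] by (simp only: sc_one)
    thus ?thesis using g by (simp add: TA.l_minus)
  qed
  show ?thesis using f by (simp add: n p_sc)
qed

lemma p_minus: "f \<in> carrier TA \<Longrightarrow> g \<in> carrier TA \<Longrightarrow> p (f \<boxminus> g) = p f \<boxminus> p g"
  by (simp add: TA.minus_eq p_add p_uminus)

lemma p_fixed_iff:
  assumes f: "f \<in> carrier TA" shows "p f = f \<longleftrightarrow> (\<forall>\<mu>\<in>CrL. \<forall>w\<in>W. w \<noteq> id \<longrightarrow> f (\<mu>, w) = \<zero>\<^bsub>K\<^esub>)"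
proof
  assume "p f = f"
  thus "\<forall>\<mu>\<in>CrL. \<forall>w\<in>W. w \<noteq> id \<longrightarrow> f (\<mu>, w) = \<zero>\<^bsub>K\<^esub>" by (metis p_apply)
next
  assume z: "\<forall>\<mu>\<in>CrL. \<forall>w\<in>W. w \<noteq> id \<longrightarrow> f (\<mu>, w) = \<zero>\<^bsub>K\<^esub>"
  show "p f = f"
  proof (rule p_ext)
    fix \<mu> w assume mw: "\<mu> \<in> CrL" "w \<in> W"
    have "finsum K (\<lambda>v. f (\<mu>, v)) W = finsum K (\<lambda>v. if id = v then f (\<mu>, v) else \<zero>\<^bsub>K\<^esub>) W"
      by (rule K.finsum_cong') (use z mw f in auto)
    also have "\<dots> = f (\<mu>, id)"
      by (rule K.finsum_singleton) (use weyl_group.id[of \<Phi>] finite_weyl f in auto)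
    finally show "p f (\<mu>, w) = f (\<mu>, w)" using z mw by (auto simp: p_apply)
  qed (use f in auto)
qed

lemma p_p: "f \<in> carrier TA \<Longrightarrow> p (p f) = p f"
  by (rule p_fixed_iff[THEN iffD2]) (auto simp: p_apply)

lemma p_tr: assumes "\<nu> \<in> CrL" shows "p (tr \<nu>) = tr \<nu>"
proof (rule p_fixed_iff[THEN iffD2])
  show "tr \<nu> \<in> carrier TA" using tr_GG[OF assms] by simp
qed (auto simp: tw_elem_def)

lemma p_one: "p \<one>\<^bsub>TA\<^esub> = \<one>\<^bsub>TA\<^esub>"
  using p_tr[OF int_lattice_zero] by (simp only: e_id)

text \<open>Left multiplication by \<open>w\<close> permutes the index set \<open>W\<close> of the
  sum in \<open>p\<close>, while \<open>w\<close> also moves the translation part and acts on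
  coefficients. Conjugation of a translation by \<open>w\<close> has precisely this effect, hence
  the trailing inverse.\<close>

lemma p_eta:
  assumes n: "\<nu> \<in> CrL" and w: "w \<in> W" and f: "f \<in> carrier TA"
  shows "p (eta (\<nu>, w) \<boxtimes> f) = eta (\<nu>, w) \<boxtimes> p f \<boxtimes> e (inv_into UNIV w)"
proof (rule p_ext)
  let ?i = "inv_into UNIV w"
  have i: "?i \<in> W" by (rule weyl_inv[OF w])
  have nw: "(\<nu>, w) \<in> carrier GG" using n w by (simp add: GG_simps)
  fix \<mu> v assume mv: "\<mu> \<in> CrL" "v \<in> W"
  define \<rho> where "\<rho> = ?i (\<mu> - \<nu>)"
  have lin: "linear ?i" by (rule weyl_linear[OF i])
  have inv: "inv\<^bsub>GG\<^esub> (\<nu>, w) \<otimes>\<^bsub>GG\<^esub> (\<mu>, y) = (\<rho>, ?i \<circ> y)" for y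
    by (simp add: GG_inv[OF n w] GG_simps \<rho>_def linear_diff[OF lin])
  have l: "(eta (\<nu>, w) \<boxtimes> g) (\<mu>, y) = ac w (g (\<rho>, ?i \<circ> y))" if "y \<in> W" "g \<in> carrier TA" for y g
    using tw_elem_mult_left[OF K.one_closed nw that(2), of "(\<mu>, y)"] that mv w
    by (simp add: inv act_ac GG_simps)
  have "finsum K (\<lambda>y. (eta (\<nu>, w) \<boxtimes> f) (\<mu>, y)) W = finsum K (\<lambda>y. ac w (f (\<rho>, ?i \<circ> y))) W"
    by (rule K.finsum_cong') (use l f w in auto)
  also have "\<dots> = finsum K (\<lambda>y. ac w (f (\<rho>, y))) ((\<lambda>y. ?i \<circ> y) ` W)"
  proof (rule K.finsum_reindex[symmetric])
    show "inj_on (\<lambda>y. ?i \<circ> y) W"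
    proof (rule inj_onI)
      fix a b assume "?i \<circ> a = ?i \<circ> b"
      hence "w \<circ> (?i \<circ> a) = w \<circ> (?i \<circ> b)" by simp
      thus "a = b" by (simp add: fun_eq_iff weyl_inv_simps[OF w])
    qed
  qed (use f w in auto)
  also have "(\<lambda>y. ?i \<circ> y) ` W = W"
  proof (intro equalityI subsetI)
    fix y assume y: "y \<in> W"
    have "y = ?i \<circ> (w \<circ> y)" by (simp add: fun_eq_iff weyl_inv_simps[OF w])
    thus "y \<in> (\<lambda>y. ?i \<circ> y) ` W" using weyl_comp[OF w y] by (rule image_eqI)
  qed (auto intro: weyl_comp i)
  also have "finsum K (\<lambda>y. ac w (f (\<rho>, y))) W = ac w (finsum K (\<lambda>y. f (\<rho>, y)) W)"
  proof -
    interpret r: ring_hom_cring K K "ac w"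
      using act_ring_hom_cring[OF W_GG[OF w]] by (simp add: act_ac)
    have "ac w (finsum K (\<lambda>y. f (\<rho>, y)) W) = finsum K (ac w \<circ> (\<lambda>y. f (\<rho>, y))) W"
      by (rule r.hom_finsum) (use f in auto)
    thus ?thesis by (simp add: comp_def)
  qed
  finally have A: "finsum K (\<lambda>y. (eta (\<nu>, w) \<boxtimes> f) (\<mu>, y)) W = ac w (finsum K (\<lambda>y. f (\<rho>, y)) W)" .
  have "(\<mu>, v) \<otimes>\<^bsub>GG\<^esub> inv\<^bsub>GG\<^esub> (0, ?i) = (\<mu>, v \<circ> w)"
    using w weyl_bij[OF w]
    by (simp add: GG_inv[OF int_lattice_zero i] GG_simps linear_0[OF weyl_linear[OF mv(2)]]
        linear_0[OF weyl_linear[OF w]] inv_inv_eq)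
  hence "(eta (\<nu>, w) \<boxtimes> p f \<boxtimes> e ?i) (\<mu>, v) = (eta (\<nu>, w) \<boxtimes> p f) (\<mu>, v \<circ> w)"
    using tw_elem_mult_right[OF K.one_closed W_GG[OF i], of "eta (\<nu>, w) \<boxtimes> p f" "(\<mu>, v)"] nw f mv w
    by (simp add: GG_simps weyl_comp)
  also have "\<dots> = ac w (p f (\<rho>, ?i \<circ> (v \<circ> w)))" by (rule l) (use mv w f in \<open>auto intro: weyl_comp\<close>)
  also have "\<dots> = (if v = id then ac w (finsum K (\<lambda>y. f (\<rho>, y)) W) else \<zero>\<^bsub>K\<^esub>)"
  proof -
    have "?i \<circ> (v \<circ> w) = id \<longleftrightarrow> v = id"
    proof
      assume a: "?i \<circ> (v \<circ> w) = id"
      have "v y = y" for y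
      proof -
        have "w ((?i \<circ> (v \<circ> w)) (?i y)) = w (?i y)" by (simp only: a id_apply)
        thus ?thesis by (simp add: weyl_inv_simps[OF w])
      qed
      thus "v = id" by auto
    qed (auto simp: fun_eq_iff weyl_inv_simps[OF w])
    moreover have "ac w \<zero>\<^bsub>K\<^esub> = \<zero>\<^bsub>K\<^esub>" using act_simps(1)[OF W_GG[OF w]] by (simp add: act_ac)
    ultimately show ?thesis by (simp add: p_apply)
  qed
  finally have B: "(eta (\<nu>, w) \<boxtimes> p f \<boxtimes> e ?i) (\<mu>, v) =
      (if v = id then ac w (finsum K (\<lambda>y. f (\<rho>, y)) W) else \<zero>\<^bsub>K\<^esub>)" .
  show "p (eta (\<nu>, w) \<boxtimes> f) (\<mu>, v) = (eta (\<nu>, w) \<boxtimes> p f \<boxtimes> e ?i) (\<mu>, v)"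
    unfolding p_apply B A ..
qed (use n w f weyl_inv[OF w] in \<open>auto simp: GG_simps\<close>)

lemma p_e:
  assumes "w \<in> W" "f \<in> carrier TA" shows "p (e w \<boxtimes> f) = e w \<boxtimes> p f \<boxtimes> e (inv_into UNIV w)"
  by (rule p_eta[OF int_lattice_zero assms])

text \<open>Translations act trivially on the coefficient ring, and elements fixed by
  \<open>p\<close> are supported on translations.\<close>

lemma fixed_sc_commute:
  assumes m: "m \<in> carrier TA" "p m = m" and c: "c \<in> carrier K"
  shows "sc c \<boxtimes> m = m \<boxtimes> sc c"
proof (rule p_ext)
  fix \<mu> w assume mw: "\<mu> \<in> CrL" "w \<in> W"
  hence u: "(\<mu>, w) \<in> carrier GG" by (simp add: GG_simps)
  have "(sc c \<boxtimes> m) (\<mu>, w) = c \<otimes>\<^bsub>K\<^esub> m (\<mu>, w)"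
    using tw_elem_mult_left[OF c G.one_closed m(1) u] m u by (simp add: act_one)
  moreover have "(m \<boxtimes> sc c) (\<mu>, w) = m (\<mu>, w) \<otimes>\<^bsub>K\<^esub> ac w c"
    using tw_elem_mult_right[OF c G.one_closed m(1) u] u by (simp add: act_ac)
  moreover have "c \<otimes>\<^bsub>K\<^esub> m (\<mu>, w) = m (\<mu>, w) \<otimes>\<^bsub>K\<^esub> ac w c"
  proof (cases "w = id")
    case True
    have "ac id c = c" using act_one[OF c] by (simp add: GG_simps act_ac)
    thus ?thesis using True m c by (simp add: K.m_comm)
  next
    case False
    thus ?thesis using m mw c by (simp add: p_fixed_iff)
  qed
  ultimately show "(sc c \<boxtimes> m) (\<mu>, w) = (m \<boxtimes> sc c) (\<mu>, w)" by simp
qed (use m c in auto)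

lemma tr_mult_coeff:
  assumes n: "\<nu> \<in> CrL" and m: "m \<in> carrier TA" and mw: "\<mu> \<in> CrL" "w \<in> W"
  shows "(tr \<nu> \<boxtimes> m) (\<mu>, w) = m (\<mu> - \<nu>, w)" "(m \<boxtimes> tr \<nu>) (\<mu>, w) = m (\<mu> - w \<nu>, w)"
proof -
  have u: "(\<mu>, w) \<in> carrier GG" using mw by (simp add: GG_simps)
  have id: "id \<in> W" by (rule weyl_group.id)
  have "inv\<^bsub>GG\<^esub> (\<nu>, id) = (- \<nu>, id)" using GG_inv[OF n id] by (simp add: inv_id)
  moreover have "ac id c = c" if "c \<in> carrier K" for c
    using act_one[OF that] by (simp add: GG_simps act_ac)
  ultimately show "(tr \<nu> \<boxtimes> m) (\<mu>, w) = m (\<mu> - \<nu>, w)"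
    using tw_elem_mult_left[OF K.one_closed tr_GG[OF n] m u] m by (simp add: GG_simps act_ac)
  have "(\<mu> - w \<nu>, w) \<in> carrier GG"
    using mw n int_lattice_add[OF mw(1) int_lattice_uminus[OF CrL_weyl[OF mw(2) n]]] by (simp add: GG_simps)
  thus "(m \<boxtimes> tr \<nu>) (\<mu>, w) = m (\<mu> - w \<nu>, w)"
    using tw_elem_mult_right[OF K.one_closed tr_GG[OF n] m u] m \<open>inv\<^bsub>GG\<^esub> (\<nu>, id) = (- \<nu>, id)\<close>
    by (simp add: GG_simps linear_neg[OF weyl_linear[OF mw(2)]])
qed

lemma fixed_tr_commute:
  assumes m: "m \<in> carrier TA" "p m = m" and n: "\<nu> \<in> CrL"
  shows "tr \<nu> \<boxtimes> m = m \<boxtimes> tr \<nu>"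
proof (rule p_ext)
  fix \<mu> w assume mw: "\<mu> \<in> CrL" "w \<in> W"
  show "(tr \<nu> \<boxtimes> m) (\<mu>, w) = (m \<boxtimes> tr \<nu>) (\<mu>, w)"
  proof (cases "w = id")
    case False
    have "\<mu> - \<nu> \<in> CrL" "\<mu> - w \<nu> \<in> CrL"
      using int_lattice_add[OF mw(1) int_lattice_uminus[OF n]]
        int_lattice_add[OF mw(1) int_lattice_uminus[OF CrL_weyl[OF mw(2) n]]] by simp_all
    thus ?thesis using False m mw by (simp add: tr_mult_coeff[OF n m(1) mw] p_fixed_iff)
  next
    case True
    thus ?thesis unfolding tr_mult_coeff[OF n m(1) mw] by simp
  qed
qed (use m tr_GG[OF n] in auto)

subsection \<open>The Peterson subalgebra is contained in the Demazure algebra\<close>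

text \<open>A twisted Leibniz rule: for \<open>u = (\<nu>, reflection \<beta>)\<close> one has
  \<open>p (dem g) = dem p(g) + eta_u p(g) X\<close>, where \<open>X\<close> is the Demazure element
  of \<open>- \<beta>\<close>. Both terms stay in \<open>H\<close> as soon as \<open>p g\<close>
  does; \<open>g\<close> itself may lie outside.\<close>

lemma p_dem_mult:
  assumes b: "\<beta> \<in> \<Phi>" and n: "\<nu> \<in> CrL" and eta: "eta (\<nu>, reflection \<beta>) \<in> H"
    and dem: "dem (xi \<beta>) (\<nu>, reflection \<beta>) \<in> H" and g: "g \<in> carrier TA" "p g \<in> H"
  shows "p (dem (xi \<beta>) (\<nu>, reflection \<beta>) \<boxtimes> g) \<in> H"
proof -
  let ?s = "reflection \<beta>" and ?u = "(\<nu>, reflection \<beta>)"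
  have s: "?s \<in> W" by (rule weyl_reflection[OF b])
  have u: "?u \<in> carrier GG" using n s by (simp add: GG_simps)
  have mb: "- \<beta> \<in> \<Phi>" by (rule uminus_root[OF b])
  have sb: "?s (- \<beta>) = \<beta>"
    using reflection_self[OF root_nonzero[OF b]] linear_neg[OF reflection_linear, of \<beta> \<beta>] by simp
  have inv_s: "inv_into UNIV ?s = ?s"
    by (rule inv_equality) (auto simp: reflection_invol)
  note cl = xi_closed[OF b] xi_closed[OF mb] p_closed[OF g(1)]
  have eu: "sc (xi \<beta>) \<boxtimes> eta ?u = eta ?u \<boxtimes> sc (xi (- \<beta>))"
    using eta_sc[OF u cl(2)] ac_xi[OF s mb] sb by (simp add: act_ac)
  have "p (dem (xi \<beta>) ?u \<boxtimes> g) = sc (xi \<beta>) \<boxtimes> (p g \<boxminus> eta ?u \<boxtimes> p g \<boxtimes> e ?s)"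
    using cl u g s by (simp add: TA.m_assoc p_sc TA_minus_distr p_minus p_eta[OF n s] inv_s)
  \<comment> \<open>Adding and subtracting \<open>eta_u p(g)\<close> separates a difference on the
    left of \<open>p g\<close> from one on its right.\<close>
  also have "p g \<boxminus> eta ?u \<boxtimes> p g \<boxtimes> e ?s =
      (\<one>\<^bsub>TA\<^esub> \<boxminus> eta ?u) \<boxtimes> p g \<boxplus> eta ?u \<boxtimes> p g \<boxtimes> (\<one>\<^bsub>TA\<^esub> \<boxminus> e ?s)"
  proof -
    have a: "eta ?u \<boxtimes> p g \<in> carrier TA" "eta ?u \<boxtimes> p g \<boxtimes> e ?s \<in> carrier TA" using u g s by auto
    have "(p g \<boxminus> eta ?u \<boxtimes> p g) \<boxplus> (eta ?u \<boxtimes> p g \<boxminus> eta ?u \<boxtimes> p g \<boxtimes> e ?s) = p g \<boxminus> eta ?u \<boxtimes> p g \<boxtimes> e ?s"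
      using a cl(3) by (simp add: TA.minus_eq TA.a_assoc TA.r_neg1)
    thus ?thesis using u g s by (simp add: TA_minus_distr)
  qed
  also have "sc (xi \<beta>) \<boxtimes> \<dots> =
      dem (xi \<beta>) ?u \<boxtimes> p g \<boxplus> sc (xi \<beta>) \<boxtimes> eta ?u \<boxtimes> p g \<boxtimes> (\<one>\<^bsub>TA\<^esub> \<boxminus> e ?s)"
    using cl u g s by (simp add: TA.r_distr TA.m_assoc)
  \<comment> \<open>The denominator passes \<open>eta_u\<close>, which changes \<beta> into
    \<open>- \<beta>\<close>, then commutes with \<open>p g\<close>, and so joins the right hand
    difference to form a Demazure element.\<close>
  also have "sc (xi \<beta>) \<boxtimes> eta ?u \<boxtimes> p g \<boxtimes> (\<one>\<^bsub>TA\<^esub> \<boxminus> e ?s) = eta ?u \<boxtimes> p g \<boxtimes> Xs (- \<beta>)"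
  proof -
    have "sc (xi \<beta>) \<boxtimes> eta ?u \<boxtimes> p g = eta ?u \<boxtimes> p g \<boxtimes> sc (xi (- \<beta>))"
      unfolding eu using cl u fixed_sc_commute[OF cl(3) p_p[OF g(1)] cl(2)] by (simp add: TA.m_assoc)
    thus ?thesis using cl u s by (simp add: TA.m_assoc reflection_uminus)
  qed
  also have "dem (xi \<beta>) ?u \<boxtimes> p g \<boxplus> eta ?u \<boxtimes> p g \<boxtimes> Xs (- \<beta>) \<in> H"
    by (intro H_ops dem eta g(2) DW_H[OF Xs_DW[OF mb]])
  finally show ?thesis .
qed

text \<open>An arbitrary right factor \<open>g\<close> lets the case of a product be handled by
  nesting; \<open>g = 1\<close> then shows that \<open>p\<close> maps \<open>H\<close> into
  itself.\<close>

lemma p_mult_H: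
  assumes "f \<in> H" shows "g \<in> carrier TA \<Longrightarrow> p g \<in> H \<Longrightarrow> p (f \<boxtimes> g) \<in> H"
  using assms
proof (induction arbitrary: g rule: H_induct)
  case one
  thus ?case by simp
next
  case (sc c)
  thus ?case by (simp add: p_sc Sc_carrier H_ops sc_H)
next
  case X0
  have m: "- \<theta> \<in> \<Phi>" by (rule uminus_root[OF \<theta>])
  have "p (dem (xi (- \<theta>)) (coroot \<theta>, reflection (- \<theta>)) \<boxtimes> g) \<in> H"
  proof (rule p_dem_mult[OF m CrL_coroot[OF \<theta>] _ _ X0])
    show "dem (xi (- \<theta>)) (coroot \<theta>, reflection (- \<theta>)) \<in> H"
      using X0_H by (simp only: reflection_uminus)
    show "eta (coroot \<theta>, reflection (- \<theta>)) \<in> H"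
      unfolding reflection_uminus by (rule eta_theta_H)
  qed
  thus ?case by (simp only: reflection_uminus)
next
  case (Xs \<alpha>)
  have a: "\<alpha> \<in> \<Phi>" by (rule simple_root[OF Xs(1)])
  show ?case
    by (rule p_dem_mult[OF a int_lattice_zero e_H[OF weyl_reflection[OF a]] DW_H[OF Xs_DW[OF a]] Xs(2,3)])
next
  case (uminus h)
  have "p (\<ominus>\<^bsub>TA\<^esub> h \<boxtimes> g) = \<ominus>\<^bsub>TA\<^esub> p (h \<boxtimes> g)"
    using H_closed[OF uminus.hyps] uminus.prems by (simp add: TA.l_minus p_uminus)
  thus ?case using uminus.IH[OF uminus.prems] by (simp add: H_ops)
next
  case (add h1 h2)
  have "p ((h1 \<boxplus> h2) \<boxtimes> g) = p (h1 \<boxtimes> g) \<boxplus> p (h2 \<boxtimes> g)"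
    using H_closed[OF add.hyps(1)] H_closed[OF add.hyps(2)] add.prems by (simp add: TA.l_distr p_add)
  thus ?case using add.IH[OF add.prems] by (simp add: H_ops)
next
  case (mult h1 h2)
  note h = H_closed[OF mult.hyps(1)] H_closed[OF mult.hyps(2)]
  have "p (h1 \<boxtimes> (h2 \<boxtimes> g)) \<in> H"
    by (rule mult.IH(1)[OF TA.m_closed[OF h(2) mult.prems(1)] mult.IH(2)[OF mult.prems]])
  thus ?case using h mult.prems by (simp add: TA.m_assoc)
qed

lemma p_H: "f \<in> H \<Longrightarrow> p f \<in> H"
  using p_mult_H[of f "\<one>\<^bsub>TA\<^esub>"] H_closed[of f] by (simp add: p_one H_ops)

subsection \<open>The centre\<close>

definition Z where "Z = centre TA H"

text \<open>An element supported on translations commutes with all coefficients from the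
  localization, denominators included, and with all translations. Commuting with the finite Weyl
  group then covers every generator, because \<open>s_0\<close> is a translation times the
  reflection in \<theta>.\<close>

lemma ZI:
  assumes z: "z \<in> H" "p z = z" and e: "\<And>w. w \<in> W \<Longrightarrow> e w \<boxtimes> z = z \<boxtimes> e w"
  shows "z \<in> Z"
proof -
  have zc: "z \<in> carrier TA" by (rule H_closed[OF z(1)])
  have sc_comm: "z \<boxtimes> sc c = sc c \<boxtimes> z" if "c \<in> carrier K" for c
    using fixed_sc_commute[OF zc z(2) that] by simp
  have dem_comm: "z \<boxtimes> dem c u = dem c u \<boxtimes> z"
    if c: "c \<in> carrier K" and u: "u \<in> carrier GG" and eu: "eta u \<boxtimes> z = z \<boxtimes> eta u" for c u
  proof -
    have "z \<boxtimes> dem c u = sc c \<boxtimes> (z \<boxtimes> (\<one>\<^bsub>TA\<^esub> \<boxminus> eta u))"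
      using c u zc sc_comm[OF c] by (simp add: TA.m_assoc[symmetric])
    also have "z \<boxtimes> (\<one>\<^bsub>TA\<^esub> \<boxminus> eta u) = (\<one>\<^bsub>TA\<^esub> \<boxminus> eta u) \<boxtimes> z"
      using u zc eu by (simp add: TA_minus_distr)
    finally show ?thesis using c u zc by (simp add: TA.m_assoc)
  qed
  have "z \<boxtimes> d = d \<boxtimes> z" if "d \<in> H" for d
    using that
  proof (induction rule: H_induct)
    case one
    show ?case using zc by simp
  next
    case (sc c)
    thus ?case by (simp add: sc_comm Sc_carrier)
  next
    case X0
    let ?c = "coroot \<theta>" and ?s = "reflection \<theta>"
    have c: "?c \<in> CrL" and s: "?s \<in> W" using \<theta> by (auto intro: CrL_coroot weyl_reflection)
    have split: "eta (?c, ?s) = tr ?c \<boxtimes> e ?s"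
      using eta_mult[OF tr_GG[OF c] W_GG[OF s]] by (simp add: GG_simps)
    have "eta (?c, ?s) \<boxtimes> z = z \<boxtimes> eta (?c, ?s)"
    proof -
      have "tr ?c \<boxtimes> e ?s \<boxtimes> z = tr ?c \<boxtimes> z \<boxtimes> e ?s"
        using tr_GG[OF c] s zc e[OF s] by (simp add: TA.m_assoc)
      also have "\<dots> = z \<boxtimes> tr ?c \<boxtimes> e ?s" by (simp only: fixed_tr_commute[OF zc z(2) c])
      finally show ?thesis unfolding split using tr_GG[OF c] s zc by (simp add: TA.m_assoc)
    qed
    thus ?case by (intro dem_comm xi_closed uminus_root \<theta> coroot_refl_GG)
  next
    case (Xs \<alpha>)
    have a: "\<alpha> \<in> \<Phi>" by (rule simple_root[OF Xs])
    show ?case by (intro dem_comm xi_closed a e W_GG weyl_reflection)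
  next
    case (uminus h)
    thus ?case using zc by (simp add: H_closed TA.r_minus TA.l_minus)
  next
    case (add h1 h2)
    thus ?case using zc by (simp add: H_closed TA.r_distr TA.l_distr)
  next
    case (mult h1 h2)
    hence h: "h1 \<in> carrier TA" "h2 \<in> carrier TA" by (simp_all add: H_closed)
    have "z \<boxtimes> (h1 \<boxtimes> h2) = h1 \<boxtimes> (z \<boxtimes> h2)"
      using h zc mult.IH(1) by (simp add: TA.m_assoc[symmetric])
    thus ?case using h zc mult.IH(2) by (simp add: TA.m_assoc)
  qed
  thus ?thesis using z(1) by (simp add: Z_def centre_def)
qed

text \<open>
  A central element commutes with translations, so its coefficients off the translation lattice are
  constant along infinite conjugation orbits.
\<close>

lemma Z_fixed: assumes z: "z \<in> Z" shows "p z = z"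
proof -
  have zH: "z \<in> H" and comm: "\<And>d. d \<in> H \<Longrightarrow> z \<boxtimes> d = d \<boxtimes> z" using z by (auto simp: Z_def centre_def)
  have zc: "z \<in> carrier TA" by (rule H_closed[OF zH])
  have "z (\<mu>, w) = \<zero>\<^bsub>K\<^esub>" if mw: "\<mu> \<in> CrL" "w \<in> W" "w \<noteq> id" for \<mu> w
  proof (rule ccontr)
    assume nz: "z (\<mu>, w) \<noteq> \<zero>\<^bsub>K\<^esub>"
    \<comment> \<open>Commuting with the translation by \<open>v (coroot \<theta>)\<close> makes the
      coefficients constant along steps of \<delta>. Finite support forces \<delta> to vanish, so
      \<open>w\<close> fixes the whole orbit of \<theta>, which spans, against
      \<open>w \<noteq> id\<close>.\<close>
    have fixv: "w (v \<theta>) = v \<theta>" if v: "v \<in> W" for v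
    proof -
      let ?n = "v (coroot \<theta>)"
      have n: "?n \<in> CrL" by (rule CrL_weyl[OF v CrL_coroot[OF \<theta>]])
      define \<delta> where "\<delta> = ?n - w ?n"
      have wn: "w ?n \<in> CrL" by (rule CrL_weyl[OF mw(2) n])
      have \<delta>: "\<delta> \<in> CrL" unfolding \<delta>_def using int_lattice_add[OF n int_lattice_uminus[OF wn]] by simp
      have step: "z (\<rho>, w) = z (\<rho> + \<delta>, w)" if \<rho>: "\<rho> \<in> CrL" for \<rho>
      proof -
        have r: "\<rho> + ?n \<in> CrL" by (rule int_lattice_add[OF \<rho> n])
        have "z \<boxtimes> tr ?n = tr ?n \<boxtimes> z" by (rule comm[OF tr_orbit_H[OF v]])
        hence "(z \<boxtimes> tr ?n) (\<rho> + ?n, w) = (tr ?n \<boxtimes> z) (\<rho> + ?n, w)" by simp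
        thus ?thesis unfolding tr_mult_coeff[OF n zc r mw(2)] by (simp add: \<delta>_def algebra_simps)
      qed
      have iter: "z (\<mu> + of_nat k *\<^sub>R \<delta>, w) = z (\<mu>, w) \<and> \<mu> + of_nat k *\<^sub>R \<delta> \<in> CrL" for k
      proof (induction k)
        case (Suc k)
        have s: "\<mu> + of_nat (Suc k) *\<^sub>R \<delta> = (\<mu> + of_nat k *\<^sub>R \<delta>) + \<delta>" by (simp add: algebra_simps)
        have m: "\<mu> + of_nat k *\<^sub>R \<delta> \<in> CrL" using Suc by simp
        show ?case unfolding s using Suc step[OF m] int_lattice_add[OF m \<delta>] by simp
      qed (use mw in simp)
      have "\<delta> = 0"
      proof (rule ccontr)
        assume d: "\<delta> \<noteq> 0"
        have "inj (\<lambda>k::nat. (\<mu> + of_nat k *\<^sub>R \<delta>, w))" using d by (auto simp: inj_def)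
        moreover have "range (\<lambda>k::nat. (\<mu> + of_nat k *\<^sub>R \<delta>, w)) \<subseteq> {u. z u \<noteq> \<zero>\<^bsub>K\<^esub>}"
          using iter nz by auto
        ultimately show False using tw_finite[OF zc] by (meson finite_subset range_inj_infinite)
      qed
      hence "w ?n = ?n" by (simp add: \<delta>_def)
      hence "coroot (w (v \<theta>)) = coroot (v \<theta>)"
        by (simp add: coroot_weyl[OF v] coroot_weyl[OF mw(2)])
      \<comment> \<open>Equal lengths turn the equality of coroots into one of roots.\<close>
      moreover have "w (v \<theta>) \<bullet> w (v \<theta>) = v \<theta> \<bullet> v \<theta>" by (rule weyl_inner[OF mw(2)])
      moreover have "v \<theta> \<noteq> 0" by (rule root_nonzero[OF weyl_root[OF v \<theta>]])
      ultimately show ?thesis by (simp add: coroot_def)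
    qed
    have "w y = id y" for y
    proof (rule linear_eq_on_span[OF weyl_linear[OF mw(2)] linear_id])
      show "y \<in> span ((\<lambda>v. v \<theta>) ` W)" using irreducible_orbit_spans[OF irr \<theta>] by simp
    qed (use fixv in auto)
    thus False using mw(3) by auto
  qed
  thus ?thesis using zc by (simp add: p_fixed_iff)
qed

subsection \<open>Nilpotence of the additive divided differences\<close>

abbreviation dd where "dd \<alpha> \<equiv> dem (Yi \<alpha>) (0, reflection \<alpha>)"

lemma dd_closed [simp]: "\<alpha> \<in> \<Phi> \<Longrightarrow> dd \<alpha> \<in> carrier TA"
  by (simp add: Yi_closed weyl_reflection)

text \<open>The inverse of \<open>y_alpha\<close> is a multiple of that of \<open>x_alpha\<close> by
  an element of the image of \<open>S\<close>, so the additive divided difference is such a multiple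
  of the Demazure element.\<close>

lemma dd_DW: assumes a: "\<alpha> \<in> \<Phi>" shows "dd \<alpha> \<in> DW"
proof -
  obtain u where u: "u \<in> Sc" "Yi \<alpha> = u \<otimes>\<^bsub>K\<^esub> xi \<alpha>" using Yi_xi[OF a] by blast
  have "dd \<alpha> = sc u \<boxtimes> Xs \<alpha>"
    unfolding u(2) using u a
    by (simp add: sc_mult[symmetric] Sc_carrier xi_closed TA.m_assoc weyl_reflection)
  thus ?thesis using u Xs_DW[OF a] by (simp add: DW_ops sc_DW)
qed

lemma e_dd: "w \<in> W \<Longrightarrow> \<alpha> \<in> \<Phi> \<Longrightarrow> e w \<boxtimes> dd \<alpha> = dd (w \<alpha>) \<boxtimes> e w"
  by (simp add: e_dem Yi_closed ac_Yi)

lemma one_minus_e: "\<alpha> \<in> \<Phi> \<Longrightarrow> \<one>\<^bsub>TA\<^esub> \<boxminus> e (reflection \<alpha>) = sc (Y \<alpha>) \<boxtimes> dd \<alpha>"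
  by (simp add: TA.m_assoc[symmetric] sc_mult Y_closed RtL_root Yi_closed Y_Yi sc_one weyl_reflection)

text \<open>In the application \<open>n\<close> is the integer pairing of \<open>l\<close> with the
  coroot of \<alpha>. Here it is only known as a Weyl invariant element, which suffices for it to
  commute with divided differences.\<close>

lemma dd_Y:
  assumes a: "\<alpha> \<in> \<Phi>" and l: "l \<in> RtL"
  obtains n where "n \<in> carrier K" "\<And>w. w \<in> W \<Longrightarrow> ac w n = n"
    "dd \<alpha> \<boxtimes> sc (Y l) = sc n \<boxplus> sc (Y (reflection \<alpha> l)) \<boxtimes> dd \<alpha>"
proof -
  let ?s = "reflection \<alpha>"
  obtain n where n: "n \<in> carrier K" "\<And>w. w \<in> W \<Longrightarrow> ac w n = n" "Y l \<ominus>\<^bsub>K\<^esub> Y (?s l) = n \<otimes>\<^bsub>K\<^esub> Y \<alpha>"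
    using Y_reflection[OF a l] by blast
  have s: "?s \<in> W" by (rule weyl_reflection[OF a])
  have c: "Y l \<in> carrier K" "Y (?s l) \<in> carrier K" "Y \<alpha> \<in> carrier K" "Yi \<alpha> \<in> carrier K"
    using a l RtL_weyl[OF s l] by (auto intro: Y_closed Yi_closed RtL_root)
  have "(\<one>\<^bsub>TA\<^esub> \<boxminus> e ?s) \<boxtimes> sc (Y l) = sc (Y l) \<boxminus> sc (Y (?s l)) \<boxtimes> e ?s"
    using c s by (simp add: TA_minus_distr e_sc ac_Y[OF s l])
  also have "\<dots> = (sc (Y l) \<boxminus> sc (Y (?s l))) \<boxplus> sc (Y (?s l)) \<boxtimes> (\<one>\<^bsub>TA\<^esub> \<boxminus> e ?s)"
    using c s by (simp add: TA_minus_distr) (simp add: TA.minus_eq TA.a_assoc TA.r_neg1)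
  also have "sc (Y l) \<boxminus> sc (Y (?s l)) = sc (n \<otimes>\<^bsub>K\<^esub> Y \<alpha>)"
  proof -
    have "sc (Y l) \<boxminus> sc (Y (?s l)) = sc (Y l \<ominus>\<^bsub>K\<^esub> Y (?s l))"
      using c by (simp only: sc_minus)
    thus ?thesis by (simp only: n(3))
  qed
  finally have "dd \<alpha> \<boxtimes> sc (Y l) = sc (Yi \<alpha>) \<boxtimes> (sc (n \<otimes>\<^bsub>K\<^esub> Y \<alpha>) \<boxplus> sc (Y (?s l)) \<boxtimes> (\<one>\<^bsub>TA\<^esub> \<boxminus> e ?s))"
    using c s by (simp add: TA.m_assoc)
  also have "\<dots> = sc (Yi \<alpha>) \<boxtimes> sc (n \<otimes>\<^bsub>K\<^esub> Y \<alpha>) \<boxplus> sc (Yi \<alpha>) \<boxtimes> sc (Y (?s l)) \<boxtimes> (\<one>\<^bsub>TA\<^esub> \<boxminus> e ?s)"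
    using c s n(1) by (simp add: TA.r_distr TA.m_assoc)
  also have "sc (Yi \<alpha>) \<boxtimes> sc (n \<otimes>\<^bsub>K\<^esub> Y \<alpha>) = sc n"
  proof -
    have "Yi \<alpha> \<otimes>\<^bsub>K\<^esub> (n \<otimes>\<^bsub>K\<^esub> Y \<alpha>) = n \<otimes>\<^bsub>K\<^esub> (Y \<alpha> \<otimes>\<^bsub>K\<^esub> Yi \<alpha>)" using c n(1) by (simp add: K.m_ac)
    thus ?thesis using c n(1) by (simp add: sc_mult Y_Yi[OF a])
  qed
  also have "sc (Yi \<alpha>) \<boxtimes> sc (Y (?s l)) = sc (Y (?s l)) \<boxtimes> sc (Yi \<alpha>)"
    using c by (simp add: sc_mult K.m_comm)
  also have "sc (Y (?s l)) \<boxtimes> sc (Yi \<alpha>) \<boxtimes> (\<one>\<^bsub>TA\<^esub> \<boxminus> e ?s) = sc (Y (?s l)) \<boxtimes> dd \<alpha>"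
    using c s by (simp add: TA.m_assoc)
  finally show ?thesis using n that by blast
qed

lemma dd_const:
  assumes a: "\<alpha> \<in> \<Phi>" and n: "n \<in> carrier K" "\<And>w. w \<in> W \<Longrightarrow> ac w n = n"
  shows "dd \<alpha> \<boxtimes> sc n = sc n \<boxtimes> dd \<alpha>"
proof -
  let ?s = "reflection \<alpha>"
  have s: "?s \<in> W" by (rule weyl_reflection[OF a])
  have c: "Yi \<alpha> \<in> carrier K" by (rule Yi_closed[OF a])
  have "(\<one>\<^bsub>TA\<^esub> \<boxminus> e ?s) \<boxtimes> sc n = sc n \<boxtimes> (\<one>\<^bsub>TA\<^esub> \<boxminus> e ?s)"
    using n s by (simp add: TA_minus_distr e_sc)
  hence "dd \<alpha> \<boxtimes> sc n = sc (Yi \<alpha>) \<boxtimes> sc n \<boxtimes> (\<one>\<^bsub>TA\<^esub> \<boxminus> e ?s)" using n s c by (simp add: TA.m_assoc)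
  also have "sc (Yi \<alpha>) \<boxtimes> sc n = sc n \<boxtimes> sc (Yi \<alpha>)" using n c by (simp add: sc_mult K.m_comm)
  finally show ?thesis using n s c by (simp add: TA.m_assoc)
qed

text \<open>The elements killed from the left by every product of \<open>n\<close> divided
  differences, the roots being arbitrary. Each \<open>N n\<close> is stable under right
  multiplication, so nilpotence of all these products amounts to \<open>1\<close> lying in some
  \<open>N n\<close>.\<close>

primrec N where
  "N 0 = {\<zero>\<^bsub>TA\<^esub>}"
| "N (Suc n) = {g \<in> carrier TA. \<forall>\<alpha>\<in>\<Phi>. dd \<alpha> \<boxtimes> g \<in> N n}"

lemma N_closed: "g \<in> N n \<Longrightarrow> g \<in> carrier TA"
  by (cases n) auto

lemma N_add: "f \<in> N n \<Longrightarrow> g \<in> N n \<Longrightarrow> f \<boxplus> g \<in> N n"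
  by (induction n arbitrary: f g) (auto simp: TA.r_distr)

lemma N_mult: "g \<in> N n \<Longrightarrow> f \<in> carrier TA \<Longrightarrow> g \<boxtimes> f \<in> N n"
  by (induction n arbitrary: g) (auto simp: TA.m_assoc[symmetric])

lemma N_minus: "f \<in> N n \<Longrightarrow> g \<in> N n \<Longrightarrow> f \<boxminus> g \<in> N n"
proof -
  assume f: "f \<in> N n" and g: "g \<in> N n"
  have "g \<boxtimes> (\<ominus>\<^bsub>TA\<^esub> \<one>\<^bsub>TA\<^esub>) \<in> N n" by (rule N_mult[OF g]) simp
  moreover have "g \<boxtimes> (\<ominus>\<^bsub>TA\<^esub> \<one>\<^bsub>TA\<^esub>) = \<ominus>\<^bsub>TA\<^esub> g" using N_closed[OF g] by (simp add: TA.r_minus)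
  ultimately show ?thesis using N_add[OF f] by (simp add: TA.minus_eq)
qed

lemma N_Suc: "g \<in> N n \<Longrightarrow> g \<in> N (Suc n)"
  by (induction n arbitrary: g) auto

text \<open>Conjugation by \<open>e w\<close> permutes the divided differences among the roots, so
  the order of nilpotence is unchanged.\<close>

lemma N_e: "w \<in> W \<Longrightarrow> g \<in> N n \<Longrightarrow> e w \<boxtimes> g \<in> N n"
proof (induction n arbitrary: g)
  case (Suc n)
  have g: "g \<in> carrier TA" "\<And>\<alpha>. \<alpha> \<in> \<Phi> \<Longrightarrow> dd \<alpha> \<boxtimes> g \<in> N n" using Suc.prems by auto
  have "dd \<alpha> \<boxtimes> (e w \<boxtimes> g) \<in> N n" if a: "\<alpha> \<in> \<Phi>" for \<alpha>
  proof -
    let ?b = "inv_into UNIV w \<alpha>"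
    have b: "?b \<in> \<Phi>" by (rule weyl_root[OF weyl_inv[OF Suc.prems(1)] a])
    have "e w \<boxtimes> dd ?b = dd \<alpha> \<boxtimes> e w"
      using e_dd[OF Suc.prems(1) b] by (simp only: weyl_inv_simps[OF Suc.prems(1)])
    hence "dd \<alpha> \<boxtimes> (e w \<boxtimes> g) = e w \<boxtimes> (dd ?b \<boxtimes> g)"
      using a b g(1) Suc.prems(1) by (simp add: TA.m_assoc[symmetric] del: TA.m_closed)
    thus ?thesis using Suc.IH[OF Suc.prems(1) g(2)[OF b]] by simp
  qed
  thus ?case using Suc.prems g by auto
qed simp

lemma N_const:
  assumes n: "c \<in> carrier K" "\<And>w. w \<in> W \<Longrightarrow> ac w c = c"
  shows "g \<in> N k \<Longrightarrow> sc c \<boxtimes> g \<in> N k"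
proof (induction k arbitrary: g)
  case (Suc k)
  have g: "g \<in> carrier TA" "\<And>\<alpha>. \<alpha> \<in> \<Phi> \<Longrightarrow> dd \<alpha> \<boxtimes> g \<in> N k" using Suc.prems by auto
  have "dd \<alpha> \<boxtimes> (sc c \<boxtimes> g) \<in> N k" if a: "\<alpha> \<in> \<Phi>" for \<alpha>
  proof -
    have "dd \<alpha> \<boxtimes> (sc c \<boxtimes> g) = dd \<alpha> \<boxtimes> sc c \<boxtimes> g" using a g n by (intro TA.m_assoc[symmetric]) auto
    also have "dd \<alpha> \<boxtimes> sc c = sc c \<boxtimes> dd \<alpha>" by (rule dd_const[OF a]) (use n in auto)
    also have "sc c \<boxtimes> dd \<alpha> \<boxtimes> g = sc c \<boxtimes> (dd \<alpha> \<boxtimes> g)" using a g n by (intro TA.m_assoc) auto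
    finally show ?thesis using Suc.IH[OF g(2)[OF a]] by simp
  qed
  thus ?case using g n by auto
qed (use n in simp)

text \<open>One divided difference applied to \<open>y_l g\<close> yields
  \<open>n g + y_(s l) (dd g)\<close>. The first term has the order of \<open>g\<close> because
  \<open>n\<close> is invariant; in the second the order of \<open>dd g\<close> has dropped by one,
  and the induction restores it.\<close>

lemma N_Y: "l \<in> RtL \<Longrightarrow> g \<in> N n \<Longrightarrow> sc (Y l) \<boxtimes> g \<in> N (Suc n)"
proof (induction n arbitrary: l g)
  case 0
  hence "sc (Y l) \<boxtimes> g = \<zero>\<^bsub>TA\<^esub>" by (simp add: Y_closed)
  thus ?case using N_Suc[of "\<zero>\<^bsub>TA\<^esub>" 0] by simp
next
  case (Suc n)
  have g: "g \<in> carrier TA" "\<And>\<alpha>. \<alpha> \<in> \<Phi> \<Longrightarrow> dd \<alpha> \<boxtimes> g \<in> N n" using Suc.prems by auto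
  have Yl: "Y l \<in> carrier K" by (rule Y_closed[OF Suc.prems(1)])
  have "dd \<alpha> \<boxtimes> (sc (Y l) \<boxtimes> g) \<in> N (Suc n)" if a: "\<alpha> \<in> \<Phi>" for \<alpha>
  proof -
    have rl: "reflection \<alpha> l \<in> RtL" by (rule RtL_weyl[OF weyl_reflection[OF a] Suc.prems(1)])
    obtain k where k: "k \<in> carrier K" "\<And>w. w \<in> W \<Longrightarrow> ac w k = k"
      "dd \<alpha> \<boxtimes> sc (Y l) = sc k \<boxplus> sc (Y (reflection \<alpha> l)) \<boxtimes> dd \<alpha>" using dd_Y[OF a Suc.prems(1)] by blast
    have "dd \<alpha> \<boxtimes> (sc (Y l) \<boxtimes> g) = dd \<alpha> \<boxtimes> sc (Y l) \<boxtimes> g"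
      using a g Yl by (intro TA.m_assoc[symmetric]) auto
    also have "\<dots> = sc k \<boxtimes> g \<boxplus> sc (Y (reflection \<alpha> l)) \<boxtimes> (dd \<alpha> \<boxtimes> g)"
      unfolding k(3) using a g k(1) Y_closed[OF rl] dd_closed[OF a]
      by (simp add: TA.l_distr TA.m_assoc del: dd_closed)
    also have "\<dots> \<in> N (Suc n)"
      by (intro N_add N_const k Suc.prems Suc.IH rl g(2) a)
    finally show ?thesis .
  qed
  moreover have "sc (Y l) \<boxtimes> g \<in> carrier TA" using g Yl by simp
  ultimately show ?case by simp
qed

section \<open>The sum over the finite Weyl group and interpolation\<close>

definition E where "E = finsum TA (\<lambda>w. e w) W"

lemma E_H: "E \<in> H"
proof -
  have "finsum TA (\<lambda>w. e w) X \<in> H" if "finite X" "X \<subseteq> W" for X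
    using that
  proof (induction X)
    case (insert w X)
    hence "finsum TA (\<lambda>w. e w) (insert w X) = e w \<boxplus> finsum TA (\<lambda>w. e w) X"
      by (intro TA.finsum_insert) auto
    thus ?case using insert by (simp add: H_ops e_H)
  qed (simp add: H_ops)
  thus ?thesis using finite_weyl by (simp add: E_def)
qed

lemma E_closed: "E \<in> carrier TA"
  by (rule H_closed[OF E_H])

lemma e_E: assumes v: "v \<in> W" shows "e v \<boxtimes> E = E"
proof -
  have "e v \<boxtimes> E = finsum TA (\<lambda>w. e v \<boxtimes> e w) W"
    unfolding E_def by (rule TA.finsum_rdistr) (use v finite_weyl in auto)
  also have "\<dots> = finsum TA (\<lambda>w. e (v \<circ> w)) W"
    by (rule TA.finsum_cong') (use v in \<open>simp_all add: e_mult weyl_comp Pi_I\<close>)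
  also have "\<dots> = finsum TA (\<lambda>w. e w) ((\<lambda>w. v \<circ> w) ` W)"
  proof (rule TA.finsum_reindex[symmetric])
    show "inj_on (\<lambda>w. v \<circ> w) W"
    proof (rule inj_onI)
      fix a b assume "v \<circ> a = v \<circ> b"
      hence "v (a y) = v (b y)" for y by (metis comp_apply)
      hence "inv_into UNIV v (v (a y)) = inv_into UNIV v (v (b y))" for y by simp
      thus "a = b" by (simp add: fun_eq_iff weyl_inv_simps[OF v])
    qed
    show "(\<lambda>w. e w) \<in> (\<lambda>w. v \<circ> w) ` W \<rightarrow> carrier TA"
    proof
      fix y assume "y \<in> (\<lambda>w. v \<circ> w) ` W"
      hence "y \<in> W" using weyl_comp[OF v] by blast
      thus "e y \<in> carrier TA" by (rule e_closed)
    qed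
  qed
  also have "(\<lambda>w. v \<circ> w) ` W = W"
  proof (intro equalityI subsetI)
    fix y assume y: "y \<in> W"
    have "y = v \<circ> (inv_into UNIV v \<circ> y)" by (simp add: fun_eq_iff weyl_inv_simps[OF v])
    thus "y \<in> (\<lambda>w. v \<circ> w) ` W" using weyl_comp[OF weyl_inv[OF v] y] by (rule image_eqI)
  qed (auto intro: weyl_comp v)
  finally show ?thesis by (simp add: E_def)
qed

lemma E_coeff: "E (\<mu>, w) = (if \<mu> = 0 \<and> w \<in> W then \<one>\<^bsub>K\<^esub> else \<zero>\<^bsub>K\<^esub>)"
proof -
  have "E (\<mu>, w) = finsum K (\<lambda>v. e v (\<mu>, w)) W"
    unfolding E_def by (rule tw_finsum) (auto simp: finite_weyl)
  also have "\<dots> = finsum K (\<lambda>v. if w = v then (if \<mu> = 0 then \<one>\<^bsub>K\<^esub> else \<zero>\<^bsub>K\<^esub>) else \<zero>\<^bsub>K\<^esub>) W"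
    by (rule K.finsum_cong') (auto simp: tw_elem_def)
  also have "\<dots> = (if \<mu> = 0 \<and> w \<in> W then \<one>\<^bsub>K\<^esub> else \<zero>\<^bsub>K\<^esub>)"
  proof (cases "w \<in> W")
    case True
    have "finsum K (\<lambda>v. if w = v then (if \<mu> = 0 then \<one>\<^bsub>K\<^esub> else \<zero>\<^bsub>K\<^esub>) else \<zero>\<^bsub>K\<^esub>) W =
        (if \<mu> = 0 then \<one>\<^bsub>K\<^esub> else \<zero>\<^bsub>K\<^esub>)"
      by (rule K.finsum_singleton[OF True finite_weyl]) auto
    thus ?thesis using True by simp
  next
    case False
    have "finsum K (\<lambda>v. if w = v then (if \<mu> = 0 then \<one>\<^bsub>K\<^esub> else \<zero>\<^bsub>K\<^esub>) else \<zero>\<^bsub>K\<^esub>) W =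
       finsum K (\<lambda>v. \<zero>\<^bsub>K\<^esub>) W"
      by (rule K.finsum_cong') (use False in auto)
    thus ?thesis using False by simp
  qed
  finally show ?thesis .
qed

lemma E_N: "E \<in> N 1"
proof -
  have "dd \<alpha> \<boxtimes> E = \<zero>\<^bsub>TA\<^esub>" if a: "\<alpha> \<in> \<Phi>" for \<alpha>
  proof -
    have s: "reflection \<alpha> \<in> W" by (rule weyl_reflection[OF a])
    have "(\<one>\<^bsub>TA\<^esub> \<boxminus> e (reflection \<alpha>)) \<boxtimes> E = E \<boxminus> E"
      using E_closed s by (simp add: TA_minus_distr e_E[OF s])
    hence "(\<one>\<^bsub>TA\<^esub> \<boxminus> e (reflection \<alpha>)) \<boxtimes> E = \<zero>\<^bsub>TA\<^esub>"
      using E_closed by (simp only: TA.minus_eq TA.r_neg)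
    thus ?thesis using s E_closed by (simp add: TA.m_assoc Yi_closed[OF a])
  qed
  thus ?thesis using E_closed by simp
qed

text \<open>
  Lagrange interpolation: the commutator-like operation \<open>g \<mapsto> g y\<^sub>l - y\<^bsub>v(l)\<^esub> g\<close> kills the
  coefficient of \<open>g\<close> at \<open>v\<close> and raises the nilpotence order by one.
\<close>

lemma N_lagrange:
  assumes "finite V" "V \<subseteq> W - {id}"
  shows "\<exists>g\<in>N (Suc (card V)). (\<forall>\<mu> w. \<mu> \<noteq> 0 \<or> w \<in> V \<or> w \<notin> W \<longrightarrow> g (\<mu>, w) = \<zero>\<^bsub>K\<^esub>) \<and> g (0, id) \<in> Units K"
  using assms
proof (induction V)
  case empty
  have id: "E (0, id) \<in> Units K" unfolding E_coeff using weyl_group.id[of \<Phi>] by simp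
  have z: "E (\<mu>, w) = \<zero>\<^bsub>K\<^esub>" if "\<mu> \<noteq> 0 \<or> w \<in> {} \<or> w \<notin> W" for \<mu> w
    unfolding E_coeff using that by auto
  have "E \<in> N (Suc (card ({} :: ('v \<Rightarrow> 'v) set)))" using E_N by (simp only: card.empty One_nat_def)
  thus ?case using id z by blast
next
  case (insert v V)
  have "V \<subseteq> W - {id}" using insert.prems by blast
  from insert.IH[OF this] obtain g where g: "g \<in> N (Suc (card V))" "g (0, id) \<in> Units K"
    "\<And>\<mu> w. \<mu> \<noteq> 0 \<or> w \<in> V \<or> w \<notin> W \<Longrightarrow> g (\<mu>, w) = \<zero>\<^bsub>K\<^esub>" by blast
  have v: "v \<in> W" "v \<noteq> id" using insert.prems by auto
  \<comment> \<open>For this \<open>l\<close> the difference \<open>y_l - y_(v l)\<close> is a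
    positive integer multiple of \<open>y_alpha\<close>, hence a unit.\<close>
  obtain l \<alpha> m where l: "l \<in> RtL" "\<alpha> \<in> \<Phi>" "(m::nat) > 0" "l - v l = of_nat m *\<^sub>R \<alpha>"
    using weyl_moves_along_root[OF v] by blast
  have vl: "v l \<in> RtL" by (rule RtL_weyl[OF v(1) l(1)])
  note gc = N_closed[OF g(1)] and Yc = Y_closed[OF l(1)] Y_closed[OF vl]
  define g' where "g' = g \<boxtimes> sc (Y l) \<boxminus> sc (Y (v l)) \<boxtimes> g"
  have "g' \<in> N (Suc (Suc (card V)))"
    unfolding g'_def using Yc by (intro N_minus N_Suc[OF N_mult[OF g(1)]] N_Y vl g) simp
  hence N': "g' \<in> N (Suc (card (insert v V)))" using insert.hyps by simp
  \<comment> \<open>Right multiplication by \<open>y_l\<close> meets the coefficient at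
    \<open>w\<close> as \<open>y_(w l)\<close>. The resulting factor vanishes at
    \<open>w = v\<close> and is a unit at the identity; zeros already created at other elements
    persist.\<close>
  have coeff: "g' (0, w) = g (0, w) \<otimes>\<^bsub>K\<^esub> (Y (w l) \<ominus>\<^bsub>K\<^esub> Y (v l))" if w: "w \<in> W" for w
  proof -
    have u: "(0, w) \<in> carrier GG" using w by simp
    have Yw: "Y (w l) \<in> carrier K" by (rule Y_closed[OF RtL_weyl[OF w l(1)]])
    have "(g \<boxtimes> sc (Y l)) (0, w) = g (0, w) \<otimes>\<^bsub>K\<^esub> Y (w l)"
      using tw_elem_mult_right[OF Yc(1) G.one_closed gc u] u by (simp add: act_ac ac_Y[OF w l(1)])
    moreover have "(sc (Y (v l)) \<boxtimes> g) (0, w) = Y (v l) \<otimes>\<^bsub>K\<^esub> g (0, w)"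
      using tw_elem_mult_left[OF Yc(2) G.one_closed gc u] u gc by (simp add: act_one)
    ultimately show ?thesis
      unfolding g'_def using gc Yc Yw
      by (simp add: tw_minus K.minus_eq K.r_distr K.r_minus K.m_comm)
  qed
  have "g' (\<mu>, w) = \<zero>\<^bsub>K\<^esub>" if mw: "\<mu> \<noteq> 0 \<or> w \<in> insert v V \<or> w \<notin> W" for \<mu> w
  proof (cases "(\<mu>, w) \<in> carrier GG")
    case u: True
    hence w: "w \<in> W" by (simp add: GG_simps)
    show ?thesis
    proof (cases "\<mu> = 0")
      case True
      thus ?thesis
      proof (cases "w = v")
        case True
        have "Y (v l) \<ominus>\<^bsub>K\<^esub> Y (v l) = \<zero>\<^bsub>K\<^esub>" using Yc by (simp add: K.minus_eq K.r_neg)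
        thus ?thesis using coeff[OF w] \<open>\<mu> = 0\<close> True gc by simp
      next
        case False
        hence "g (0, w) = \<zero>\<^bsub>K\<^esub>" using mw w \<open>\<mu> = 0\<close> by (intro g(3)) auto
        thus ?thesis using coeff[OF w] \<open>\<mu> = 0\<close> Yc Y_closed[OF RtL_weyl[OF w l(1)]] by simp
      qed
    next
      case False
      have "(g \<boxtimes> sc (Y l)) (\<mu>, w) = \<zero>\<^bsub>K\<^esub>"
        using tw_elem_mult_right[OF Yc(1) G.one_closed gc u] u g(3)[of \<mu> w] False w Yc
        by (simp add: act_ac ac_Y[OF w l(1)] Y_closed[OF RtL_weyl[OF w l(1)]])
      moreover have "(sc (Y (v l)) \<boxtimes> g) (\<mu>, w) = \<zero>\<^bsub>K\<^esub>"
        using tw_elem_mult_left[OF Yc(2) G.one_closed gc u] u g(3)[of \<mu> w] False Yc by simp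
      ultimately show ?thesis unfolding g'_def using gc Yc by (simp add: tw_minus K.minus_eq)
    qed
  next
    case False
    show ?thesis by (rule tw_outside[OF N_closed[OF N'] False])
  qed
  moreover have "g' (0, id) \<in> Units K"
  proof -
    have "Y (id l) \<ominus>\<^bsub>K\<^esub> Y (v l) \<in> Units K" using Y_diff_unit[OF l(1) vl l(2,3,4)] by simp
    thus ?thesis unfolding coeff[OF weyl_group.id] by (rule K.Units_m_closed[OF g(2)])
  qed
  ultimately show ?case using N' by blast
qed

text \<open>Interpolating over all nontrivial elements leaves an element concentrated at the
  identity with a unit coefficient; dividing by that unit on the right stays inside
  \<open>N n\<close>.\<close>

lemma one_N: "\<exists>n. \<one>\<^bsub>TA\<^esub> \<in> N n"
proof -
  obtain n g where g: "g \<in> N n" "\<And>\<mu> w. \<mu> \<noteq> 0 \<or> w \<noteq> id \<Longrightarrow> g (\<mu>, w) = \<zero>\<^bsub>K\<^esub>" "g (0, id) \<in> Units K"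
    using N_lagrange[of "W - {id}"] finite_weyl by blast
  have gs: "g = sc (g (0, id))"
  proof
    fix u show "g u = sc (g (0, id)) u"
    proof (cases "u = (0, id)")
      case True
      thus ?thesis by (simp only: tw_elem_def GG_simps(2) if_True refl)
    next
      case False
      thus ?thesis using g(2)[of "fst u" "snd u"] by (auto simp: tw_elem_def GG_simps(2) prod_eq_iff)
    qed
  qed
  obtain c where c: "c \<in> carrier K" "g (0, id) \<otimes>\<^bsub>K\<^esub> c = \<one>\<^bsub>K\<^esub>"
    using g(3) by (auto simp: Units_def)
  have "g \<boxtimes> sc c = sc (g (0, id)) \<boxtimes> sc c" by (subst gs) (rule refl)
  also have "\<dots> = \<one>\<^bsub>TA\<^esub>" using c g(3) by (simp add: sc_mult sc_one K.Units_closed)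
  finally have "g \<boxtimes> sc c = \<one>\<^bsub>TA\<^esub>" .
  moreover have "g \<boxtimes> sc c \<in> N n" using c by (intro N_mult g) simp
  ultimately show ?thesis by auto
qed

subsection \<open>The centre spans\<close>

abbreviation SZ where "SZ \<equiv> module_span TA ((\<lambda>c. sc c) ` Sc) Z"
abbreviation DZ where "DZ \<equiv> module_span TA DW Z"

lemma SZ_smult: "c \<in> Sc \<Longrightarrow> f \<in> SZ \<Longrightarrow> sc c \<boxtimes> f \<in> SZ"
  by (rule module_span.smult) auto

lemma Z_H: "z \<in> Z \<Longrightarrow> z \<in> H"
  by (simp add: Z_def centre_def)

text \<open>Since \<open>e w E = E\<close>, the conjugation formula for \<open>p\<close> says that
  \<open>p (E h)\<close> is invariant under conjugation by \<open>e w\<close>; membership in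
  \<open>H\<close> comes from \<open>p_H\<close>.\<close>

lemma p_E_Z: assumes h: "h \<in> H" shows "p (E \<boxtimes> h) \<in> Z"
proof (rule ZI)
  have hc: "h \<in> carrier TA" by (rule H_closed[OF h])
  have Eh: "E \<boxtimes> h \<in> carrier TA" using E_closed hc by simp
  show "p (E \<boxtimes> h) \<in> H" by (intro p_H H_ops E_H h)
  show "p (p (E \<boxtimes> h)) = p (E \<boxtimes> h)" using Eh by (rule p_p)
  fix w assume w: "w \<in> W"
  have "e w \<boxtimes> (E \<boxtimes> h) = E \<boxtimes> h"
    using w E_closed hc by (simp add: TA.m_assoc[symmetric] e_E)
  hence "p (E \<boxtimes> h) = e w \<boxtimes> p (E \<boxtimes> h) \<boxtimes> e (inv_into UNIV w)"
    using p_e[OF w Eh] by simp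
  hence "p (E \<boxtimes> h) \<boxtimes> e w = e w \<boxtimes> p (E \<boxtimes> h) \<boxtimes> e (inv_into UNIV w) \<boxtimes> e w" by simp
  also have "\<dots> = e w \<boxtimes> p (E \<boxtimes> h) \<boxtimes> (e (inv_into UNIV w) \<boxtimes> e w)"
    using w Eh weyl_inv[OF w] by (intro TA.m_assoc) auto
  also have "\<dots> = e w \<boxtimes> p (E \<boxtimes> h)" using w Eh by (simp only: e_inv(2)[OF w]) simp
  finally show "e w \<boxtimes> p (E \<boxtimes> h) = p (E \<boxtimes> h) \<boxtimes> e w" by simp
qed

text \<open>Induction on the nilpotence order. The projection is left linear, so the factors
  \<open>y_beta\<close> and \<kappa> come out as coefficients from \<open>S\<close>, while
  \<open>dd\<close> applied to the element has smaller order and remains in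
  \<open>H\<close>.\<close>

lemma p_in_SZ: "h \<in> N n \<Longrightarrow> h \<in> H \<Longrightarrow> p h \<in> SZ"
proof (induction n arbitrary: h)
  case 0
  hence "p h = \<zero>\<^bsub>TA\<^esub>" by (auto simp: fun_eq_iff p_apply tw_zero)
  thus ?case by (simp add: module_span.zero)
next
  case (Suc n)
  \<comment> \<open>Stated for every \<open>h'\<close> of the same order, because it is applied to
    the translates \<open>e w h'\<close> along a product of reflections.\<close>
  have refl: "p (h' \<boxminus> e (reflection \<beta>) \<boxtimes> h') \<in> SZ"
    if h': "h' \<in> N (Suc n)" "h' \<in> H" and b: "\<beta> \<in> \<Phi>" for h' \<beta>
  proof -
    have hc: "h' \<in> carrier TA" by (rule H_closed[OF h'(2)])
    have "h' \<boxminus> e (reflection \<beta>) \<boxtimes> h' = (\<one>\<^bsub>TA\<^esub> \<boxminus> e (reflection \<beta>)) \<boxtimes> h'"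
      using hc weyl_reflection[OF b] by (simp add: TA_minus_distr)
    also have "\<dots> = sc (Y \<beta>) \<boxtimes> dd \<beta> \<boxtimes> h'"
      by (rule arg_cong[OF one_minus_e[OF b]])
    also have "\<dots> = sc (Y \<beta>) \<boxtimes> (dd \<beta> \<boxtimes> h')"
      by (rule TA.m_assoc[OF tw_elem_closed[OF Y_closed[OF RtL_root[OF b]] G.one_closed] dd_closed[OF b] hc])
    finally have "p (h' \<boxminus> e (reflection \<beta>) \<boxtimes> h') = sc (Y \<beta>) \<boxtimes> p (dd \<beta> \<boxtimes> h')"
      using hc b by (simp add: p_sc Y_closed RtL_root del: tw_elem_closed)
    moreover have "p (dd \<beta> \<boxtimes> h') \<in> SZ"
    proof (rule Suc.IH)
      show "dd \<beta> \<boxtimes> h' \<in> N n" using h'(1) b by simp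
      show "dd \<beta> \<boxtimes> h' \<in> H" by (rule H_ops(2)[OF DW_H[OF dd_DW[OF b]] h'(2)])
    qed
    ultimately show ?thesis using SZ_smult[OF Y_Sc[OF RtL_root[OF b]]] by simp
  qed
  have diff: "p (h' \<boxminus> e w \<boxtimes> h') \<in> SZ" if w: "w \<in> W" and h': "h' \<in> N (Suc n)" "h' \<in> H" for w h'
    using w
  proof (induction rule: weyl_group.induct)
    case id
    have "h' \<boxminus> e id \<boxtimes> h' = \<zero>\<^bsub>TA\<^esub>" using H_closed[OF h'(2)] by (simp add: e_id TA.minus_eq TA.r_neg)
    moreover have "p \<zero>\<^bsub>TA\<^esub> = \<zero>\<^bsub>TA\<^esub>" by (auto simp: fun_eq_iff p_apply tw_zero)
    ultimately show ?case by (simp only: module_span.zero)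
  next
    case (reflect \<beta> w)
    let ?s = "reflection \<beta>"
    have s: "?s \<in> W" by (rule weyl_reflection[OF reflect.hyps(1)])
    have hc: "h' \<in> carrier TA" by (rule H_closed[OF h'(2)])
    have wh: "e w \<boxtimes> h' \<in> carrier TA" "e ?s \<boxtimes> (e w \<boxtimes> h') \<in> carrier TA" using hc reflect.hyps s by auto
    have "e (?s \<circ> w) \<boxtimes> h' = e ?s \<boxtimes> (e w \<boxtimes> h')"
      using hc reflect.hyps s by (simp add: e_mult[OF s reflect.hyps(2), symmetric] TA.m_assoc)
    \<comment> \<open>Telescoping: \<open>1 - e (s w) = (1 - e w) + (1 - e s) e w\<close>, so only
      differences for single reflections remain.\<close>
    hence "h' \<boxminus> e (?s \<circ> w) \<boxtimes> h' = (h' \<boxminus> e w \<boxtimes> h') \<boxplus> (e w \<boxtimes> h' \<boxminus> e ?s \<boxtimes> (e w \<boxtimes> h'))"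
      using hc wh by (simp add: TA.minus_eq TA.a_assoc TA.r_neg1)
    moreover have "p (e w \<boxtimes> h' \<boxminus> e ?s \<boxtimes> (e w \<boxtimes> h')) \<in> SZ"
      using h' reflect.hyps by (intro refl N_e H_ops e_H)
    ultimately show ?case
      using reflect.IH p_add[OF TA.minus_closed[OF hc wh(1)] TA.minus_closed[OF wh]]
      by (simp only: module_span.add)
  qed
  let ?h = "h"
  have hH: "h \<in> H" and hc: "h \<in> carrier TA" using Suc.prems H_closed by auto
  have kc: "\<kappa> \<in> carrier K" by (rule Sc_carrier[OF \<kappa>_Sc])
  have kh: "sc \<kappa> \<boxtimes> h \<in> carrier TA" using kc hc by simp
  have sum_h: "finsum TA (\<lambda>w. sc \<kappa> \<boxtimes> h) W = h"
  proof (rule tw_ext)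
    fix u assume u: "u \<in> carrier GG"
    have "finsum TA (\<lambda>w. sc \<kappa> \<boxtimes> h) W u = finsum K (\<lambda>w. \<kappa> \<otimes>\<^bsub>K\<^esub> h u) W"
      using tw_finsum[OF finite_weyl kh] tw_elem_mult_left[OF kc G.one_closed hc u] u hc by (simp add: act_one)
    also have "\<dots> = finsum K (\<lambda>w. \<kappa>) W \<otimes>\<^bsub>K\<^esub> h u"
      by (rule K.finsum_ldistr[symmetric]) (use kc hc finite_weyl in auto)
    finally show "finsum TA (\<lambda>w. sc \<kappa> \<boxtimes> h) W u = h u" using hc by (simp add: \<kappa>_sum)
  qed (use kh hc in \<open>auto intro!: TA.finsum_closed\<close>)
  have sum_E: "finsum TA (\<lambda>w. sc \<kappa> \<boxtimes> (e w \<boxtimes> h)) W = sc \<kappa> \<boxtimes> (E \<boxtimes> h)"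
  proof -
    have "finsum TA (\<lambda>w. sc \<kappa> \<boxtimes> (e w \<boxtimes> h)) W = sc \<kappa> \<boxtimes> finsum TA (\<lambda>w. e w \<boxtimes> h) W"
      by (rule TA.finsum_rdistr[symmetric]) (use kc hc finite_weyl in auto)
    also have "finsum TA (\<lambda>w. e w \<boxtimes> h) W = E \<boxtimes> h"
      unfolding E_def by (rule TA.finsum_ldistr[symmetric]) (use hc finite_weyl in auto)
    finally show ?thesis .
  qed
  have "h = finsum TA (\<lambda>w. sc \<kappa> \<boxtimes> (h \<boxminus> e w \<boxtimes> h) \<boxplus> sc \<kappa> \<boxtimes> (e w \<boxtimes> h)) W"
  proof -
    have "finsum TA (\<lambda>w. sc \<kappa> \<boxtimes> (h \<boxminus> e w \<boxtimes> h) \<boxplus> sc \<kappa> \<boxtimes> (e w \<boxtimes> h)) W = finsum TA (\<lambda>w. sc \<kappa> \<boxtimes> h) W"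
    proof (rule TA.finsum_cong')
      fix w assume w: "w \<in> W"
      have a: "sc \<kappa> \<boxtimes> (e w \<boxtimes> h) \<in> carrier TA" using w kc hc by simp
      show "sc \<kappa> \<boxtimes> (h \<boxminus> e w \<boxtimes> h) \<boxplus> sc \<kappa> \<boxtimes> (e w \<boxtimes> h) = sc \<kappa> \<boxtimes> h"
        using a w kc hc kh by (simp add: TA_minus_distr) (simp add: TA.minus_eq TA.a_assoc TA.l_neg)
    qed (use kh in auto)
    thus ?thesis using sum_h by simp
  qed
  also have "\<dots> = finsum TA (\<lambda>w. sc \<kappa> \<boxtimes> (h \<boxminus> e w \<boxtimes> h)) W \<boxplus> sc \<kappa> \<boxtimes> (E \<boxtimes> h)"
    unfolding sum_E[symmetric] by (rule TA.finsum_addf) (use kc hc in auto)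
  finally have ph: "p h = p (finsum TA (\<lambda>w. sc \<kappa> \<boxtimes> (h \<boxminus> e w \<boxtimes> h)) W) \<boxplus> sc \<kappa> \<boxtimes> p (E \<boxtimes> h)"
    using kc hc E_closed by (metis (no_types, lifting) TA.m_closed p_add p_sc tw_elem_closed G.one_closed TA.finsum_closed Pi_I TA.minus_closed e_closed)
  have "p (finsum TA (\<lambda>w. sc \<kappa> \<boxtimes> (h \<boxminus> e w \<boxtimes> h)) X) \<in> SZ" if "finite X" "X \<subseteq> W" for X
    using that
  proof (induction X)
    case empty
    have "p \<zero>\<^bsub>TA\<^esub> = \<zero>\<^bsub>TA\<^esub>" by (auto simp: fun_eq_iff p_apply tw_zero)
    thus ?case by (simp add: module_span.zero)
  next
    case (insert w X)
    have w: "w \<in> W" using insert.prems by simp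
    have cl: "sc \<kappa> \<boxtimes> (h \<boxminus> e v \<boxtimes> h) \<in> carrier TA" if "v \<in> W" for v using that kc hc by simp
    have fc: "finsum TA (\<lambda>w. sc \<kappa> \<boxtimes> (h \<boxminus> e w \<boxtimes> h)) X \<in> carrier TA"
      using insert.prems cl by (intro TA.finsum_closed) auto
    have "finsum TA (\<lambda>w. sc \<kappa> \<boxtimes> (h \<boxminus> e w \<boxtimes> h)) (insert w X) =
        sc \<kappa> \<boxtimes> (h \<boxminus> e w \<boxtimes> h) \<boxplus> finsum TA (\<lambda>w. sc \<kappa> \<boxtimes> (h \<boxminus> e w \<boxtimes> h)) X"
      using insert.hyps insert.prems cl by (intro TA.finsum_insert) auto
    moreover have "p (sc \<kappa> \<boxtimes> (h \<boxminus> e w \<boxtimes> h)) = sc \<kappa> \<boxtimes> p (h \<boxminus> e w \<boxtimes> h)"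
      using kc hc w by (intro p_sc) auto
    ultimately show ?case
      using insert.IH insert.prems fc cl[OF w] diff[OF w Suc.prems] SZ_smult[OF \<kappa>_Sc]
      by (simp add: p_add module_span.add)
  qed
  hence "p (finsum TA (\<lambda>w. sc \<kappa> \<boxtimes> (h \<boxminus> e w \<boxtimes> h)) W) \<in> SZ" using finite_weyl by simp
  thus ?case unfolding ph
    by (rule module_span.add[OF _ SZ_smult[OF \<kappa>_Sc module_span.incl[OF p_E_Z[OF hH]]]])
qed

text \<open>The order \<open>n\<close> found for \<open>1\<close> works for every \<open>h\<close>,
  since \<open>h = 1 h\<close> and \<open>N n\<close> is stable under right multiplication.\<close>

lemma p_H_SZ: assumes "h \<in> H" shows "p h \<in> SZ"
proof -
  obtain n where "\<one>\<^bsub>TA\<^esub> \<in> N n" using one_N by blast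
  hence "\<one>\<^bsub>TA\<^esub> \<boxtimes> h \<in> N n" using H_closed[OF assms] by (rule N_mult)
  thus ?thesis using H_closed[OF assms] assms by (simp add: p_in_SZ)
qed

text \<open>One inclusion is the induction above. For the other, central elements are fixed by
  \<open>p\<close>, and the image of \<open>H\<close> under the left linear map \<open>p\<close> is
  closed under sums and coefficients from \<open>S\<close>.\<close>

lemma S_span_centre: "SZ = p ` H"
proof (intro equalityI subsetI)
  fix f assume "f \<in> SZ"
  thus "f \<in> p ` H"
  proof induction
    case zero
    have "p \<zero>\<^bsub>TA\<^esub> = \<zero>\<^bsub>TA\<^esub>" by (auto simp: fun_eq_iff p_apply tw_zero)
    thus ?case using H_ops(6) by (metis image_eqI)
  next
    case (incl z)
    thus ?case using Z_fixed[OF incl] Z_H[OF incl] by (metis image_eqI)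
  next
    case (add f g)
    then obtain f' g' where "f' \<in> H" "g' \<in> H" "f = p f'" "g = p g'" by blast
    thus ?case using p_add[of f' g'] by (intro image_eqI[of _ _ "f' \<boxplus> g'"]) (auto simp: H_closed H_ops)
  next
    case (smult b f)
    then obtain c f' where "c \<in> Sc" "b = sc c" "f' \<in> H" "f = p f'" by blast
    thus ?case using p_sc[of c f'] by (intro image_eqI[of _ _ "sc c \<boxtimes> f'"]) (auto simp: H_closed H_ops Sc_carrier sc_H)
  qed
qed (auto intro: p_H_SZ)

section \<open>The span of the centre over the finite Demazure algebra\<close>

lemma Z_mult: assumes "y \<in> Z" "z \<in> Z" shows "y \<boxtimes> z \<in> Z"
proof -
  have H: "y \<in> H" "z \<in> H" by (auto intro: Z_H assms)
  have c: "y \<in> carrier TA" "z \<in> carrier TA" by (auto intro: H_closed H)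
  have "y \<boxtimes> z \<boxtimes> d = d \<boxtimes> (y \<boxtimes> z)" if d: "d \<in> H" for d
  proof -
    have dc: "d \<in> carrier TA" by (rule H_closed[OF d])
    have yd: "y \<boxtimes> d = d \<boxtimes> y" and zd: "z \<boxtimes> d = d \<boxtimes> z" using assms d by (auto simp: Z_def centre_def)
    have "y \<boxtimes> z \<boxtimes> d = y \<boxtimes> d \<boxtimes> z" using c dc zd by (simp add: TA.m_assoc)
    thus ?thesis unfolding yd using c dc by (simp add: TA.m_assoc)
  qed
  thus ?thesis using H by (simp add: Z_def centre_def H_ops)
qed

lemma DZ_H: "f \<in> DZ \<Longrightarrow> f \<in> H"
  by (induction rule: module_span.induct) (auto intro: H_ops Z_H DW_H)

text \<open>A central element moves past the coefficients from \<open>D_W\<close> and multiplies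
  central elements to central ones, and coefficients from \<open>S\<close> belong to
  \<open>D_W\<close>.\<close>

lemma SZ_DZ_mult: assumes "a \<in> SZ" "f \<in> DZ" shows "a \<boxtimes> f \<in> DZ"
  using assms(1)
proof induction
  case zero
  thus ?case using H_closed[OF DZ_H[OF assms(2)]] by (simp add: module_span.zero)
next
  case (incl z)
  have zc: "z \<in> carrier TA" by (rule H_closed[OF Z_H[OF incl]])
  show ?case using assms(2)
  proof induction
    case zero
    show ?case using zc by (simp add: module_span.zero)
  next
    case (incl y)
    thus ?case using \<open>z \<in> Z\<close> by (intro module_span.incl Z_mult)
  next
    case (add f g)
    thus ?case using zc H_closed[OF DZ_H] by (simp add: TA.r_distr module_span.add)
  next
    case (smult b f)
    have bc: "b \<in> carrier TA" and fc: "f \<in> carrier TA"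
      using smult H_closed[OF DW_H] H_closed[OF DZ_H] by auto
    have "z \<boxtimes> b = b \<boxtimes> z" using \<open>z \<in> Z\<close> DW_H[OF smult.hyps(1)] by (simp add: Z_def centre_def)
    hence "z \<boxtimes> (b \<boxtimes> f) = b \<boxtimes> (z \<boxtimes> f)" using zc bc fc by (simp add: TA.m_assoc[symmetric])
    thus ?case using smult by (simp add: module_span.smult)
  qed
next
  case (add f g)
  have "f \<in> carrier TA" "g \<in> carrier TA"
    using add.hyps p_H H_closed unfolding S_span_centre by blast+
  thus ?case using add.IH H_closed[OF DZ_H[OF assms(2)]] by (simp add: TA.l_distr module_span.add)
next
  case (smult b g)
  then obtain c where c: "c \<in> Sc" "b = sc c" by blast
  have "g \<in> carrier TA" using smult.hyps p_H H_closed unfolding S_span_centre by blast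
  hence "b \<boxtimes> g \<boxtimes> f = b \<boxtimes> (g \<boxtimes> f)"
    using c H_closed[OF DZ_H[OF assms(2)]] by (intro TA.m_assoc) (auto simp: Sc_carrier)
  thus ?case using smult.IH c by (simp add: module_span.smult sc_DW)
qed

text \<open>Among the generators of \<open>H\<close> only the affine one lies outside the
  coefficient ring \<open>D_W\<close> by construction. Its decomposition uses only \<open>X\<close>
  at \<open>- \<theta>\<close>, which is in \<open>D_W\<close>, and two elements of
  \<open>p H\<close>, hence of \<open>SZ\<close>.\<close>

lemma X0_DZ: assumes f: "f \<in> DZ" shows "X0 \<boxtimes> f \<in> DZ"
proof -
  let ?c = "coroot \<theta>" and ?s = "reflection \<theta>" and ?x = "xi (- \<theta>)"
  have m: "- \<theta> \<in> \<Phi>" by (rule uminus_root[OF \<theta>])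
  have c: "?c \<in> CrL" by (rule CrL_coroot[OF \<theta>])
  have s: "?s \<in> W" by (rule weyl_reflection[OF \<theta>])
  note cl = xi_closed[OF m] tr_GG[OF c] H_closed[OF DZ_H[OF f]]
  have split: "eta (?c, ?s) = tr ?c \<boxtimes> e ?s"
    using eta_mult[OF tr_GG[OF c] W_GG[OF s]] by (simp add: GG_simps)
  have pe: "p (eta (?c, ?s)) = tr ?c"
  proof -
    have i: "?s \<circ> inv_into UNIV ?s = id" by (auto simp: fun_eq_iff weyl_inv_simps[OF s])
    have "p (eta (?c, ?s)) = eta (?c, ?s) \<boxtimes> e (inv_into UNIV ?s)"
      using p_eta[OF c s TA.one_closed] coroot_refl_GG by (simp add: p_one)
    also have "\<dots> = tr ?c"
      using eta_mult[OF coroot_refl_GG W_GG[OF weyl_inv[OF s]]]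
      by (simp add: GG_simps linear_0[OF weyl_linear[OF s]] i)
    finally show ?thesis .
  qed
  have tr_closed: "tr ?c \<in> carrier TA" by (rule tw_elem_closed[OF K.one_closed cl(2)])
  have pX: "p X0 = sc ?x \<boxtimes> (\<one>\<^bsub>TA\<^esub> \<boxminus> tr ?c)"
    using cl coroot_refl_GG by (simp add: p_sc p_minus p_one pe)
  have comm: "sc ?x \<boxtimes> tr ?c = tr ?c \<boxtimes> sc ?x"
    by (rule fixed_sc_commute) (use cl p_tr[OF c] in auto)
  \<comment> \<open>This is \<open>1 - t s = (1 - t) + t (1 - s)\<close>, multiplied by the inverse
    of \<open>x\<close> at \<open>- \<theta>\<close>, which commutes with the translation
    \<open>t\<close>.\<close>
  have "X0 = p X0 \<boxplus> tr ?c \<boxtimes> Xs (- \<theta>)"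
  proof -
    have "tr ?c \<boxtimes> Xs (- \<theta>) = sc ?x \<boxtimes> (tr ?c \<boxtimes> (\<one>\<^bsub>TA\<^esub> \<boxminus> e ?s))"
      using cl s comm by (simp add: reflection_uminus TA.m_assoc[symmetric])
    moreover have "p X0 \<boxplus> sc ?x \<boxtimes> (tr ?c \<boxtimes> (\<one>\<^bsub>TA\<^esub> \<boxminus> e ?s)) =
        sc ?x \<boxtimes> ((\<one>\<^bsub>TA\<^esub> \<boxminus> tr ?c) \<boxplus> tr ?c \<boxtimes> (\<one>\<^bsub>TA\<^esub> \<boxminus> e ?s))"
      unfolding pX using cl s by (intro TA.r_distr[symmetric]) auto
    moreover have "(\<one>\<^bsub>TA\<^esub> \<boxminus> tr ?c) \<boxplus> tr ?c \<boxtimes> (\<one>\<^bsub>TA\<^esub> \<boxminus> e ?s) = \<one>\<^bsub>TA\<^esub> \<boxminus> eta (?c, ?s)"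
      unfolding split using cl s by (simp add: TA_minus_distr) (simp add: TA.minus_eq TA.a_assoc TA.r_neg1)
    ultimately show ?thesis by simp
  qed
  hence "X0 \<boxtimes> f = (p X0 \<boxplus> tr ?c \<boxtimes> Xs (- \<theta>)) \<boxtimes> f" by (rule arg_cong)
  also have "\<dots> = p X0 \<boxtimes> f \<boxplus> (tr ?c \<boxtimes> Xs (- \<theta>)) \<boxtimes> f"
    by (rule TA.l_distr[OF p_closed[OF X0_closed] TA.m_closed[OF tr_closed Xs_closed[OF m]] cl(3)])
  also have "(tr ?c \<boxtimes> Xs (- \<theta>)) \<boxtimes> f = tr ?c \<boxtimes> (Xs (- \<theta>) \<boxtimes> f)"
    by (rule TA.m_assoc[OF tr_closed Xs_closed[OF m] cl(3)])
  also have "p X0 \<boxtimes> f \<boxplus> tr ?c \<boxtimes> (Xs (- \<theta>) \<boxtimes> f) \<in> DZ"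
  proof (rule module_span.add)
    show "p X0 \<boxtimes> f \<in> DZ" by (rule SZ_DZ_mult[OF p_H_SZ[OF X0_H] f])
    have "tr ?c \<in> SZ" using p_H_SZ[OF tr_theta_H] by (simp only: p_tr[OF c])
    thus "tr ?c \<boxtimes> (Xs (- \<theta>) \<boxtimes> f) \<in> DZ"
      by (rule SZ_DZ_mult[OF _ module_span.smult[OF Xs_DW[OF m] f]])
  qed
  finally show ?thesis .
qed

text \<open>The span is stable under left multiplication by every generator of \<open>H\<close> and
  contains the central element 1, so it contains \<open>h 1\<close> for each \<open>h\<close> in
  \<open>H\<close>.\<close>

lemma DW_span_centre: "DZ = H"
proof (intro equalityI subsetI)
  fix h assume h: "h \<in> H"
  have "h \<boxtimes> f \<in> DZ" if "f \<in> DZ" for f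
    using h that
  proof (induction arbitrary: f rule: H_induct)
    case one
    thus ?case using H_closed[OF DZ_H] by simp
  next
    case (sc c)
    thus ?case by (simp add: module_span.smult sc_DW)
  next
    case X0
    thus ?case by (rule X0_DZ)
  next
    case (Xs \<alpha>)
    show ?case by (rule module_span.smult[OF Xs_DW[OF simple_root[OF Xs(1)]] Xs(2)])
  next
    case (uminus h)
    have hc: "h \<in> carrier TA" by (rule H_closed[OF uminus.hyps])
    have fc: "f \<in> carrier TA" by (rule H_closed[OF DZ_H[OF uminus.prems]])
    have "\<ominus>\<^bsub>TA\<^esub> h \<boxtimes> f = (\<ominus>\<^bsub>TA\<^esub> \<one>\<^bsub>TA\<^esub>) \<boxtimes> (h \<boxtimes> f)" using hc fc by (simp add: TA.l_minus)
    thus ?case using uminus.IH[OF uminus.prems] by (simp only: module_span.smult DW_ops)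
  next
    case (add h1 h2)
    have "h1 \<in> carrier TA" "h2 \<in> carrier TA" by (auto intro: H_closed add.hyps)
    thus ?case using add.IH[OF add.prems] H_closed[OF DZ_H[OF add.prems]]
      by (simp add: TA.l_distr module_span.add)
  next
    case (mult h1 h2)
    have "h1 \<in> carrier TA" "h2 \<in> carrier TA" by (auto intro: H_closed mult.hyps)
    thus ?case using mult.IH(1)[OF mult.IH(2)[OF mult.prems]] H_closed[OF DZ_H[OF mult.prems]]
      by (simp add: TA.m_assoc)
  qed
  moreover have "\<one>\<^bsub>TA\<^esub> \<in> DZ"
  proof (rule module_span.incl, rule ZI)
    show "\<one>\<^bsub>TA\<^esub> \<in> H" by (rule H_ops)
    show "p \<one>\<^bsub>TA\<^esub> = \<one>\<^bsub>TA\<^esub>" by (rule p_one)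
  qed simp
  ultimately have "h \<boxtimes> \<one>\<^bsub>TA\<^esub> \<in> DZ" by blast
  thus "h \<in> DZ" using H_closed[OF h] by simp
qed (rule DZ_H)

end

section \<open>The equivariant additive classes of the root lattice\<close>

lemma ps_sum_closed:
  "(\<And>b. b \<in> B \<Longrightarrow> f b \<in> carrier (ps_ring V)) \<Longrightarrow> (\<lambda>m. \<Sum>b\<in>B. f b m) \<in> carrier (ps_ring V)"
  by (induction B rule: infinite_finite_induct) (auto simp: ps_zero_closed ps_add_closed)

lemma ps_scale_closed:
  "f \<in> carrier (ps_ring V) \<Longrightarrow> (\<lambda>m. c * f m) \<in> carrier (ps_ring V)"
  using ps_conv_closed[OF ps_const_closed, of f V c] by (simp add: ps_conv_const_left)

locale peterson = based_root_sys \<Phi> \<Delta> for \<Phi> \<Delta> :: "'v::euclidean_space set" +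
  fixes F :: "nat \<Rightarrow> nat \<Rightarrow> 'r::comm_ring_1" and \<theta> :: 'v
  assumes irreducible: "irreducible_root_system \<Phi>" and theta: "\<theta> \<in> \<Phi>"
    and fgl: "formal_group_law F" and rat: "n > 0 \<Longrightarrow> \<exists>r::'r. of_nat n * r = 1"
begin

sublocale fg: formal_group_algebra F "root_lattice \<Phi>"
  by unfold_locales
    (use fgl_coeff_zero[OF fgl] fgl_coeff_one[OF fgl] in
      \<open>auto intro: int_lattice_zero int_lattice_add int_lattice_uminus\<close>)

lemma weyl_lattice_aut: "w \<in> W \<Longrightarrow> lattice_aut RtL w"
  using weyl_bij[of w \<Phi>] RtL_weyl_image[of w] linear_add[OF weyl_linear[of w \<Phi>]]
  by (simp add: lattice_aut_def)

text \<open>A lift of \<open>y_l\<close> to the power series ring: a linear form in the root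
  variables, so no convergence question arises. For \<open>l\<close> in the root lattice the
  pairings are integers, and the floor only converts their type.\<close>

definition ys :: "'v \<Rightarrow> 'v multiset \<Rightarrow> 'r" where
  "ys l = (\<lambda>m. \<Sum>\<beta>\<in>\<Phi>. of_int \<lfloor>l \<bullet> coroot \<beta>\<rfloor> * ps_var \<beta> m)"

lemma ps_root_closed: "\<beta> \<in> \<Phi> \<Longrightarrow> ps_var \<beta> \<in> carrier fg.P"
  by (intro ps_var_closed RtL_root)

lemma ys_closed: "ys l \<in> carrier fg.P"
  unfolding ys_def by (intro ps_sum_closed ps_scale_closed ps_root_closed)

lemma of_int_floor: "(z::real) \<in> \<int> \<Longrightarrow> real_of_int \<lfloor>z\<rfloor> = z"
  by (auto elim: Ints_cases)

lemma ps_act_ys: assumes w: "w \<in> W" shows "ps_act w (ys l) = ys (w l)"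
proof (rule ps_act_eqI[OF weyl_bij[OF w]])
  fix m
  have "ys (w l) (image_mset w m) =
      (\<Sum>\<beta>\<in>w ` \<Phi>. of_int \<lfloor>w l \<bullet> coroot \<beta>\<rfloor> * ps_var \<beta> (image_mset w m))"
    unfolding ys_def weyl_roots[OF w] ..
  also have "\<dots> = (\<Sum>\<beta>\<in>\<Phi>. of_int \<lfloor>w l \<bullet> coroot (w \<beta>)\<rfloor> * ps_var (w \<beta>) (image_mset w m))"
    by (subst sum.reindex) (auto intro: inj_on_subset[OF bij_is_inj[OF weyl_bij[OF w]]])
  also have "\<dots> = ys l m"
    unfolding ys_def
  proof (rule sum.cong[OF refl])
    fix \<beta>
    have "w l \<bullet> coroot (w \<beta>) = l \<bullet> coroot \<beta>"
      using weyl_inner[OF w, of l "coroot \<beta>"] by (simp add: coroot_weyl[OF w])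
    moreover have "ps_var (w \<beta>) (image_mset w m) = (ps_var \<beta> m :: 'r)"
      using ps_act_bij[OF weyl_bij[OF w], of "ps_var \<beta> :: 'v multiset \<Rightarrow> 'r" m]
      by (simp add: ps_act_var[OF weyl_bij[OF w]])
    ultimately show "of_int \<lfloor>w l \<bullet> coroot (w \<beta>)\<rfloor> * ps_var (w \<beta>) (image_mset w m) =
        of_int \<lfloor>l \<bullet> coroot \<beta>\<rfloor> * (ps_var \<beta> m :: 'r)" by simp
  qed
  finally show "ys (w l) (image_mset w m) = ys l m" .
qed

text \<open>Linearity of the pairings in \<open>l\<close>, in the one case required: subtracting an
  integer multiple of a root. Integrality makes the floors additive.\<close>

lemma ys_diff:
  assumes l: "l \<in> RtL" and a: "\<alpha> \<in> \<Phi>"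
  shows "ys l m = ys (l - of_int k *\<^sub>R \<alpha>) m + of_int k * ys \<alpha> m"
proof -
  have "of_int \<lfloor>l \<bullet> coroot \<beta>\<rfloor> * ps_var \<beta> m =
      of_int \<lfloor>(l - of_int k *\<^sub>R \<alpha>) \<bullet> coroot \<beta>\<rfloor> * ps_var \<beta> m +
      of_int k * (of_int \<lfloor>\<alpha> \<bullet> coroot \<beta>\<rfloor> * (ps_var \<beta> m :: 'r))" if b: "\<beta> \<in> \<Phi>" for \<beta>
  proof -
    obtain i where i: "l \<bullet> coroot \<beta> = of_int i" using RtL_int[OF l b] by (auto elim: Ints_cases)
    obtain j where j: "\<alpha> \<bullet> coroot \<beta> = of_int j" using roots_int[OF b a] by (auto elim: Ints_cases)
    have "(l - of_int k *\<^sub>R \<alpha>) \<bullet> coroot \<beta> = of_int (i - k * j)" by (simp add: inner_diff_left i j)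
    hence fl: "\<lfloor>(l - of_int k *\<^sub>R \<alpha>) \<bullet> coroot \<beta>\<rfloor> = i - k * j" by (simp only: floor_of_int)
    show ?thesis unfolding fl unfolding i j floor_of_int by (simp add: algebra_simps)
  qed
  thus ?thesis unfolding ys_def sum_distrib_left sum.distrib[symmetric] by (rule sum.cong[OF refl])
qed

lemma q_ys_diff:
  assumes l: "l \<in> RtL" and a: "\<alpha> \<in> \<Phi>"
  shows "fg.q (ys l) = fg.q (ys (l - of_int k *\<^sub>R \<alpha>)) \<oplus>\<^bsub>fg.S\<^esub>
    fg.q (ps_const (of_int k)) \<otimes>\<^bsub>fg.S\<^esub> fg.q (ys \<alpha>)"
proof -
  have "ys l = ys (l - of_int k *\<^sub>R \<alpha>) \<oplus>\<^bsub>fg.P\<^esub> ps_const (of_int k) \<otimes>\<^bsub>fg.P\<^esub> ys \<alpha>"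
    by (simp add: ps_ring_simps ps_conv_const_left ys_diff[OF l a, of _ k, symmetric])
  thus ?thesis
    using fg.q.hom_add[OF ys_closed ps.m_closed[OF ps_const_closed ys_closed]]
      fg.q.hom_mult[OF ps_const_closed ys_closed] by simp
qed

lemma reflection_floor:
  assumes "\<alpha> \<in> \<Phi>" "l \<in> RtL" shows "reflection \<alpha> l = l - of_int \<lfloor>l \<bullet> coroot \<alpha>\<rfloor> *\<^sub>R \<alpha>"
  unfolding reflection_def of_int_floor[OF RtL_int[OF assms(2,1)]] ..

lemma I_sum:
  assumes "\<And>b. b \<in> B \<Longrightarrow> f b \<in> fg.I" shows "(\<lambda>m. \<Sum>b\<in>B. c b * f b m) \<in> fg.I"
  using assms
proof (induction B rule: infinite_finite_induct)
  case (insert b B)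
  have "ps_const (c b) \<otimes>\<^bsub>fg.P\<^esub> f b \<in> fg.I"
    by (rule fg.I.I_l_closed[OF _ ps_const_closed]) (use insert in simp)
  hence "(\<lambda>m. c b * f b m) \<in> fg.I" by (simp add: ps_ring_simps ps_conv_const_left)
  from fg.I.a_closed[OF this insert.IH] insert show ?case by (simp add: ps_ring_simps)
qed (use fg.I.zero_closed in \<open>simp_all add: ps_ring_simps\<close>)

text \<open>
  Since \<open>ys \<alpha>\<close> is negated by the reflection in \<open>\<alpha>\<close>, twice its class is the sum of
  the \<open>\<langle>\<alpha>, \<beta>\<^sup>\<or>\<rangle> (x\<^bsub>\<beta>\<^esub> - x\<^bsub>s(\<beta>)\<^esub>)\<close>, each of which is divisible by \<open>x\<^bsub>\<alpha>\<^esub>\<close>. The constant term of the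
  quotient is half the positive integer \<open>\<Sum>\<^sub>\<beta> \<langle>\<alpha>, \<beta>\<^sup>\<or>\<rangle> \<langle>\<beta>, \<alpha>\<^sup>\<or>\<rangle>\<close>.
\<close>

lemma ys_root:
  assumes a: "\<alpha> \<in> \<Phi>" shows "\<exists>u\<in>Units fg.S. fg.q (ys \<alpha>) = fg.X \<alpha> \<otimes>\<^bsub>fg.S\<^esub> u"
proof -
  let ?n = "\<lambda>\<beta>. \<lfloor>\<alpha> \<bullet> coroot \<beta>\<rfloor>" and ?k = "\<lambda>\<beta>. \<lfloor>\<beta> \<bullet> coroot \<alpha>\<rfloor>" and ?s = "reflection \<alpha>"
  have s: "?s \<in> W" by (rule weyl_reflection[OF a])
  have "\<forall>\<beta>\<in>\<Phi>. \<exists>h. h \<in> carrier fg.P \<and> h {#} = of_int (?k \<beta>) \<and>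
      fg.X \<beta> = fg.X (?s \<beta>) \<oplus>\<^bsub>fg.S\<^esub> fg.X \<alpha> \<otimes>\<^bsub>fg.S\<^esub> fg.q h"
  proof
    fix \<beta> assume b: "\<beta> \<in> \<Phi>"
    show "\<exists>h. h \<in> carrier fg.P \<and> h {#} = of_int (?k \<beta>) \<and>
      fg.X \<beta> = fg.X (?s \<beta>) \<oplus>\<^bsub>fg.S\<^esub> fg.X \<alpha> \<otimes>\<^bsub>fg.S\<^esub> fg.q h"
      using fg.X_diff_int[OF RtL_root[OF b] RtL_root[OF a], of "?k \<beta>"]
      unfolding reflection_floor[OF a RtL_root[OF b]] by blast
  qed
  then obtain h where h: "\<And>\<beta>. \<beta> \<in> \<Phi> \<Longrightarrow> h \<beta> \<in> carrier fg.P"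
    "\<And>\<beta>. \<beta> \<in> \<Phi> \<Longrightarrow> h \<beta> {#} = of_int (?k \<beta>)"
    "\<And>\<beta>. \<beta> \<in> \<Phi> \<Longrightarrow> fg.X \<beta> = fg.X (?s \<beta>) \<oplus>\<^bsub>fg.S\<^esub> fg.X \<alpha> \<otimes>\<^bsub>fg.S\<^esub> fg.q (h \<beta>)"
    by metis
  \<comment> \<open>The divisibility relations in the quotient are lifted to elements of the ideal,
    so that a weighted sum over all roots can be formed coefficientwise.\<close>
  let ?d = "\<lambda>\<beta> m. ps_var \<beta> m - (ps_var (?s \<beta>) m + ps_conv (ps_var \<alpha>) (h \<beta>) m)"
  have d: "?d \<beta> \<in> fg.I" if b: "\<beta> \<in> \<Phi>" for \<beta>
  proof (rule fg.q_eqD)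
    note va = ps_root_closed[OF a] and vb = ps_root_closed[OF b] and vs = ps_root_closed[OF weyl_root[OF s b]]
    show "ps_var \<beta> \<in> carrier fg.P" by (rule vb)
    show "(\<lambda>m. ps_var (?s \<beta>) m + ps_conv (ps_var \<alpha>) (h \<beta>) m) \<in> carrier fg.P"
      by (intro ps_add_closed ps_conv_closed va vs h b)
    have "fg.q (ps_var (?s \<beta>) \<oplus>\<^bsub>fg.P\<^esub> ps_var \<alpha> \<otimes>\<^bsub>fg.P\<^esub> h \<beta>) = fg.q (ps_var \<beta>)"
      using h(3)[OF b] fg.q.hom_add[OF vs ps.m_closed[OF va h(1)[OF b]]] fg.q.hom_mult[OF va h(1)[OF b]]
      by (simp add: fg.X_eq)
    thus "fg.q (ps_var \<beta>) = fg.q (\<lambda>m. ps_var (?s \<beta>) m + ps_conv (ps_var \<alpha>) (h \<beta>) m)"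
      by (simp add: ps_ring_simps)
  qed
  obtain r :: 'r where "of_nat 2 * r = 1" using rat[of 2] by auto
  hence r: "r + r = 1" by simp
  \<comment> \<open>The factor \<open>r\<close> is one half, because the weighted sum of the
    relations produces \<open>y_alpha\<close> twice.\<close>
  define u where "u = (\<lambda>m. \<Sum>\<beta>\<in>\<Phi>. r * of_int (?n \<beta>) * h \<beta> m)"
  have uc: "u \<in> carrier fg.P" unfolding u_def by (intro ps_sum_closed ps_scale_closed h)
  have conv: "ps_conv (ps_var \<alpha>) u m = (\<Sum>\<beta>\<in>\<Phi>. r * of_int (?n \<beta>) * ps_conv (ps_var \<alpha>) (h \<beta>) m)" for m
    by (simp add: ps_conv_var_left u_def)
  \<comment> \<open>Reindexing by the reflection in \<alpha> reverses the sign of each pairing of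
    \<alpha> with a coroot; this supplies the second copy of \<open>y_alpha\<close>.\<close>
  have neg: "(\<Sum>\<beta>\<in>\<Phi>. of_int (?n \<beta>) * ps_var (?s \<beta>) m) = - ys \<alpha> m" for m
  proof -
    have "(\<Sum>\<beta>\<in>\<Phi>. of_int (?n \<beta>) * ps_var (?s \<beta>) m) =
        (\<Sum>\<gamma>\<in>\<Phi>. of_int (?n (?s \<gamma>)) * (ps_var \<gamma> m :: 'r))"
      by (rule sum.reindex_bij_witness[of _ ?s ?s]) (auto simp: reflection_invol weyl_root[OF s])
    also have "\<dots> = (\<Sum>\<gamma>\<in>\<Phi>. - (of_int (?n \<gamma>) * ps_var \<gamma> m))"
    proof (rule sum.cong[OF refl])
      fix \<gamma> assume g: "\<gamma> \<in> \<Phi>"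
      have "\<alpha> \<bullet> coroot (?s \<gamma>) = ?s (- \<alpha>) \<bullet> ?s (coroot \<gamma>)"
        using reflection_self[OF root_nonzero[OF a]] linear_neg[OF reflection_linear, of \<alpha> \<alpha>]
        by (simp add: coroot_weyl[OF s])
      also have "\<dots> = - (\<alpha> \<bullet> coroot \<gamma>)" by (simp add: reflection_inner)
      also have "\<dots> = - of_int (?n \<gamma>)" by (simp only: of_int_floor[OF roots_int[OF g a]])
      finally have "?n (?s \<gamma>) = - ?n \<gamma>" by (metis floor_of_int of_int_minus)
      thus "of_int (?n (?s \<gamma>)) * ps_var \<gamma> m = - (of_int (?n \<gamma>) * (ps_var \<gamma> m :: 'r))" by simp
    qed
    finally show ?thesis by (simp add: ys_def sum_negf)
  qed
  have "(\<lambda>m. \<Sum>\<beta>\<in>\<Phi>. r * of_int (?n \<beta>) * ?d \<beta> m) \<in> fg.I" by (rule I_sum) (rule d)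
  moreover have "(\<Sum>\<beta>\<in>\<Phi>. r * of_int (?n \<beta>) * ?d \<beta> m) = ys \<alpha> m - ps_conv (ps_var \<alpha>) u m" for m
  proof -
    have "(\<Sum>\<beta>\<in>\<Phi>. r * of_int (?n \<beta>) * ?d \<beta> m) =
        r * (\<Sum>\<beta>\<in>\<Phi>. of_int (?n \<beta>) * ps_var \<beta> m) - r * (\<Sum>\<beta>\<in>\<Phi>. of_int (?n \<beta>) * ps_var (?s \<beta>) m)
        - ps_conv (ps_var \<alpha>) u m"
      unfolding conv sum_distrib_left sum_subtractf[symmetric] by (rule sum.cong) (auto simp: algebra_simps)
    also have "\<dots> = (r + r) * ys \<alpha> m - ps_conv (ps_var \<alpha>) u m"
      unfolding neg by (simp add: ys_def algebra_simps)
    finally show ?thesis by (simp add: r)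
  qed
  ultimately have "(\<lambda>m. ys \<alpha> m - ps_conv (ps_var \<alpha>) u m) \<in> fg.I" by simp
  hence "fg.q (ys \<alpha>) = fg.q (ps_conv (ps_var \<alpha>) u)"
    by (intro fg.q_eqI ys_closed ps_conv_closed ps_root_closed a uc)
  hence "fg.q (ys \<alpha>) = fg.X \<alpha> \<otimes>\<^bsub>fg.S\<^esub> fg.q u"
    using fg.q.hom_mult[OF ps_root_closed[OF a] uc] by (simp add: fg.X_eq ps_ring_simps)
  moreover have "fg.q u \<in> Units fg.S"
  proof -
    \<comment> \<open>Each summand is four times the squared cosine of the angle between \<alpha>
      and \<beta>, and \<beta> = \<alpha> contributes 4, so \<open>T\<close> is a positive integer
      and hence invertible.\<close>
    define T where "T = (\<Sum>\<beta>\<in>\<Phi>. ?n \<beta> * ?k \<beta>)"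
    have "real_of_int T = (\<Sum>\<beta>\<in>\<Phi>. (\<alpha> \<bullet> coroot \<beta>) * (\<beta> \<bullet> coroot \<alpha>))"
      unfolding T_def by (simp add: of_int_floor roots_int a)
    also have "\<dots> > 0"
    proof (rule sum_pos2[OF finite_roots a])
      show "0 < (\<alpha> \<bullet> coroot \<alpha>) * (\<alpha> \<bullet> coroot \<alpha>)"
        using root_nonzero[OF a] by (simp add: inner_coroot)
      fix \<beta> assume "\<beta> \<in> \<Phi>"
      have "(\<alpha> \<bullet> coroot \<beta>) * (\<beta> \<bullet> coroot \<alpha>) = 4 * (\<alpha> \<bullet> \<beta>)\<^sup>2 / ((\<beta> \<bullet> \<beta>) * (\<alpha> \<bullet> \<alpha>))"
        by (simp add: inner_coroot power2_eq_square inner_commute[of \<beta> \<alpha>])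
      thus "0 \<le> (\<alpha> \<bullet> coroot \<beta>) * (\<beta> \<bullet> coroot \<alpha>)" by simp
    qed
    finally have T: "T > 0" by simp
    obtain c :: 'r where c: "of_nat (nat T) * c = 1" using rat[of "nat T"] T by auto
    have "u {#} = r * of_int T"
      unfolding u_def T_def by (simp add: h(2) sum_distrib_left mult.assoc)
    \<comment> \<open>The constant term is \<open>T / 2\<close>, with inverse \<open>2 c\<close>
      where \<open>c\<close> inverts \<open>T\<close>.\<close>
    hence "u {#} * (2 * c) = (r + r) * (of_nat (nat T) * c)"
      using T by (simp add: algebra_simps)
    hence "u {#} * (2 * c) = 1" by (simp add: r c)
    thus ?thesis by (rule fg.q_Units[OF uc])
  qed
  ultimately show ?thesis by blast
qed

section \<open>The small torus algebra\<close>

abbreviation MM where "MM \<equiv> root_denoms F \<Phi>"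

sublocale lc: localization_setup fg.S MM
  unfolding root_denoms_def
  by (rule localization_setupI[OF fg.S.is_cring]) (auto intro: fg.X_closed RtL_root)

abbreviation K where "K \<equiv> localization fg.S MM"
abbreviation fr where "fr \<equiv> loc_frac fg.S MM"
abbreviation emb where "emb s \<equiv> fr s \<one>\<^bsub>fg.S\<^esub>"

sublocale K: cring K
  by (rule lc.loc_cring)

sublocale emb: ring_hom_cring fg.S K "\<lambda>s. emb s"
  using lc.fr_hom by (simp add: ring_hom_cring_def ring_hom_cring_axioms_def fg.S.is_cring K.is_cring)

lemma X_MM: "\<alpha> \<in> \<Phi> \<Longrightarrow> fg.X \<alpha> \<in> MM"
  unfolding root_denoms_def
  by (rule mult_closure_incl[OF fg.S.monoid_axioms fg.X_closed[OF RtL_root]]) auto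

lemma fga_act_MM:
  assumes w: "w \<in> W" and s: "s \<in> MM" shows "fga_act w s \<in> MM"
  using s unfolding root_denoms_def
proof induction
  note hom = fg.fga_act_hom[OF weyl_lattice_aut[OF w]]
  case one
  show ?case unfolding ring_hom_one[OF hom] by (rule mult_closure.one)
next
  note hom = fg.fga_act_hom[OF weyl_lattice_aut[OF w]]
  case (mult x m)
  then obtain \<alpha> where a: "\<alpha> \<in> \<Phi>" "x = fg.X \<alpha>" by blast
  have m: "m \<in> carrier fg.S" using mult.hyps lc.M_carrier by (simp add: root_denoms_def)
  have "fga_act w (x \<otimes>\<^bsub>fg.S\<^esub> m) = fg.X (w \<alpha>) \<otimes>\<^bsub>fg.S\<^esub> fga_act w m"
    using ring_hom_mult[OF hom _ m] a by (simp add: fg.X_closed RtL_root fg.fga_act_X weyl_lattice_aut w)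
  thus ?case using mult.IH weyl_root[OF w a(1)] by (auto intro: mult_closure.mult)
qed

lemma fga_act_inverse:
  assumes w: "w \<in> W" and s: "s \<in> carrier fg.S"
  shows "fga_act w (fga_act (inv_into UNIV w) s) = s" "fga_act (inv_into UNIV w) (fga_act w s) = s"
proof -
  have c: "w \<circ> inv_into UNIV w = id" "inv_into UNIV w \<circ> w = id"
    by (auto simp: fun_eq_iff weyl_inv_simps[OF w])
  note l = weyl_lattice_aut[OF w] weyl_lattice_aut[OF weyl_inv[OF w]]
  show "fga_act w (fga_act (inv_into UNIV w) s) = s"
    unfolding fg.fga_act_comp[OF l s] c by (rule fg.fga_act_id)
  show "fga_act (inv_into UNIV w) (fga_act w s) = s"
    unfolding fg.fga_act_comp[OF l(2,1) s] c by (rule fg.fga_act_id)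
qed

lemma frac_act_eq: "frac_act w = (`) (map_prod (fga_act w) (fga_act w))"
  by (rule ext) (simp add: frac_act_def)

lemma frac_act_fr:
  assumes w: "w \<in> W" and a: "a \<in> carrier fg.S" "s \<in> MM"
  shows "frac_act w (fr a s) = fr (fga_act w a) (fga_act w s)"
  unfolding frac_act_def
  by (rule lc.map_prod_fr[where \<tau> = "fga_act (inv_into UNIV w)"])
    (simp_all add: fg.fga_act_hom weyl_lattice_aut weyl_inv w fga_act_MM fga_act_inverse a)

lemma frac_act_hom: assumes w: "w \<in> W" shows "frac_act w \<in> ring_hom K K"
  unfolding frac_act_eq
  by (rule lc.map_prod_hom[where \<tau> = "fga_act (inv_into UNIV w)"])
    (simp_all add: fg.fga_act_hom weyl_lattice_aut weyl_inv w fga_act_MM fga_act_inverse)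

lemma fga_act_closed: "w \<in> W \<Longrightarrow> s \<in> carrier fg.S \<Longrightarrow> fga_act w s \<in> carrier fg.S"
  by (rule ring_hom_closed[OF fg.fga_act_hom[OF weyl_lattice_aut]])

lemma frac_act_emb:
  assumes w: "w \<in> W" and s: "s \<in> carrier fg.S"
  shows "frac_act w (emb s) = emb (fga_act w s)"
  using frac_act_fr[OF w s lc.M_one] ring_hom_one[OF fg.fga_act_hom[OF weyl_lattice_aut[OF w]]] by simp

lemma frac_act_comp:
  assumes "v \<in> W" "w \<in> W" "c \<in> carrier K"
  shows "frac_act (v \<circ> w) c = frac_act v (frac_act w c)"
proof -
  obtain a s where c: "c = fr a s" "a \<in> carrier fg.S" "s \<in> MM" by (rule lc.fr_cases[OF assms(3)])
  show ?thesis using assms(1,2) c(2,3)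
    by (simp add: c(1) frac_act_fr weyl_comp fga_act_closed fga_act_MM
        fg.fga_act_comp[OF weyl_lattice_aut weyl_lattice_aut])
qed

lemma frac_act_id: "c \<in> carrier K \<Longrightarrow> frac_act id c = c"
proof -
  have "fga_act id = (id :: ('v multiset \<Rightarrow> 'r) set \<Rightarrow> _)" by (rule ext) (simp add: fg.fga_act_id)
  thus ?thesis by (simp add: frac_act_def map_prod.id)
qed

sublocale tw: twisted_algebra K "affine_weyl_group \<Phi>" "\<lambda>(\<mu>, w). frac_act w"
proof (rule twisted_algebra.intro)
  show "cring K" by (rule K.is_cring)
  show "group (affine_weyl_group \<Phi>)" by (rule affine_weyl_group_group)
  show "twisted_algebra_axioms K (affine_weyl_group \<Phi>) (\<lambda>(\<mu>, w). frac_act w)"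
    by unfold_locales
      (auto simp: affine_weyl_group_def frac_act_hom frac_act_id frac_act_comp)
qed

lemma emb_closed: "s \<in> carrier fg.S \<Longrightarrow> emb s \<in> carrier K"
  by (rule emb.hom_closed)

lemma one_over_X_closed: "\<alpha> \<in> \<Phi> \<Longrightarrow> fr \<one>\<^bsub>fg.S\<^esub> (fg.X \<alpha>) \<in> carrier K"
  by (simp add: X_MM)

text \<open>As \<open>y_alpha\<close> is a unit of \<open>S\<close> times \<open>x_alpha\<close>,
  inverting the root classes inverts it too. The form of the inverse is what places the additive
  divided differences in \<open>D_W\<close>.\<close>

lemma Y_unit:
  assumes a: "\<alpha> \<in> \<Phi>"
  shows "emb (fg.q (ys \<alpha>)) \<in> Units K"
    "\<exists>u\<in>carrier fg.S. inv\<^bsub>K\<^esub> emb (fg.q (ys \<alpha>)) = emb u \<otimes>\<^bsub>K\<^esub> fr \<one>\<^bsub>fg.S\<^esub> (fg.X \<alpha>)"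
proof -
  obtain u where u: "u \<in> Units fg.S" "fg.q (ys \<alpha>) = fg.X \<alpha> \<otimes>\<^bsub>fg.S\<^esub> u" using ys_root[OF a] by blast
  have uc: "u \<in> carrier fg.S" "inv\<^bsub>fg.S\<^esub> u \<in> carrier fg.S" using u(1) by auto
  have Xc: "fg.X \<alpha> \<in> carrier fg.S" by (rule fg.X_closed[OF RtL_root[OF a]])
  let ?x = "emb (fg.X \<alpha>)" and ?xi = "fr \<one>\<^bsub>fg.S\<^esub> (fg.X \<alpha>)" and ?u = "emb u" and ?v = "emb (inv\<^bsub>fg.S\<^esub> u)"
  have cl: "?x \<in> carrier K" "?xi \<in> carrier K" "?u \<in> carrier K" "?v \<in> carrier K"
    using uc Xc one_over_X_closed[OF a] by (simp_all add: emb_closed)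
  have xx: "?x \<otimes>\<^bsub>K\<^esub> ?xi = \<one>\<^bsub>K\<^esub>" by (rule lc.fr_inverse[OF X_MM[OF a]])
  have uv: "?u \<otimes>\<^bsub>K\<^esub> ?v = \<one>\<^bsub>K\<^esub>"
    using emb.hom_mult[OF uc] fg.S.Units_r_inv[OF u(1)] emb.hom_one by simp
  have "emb (fg.q (ys \<alpha>)) \<otimes>\<^bsub>K\<^esub> (?v \<otimes>\<^bsub>K\<^esub> ?xi) = (?x \<otimes>\<^bsub>K\<^esub> ?xi) \<otimes>\<^bsub>K\<^esub> (?u \<otimes>\<^bsub>K\<^esub> ?v)"
    unfolding u(2) emb.hom_mult[OF Xc uc(1)] using cl by (simp add: K.m_ac)
  hence one: "emb (fg.q (ys \<alpha>)) \<otimes>\<^bsub>K\<^esub> (?v \<otimes>\<^bsub>K\<^esub> ?xi) = \<one>\<^bsub>K\<^esub>" by (simp add: xx uv)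
  have yc: "emb (fg.q (ys \<alpha>)) \<in> carrier K" by (intro emb_closed fg.q.hom_closed ys_closed)
  have vc: "?v \<otimes>\<^bsub>K\<^esub> ?xi \<in> carrier K" using cl by simp
  show "emb (fg.q (ys \<alpha>)) \<in> Units K"
    unfolding Units_def using one K.m_comm[OF yc vc] yc vc by auto
  show "\<exists>u\<in>carrier fg.S. inv\<^bsub>K\<^esub> emb (fg.q (ys \<alpha>)) = emb u \<otimes>\<^bsub>K\<^esub> ?xi"
    using K.comm_inv_char[OF yc vc one] uc by blast
qed

lemma fga_act_q_ys: "w \<in> W \<Longrightarrow> fga_act w (fg.q (ys l)) = fg.q (ys (w l))"
  by (simp add: fg.fga_act_q weyl_lattice_aut ps_act_ys)

lemma Y_act: "w \<in> W \<Longrightarrow> frac_act w (emb (fg.q (ys l))) = emb (fg.q (ys (w l)))"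
  by (simp add: frac_act_emb fg.q.hom_closed[OF ys_closed] fga_act_q_ys)

lemma const_act:
  "w \<in> W \<Longrightarrow> frac_act w (emb (fg.q (ps_const c))) = emb (fg.q (ps_const c))"
  by (simp add: frac_act_emb fg.q.hom_closed[OF ps_const_closed] fg.fga_act_q weyl_lattice_aut
      ps_act_const weyl_bij)

lemma Y_diff:
  assumes l: "l \<in> RtL" and a: "\<alpha> \<in> \<Phi>"
  shows "emb (fg.q (ys l)) \<ominus>\<^bsub>K\<^esub> emb (fg.q (ys (l - of_int k *\<^sub>R \<alpha>))) =
    emb (fg.q (ps_const (of_int k))) \<otimes>\<^bsub>K\<^esub> emb (fg.q (ys \<alpha>))"
proof -
  note c = fg.q.hom_closed[OF ys_closed] fg.q.hom_closed[OF ps_const_closed]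
  let ?a = "emb (fg.q (ys (l - of_int k *\<^sub>R \<alpha>)))" and ?b = "emb (fg.q (ps_const (of_int k))) \<otimes>\<^bsub>K\<^esub> emb (fg.q (ys \<alpha>))"
  have cl: "?a \<in> carrier K" "?b \<in> carrier K" using c by (simp_all add: emb_closed)
  have "emb (fg.q (ys l)) = ?a \<oplus>\<^bsub>K\<^esub> ?b"
    unfolding q_ys_diff[OF l a, of k] using c by (simp only: emb.hom_add emb.hom_mult fg.S.m_closed)
  hence "emb (fg.q (ys l)) \<ominus>\<^bsub>K\<^esub> ?a = ?b \<oplus>\<^bsub>K\<^esub> ?a \<oplus>\<^bsub>K\<^esub> \<ominus>\<^bsub>K\<^esub> ?a"
    using cl by (simp add: K.minus_eq K.a_comm)
  also have "\<dots> = ?b" using cl by (simp add: K.a_assoc K.r_neg)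
  finally show ?thesis .
qed

lemma const_mult: "emb (fg.q (ps_const c)) \<otimes>\<^bsub>K\<^esub> emb (fg.q (ps_const d)) = emb (fg.q (ps_const (c * d)))"
proof -
  note c = fg.q.hom_closed[OF ps_const_closed]
  have "ps_const c \<otimes>\<^bsub>fg.P\<^esub> ps_const d = ps_const (c * d)" by (simp add: ps_ring_simps ps_const_conv_const)
  thus ?thesis
    using emb.hom_mult[OF c c, of c d] fg.q.hom_mult[OF ps_const_closed ps_const_closed, of c d] by simp
qed

lemma const_one: "emb (fg.q (ps_const 1)) = \<one>\<^bsub>K\<^esub>"
  using emb.hom_one fg.q.hom_one by (simp add: ps_ring_simps)

lemma const_sum:
  assumes "finite A"
  shows "finsum K (\<lambda>a. emb (fg.q (ps_const c))) A = emb (fg.q (ps_const (of_nat (card A) * c)))"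
  using assms
proof (induction A)
  case empty
  have "ps_const 0 = \<zero>\<^bsub>fg.P\<^esub>" by (auto simp: ps_ring_simps ps_const_def)
  thus ?case using fg.q.hom_zero emb.hom_zero by simp
next
  case (insert a A)
  note cl = fg.q.hom_closed[OF ps_const_closed]
  have e: "ps_const (of_nat (card (insert a A)) * c) = ps_const c \<oplus>\<^bsub>fg.P\<^esub> ps_const (of_nat (card A) * c)"
    using insert.hyps by (auto simp: ps_ring_simps ps_const_def algebra_simps)
  have "finsum K (\<lambda>a. emb (fg.q (ps_const c))) (insert a A) =
      emb (fg.q (ps_const c)) \<oplus>\<^bsub>K\<^esub> finsum K (\<lambda>a. emb (fg.q (ps_const c))) A"
    using insert.hyps cl by (intro K.finsum_insert) (auto simp: emb_closed)
  also have "\<dots> = emb (fg.q (ps_const c) \<oplus>\<^bsub>fg.S\<^esub> fg.q (ps_const (of_nat (card A) * c)))"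
    unfolding insert.IH using cl by (intro emb.hom_add[symmetric])
  also have "fg.q (ps_const c) \<oplus>\<^bsub>fg.S\<^esub> fg.q (ps_const (of_nat (card A) * c)) =
      fg.q (ps_const (of_nat (card (insert a A)) * c))"
    unfolding e by (rule fg.q.hom_add[OF ps_const_closed ps_const_closed, symmetric])
  finally show ?case .
qed

lemma const_unit: "c * d = 1 \<Longrightarrow> emb (fg.q (ps_const c)) \<in> Units K"
proof -
  assume cd: "c * d = 1"
  have cl: "emb (fg.q (ps_const c)) \<in> carrier K" for c by (intro emb_closed fg.q.hom_closed ps_const_closed)
  have "emb (fg.q (ps_const c)) \<otimes>\<^bsub>K\<^esub> emb (fg.q (ps_const d)) = \<one>\<^bsub>K\<^esub>"
    by (simp add: const_mult cd const_one)
  moreover have "emb (fg.q (ps_const d)) \<otimes>\<^bsub>K\<^esub> emb (fg.q (ps_const c)) = \<one>\<^bsub>K\<^esub>"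
    using cd by (simp add: const_mult const_one mult.commute)
  ultimately show ?thesis unfolding Units_def using cl by auto
qed

definition kap :: 'r where "kap = (SOME r. of_nat (card W) * r = 1)"

lemma kap: "of_nat (card W) * kap = 1"
proof -
  have "card W > 0" using finite_weyl weyl_group.id[of \<Phi>] by (auto simp: card_gt_0_iff)
  from someI_ex[OF rat[OF this]] show ?thesis by (simp add: kap_def)
qed

sublocale core: demazure_core \<Phi> \<Delta> K "\<lambda>(\<mu>, w). frac_act w" frac_act "(\<lambda>s. emb s) ` carrier fg.S"
  "\<lambda>\<alpha>. emb (fg.X \<alpha>)" "\<lambda>\<alpha>. fr \<one>\<^bsub>fg.S\<^esub> (fg.X \<alpha>)" "\<lambda>l. emb (fg.q (ys l))"
  "\<lambda>\<alpha>. inv\<^bsub>K\<^esub> emb (fg.q (ys \<alpha>))" \<theta> "emb (fg.q (ps_const kap))"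
proof (intro demazure_core.intro demazure_core_axioms.intro)
  show "based_root_sys \<Phi> \<Delta>" by (rule based_root_sys_axioms)
  show "twisted_algebra K (affine_weyl_group \<Phi>) (\<lambda>(\<mu>, w). frac_act w)" by (rule tw.twisted_algebra_axioms)
  show "irreducible_root_system \<Phi>" "\<theta> \<in> \<Phi>" by (rule irreducible, rule theta)
  note qc = fg.q.hom_closed[OF ys_closed] fg.q.hom_closed[OF ps_const_closed]
  note Yc = emb_closed[OF qc(1)] and kc = emb_closed[OF qc(2)]
  have ring_hom: "ring_hom_ring fg.S K (\<lambda>s. emb s)" 
    by (rule ring_hom_ringI2[OF fg.S.ring_axioms K.ring_axioms lc.fr_hom])
  show "subring ((\<lambda>s. emb s) ` carrier fg.S) K"
    by (rule ring_hom_ring.img_is_subring[OF ring_hom fg.S.carrier_is_subring])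
  show "emb (fg.X \<alpha>) \<in> (\<lambda>s. emb s) ` carrier fg.S" if "\<alpha> \<in> \<Phi>" for \<alpha>
    using that by (intro imageI fg.X_closed RtL_root)
  show "fr \<one>\<^bsub>fg.S\<^esub> (fg.X \<alpha>) \<in> carrier K" if "\<alpha> \<in> \<Phi>" for \<alpha> using that by (rule one_over_X_closed)
  show "emb (fg.X \<alpha>) \<otimes>\<^bsub>K\<^esub> fr \<one>\<^bsub>fg.S\<^esub> (fg.X \<alpha>) = \<one>\<^bsub>K\<^esub>" if "\<alpha> \<in> \<Phi>" for \<alpha>
    by (rule lc.fr_inverse[OF X_MM[OF that]])
  show "frac_act w (fr \<one>\<^bsub>fg.S\<^esub> (fg.X \<alpha>)) = fr \<one>\<^bsub>fg.S\<^esub> (fg.X (w \<alpha>))" if "w \<in> W" "\<alpha> \<in> \<Phi>" for w \<alpha>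
    using that ring_hom_one[OF fg.fga_act_hom[OF weyl_lattice_aut]]
    by (simp add: frac_act_fr X_MM fg.fga_act_X weyl_lattice_aut)
  show "emb (fg.q (ys l)) \<in> (\<lambda>s. emb s) ` carrier fg.S" for l by (intro imageI qc)
  show "frac_act w (emb (fg.q (ys l))) = emb (fg.q (ys (w l)))" if "w \<in> W" for w l using that by (rule Y_act)
  show "inv\<^bsub>K\<^esub> emb (fg.q (ys \<alpha>)) \<in> carrier K" if "\<alpha> \<in> \<Phi>" for \<alpha>
    by (rule K.Units_inv_closed[OF Y_unit(1)[OF that]])
  show YY: "emb (fg.q (ys \<alpha>)) \<otimes>\<^bsub>K\<^esub> inv\<^bsub>K\<^esub> emb (fg.q (ys \<alpha>)) = \<one>\<^bsub>K\<^esub>" if "\<alpha> \<in> \<Phi>" for \<alpha>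
    by (rule K.Units_r_inv[OF Y_unit(1)[OF that]])
  show "frac_act w (inv\<^bsub>K\<^esub> emb (fg.q (ys \<alpha>))) = inv\<^bsub>K\<^esub> emb (fg.q (ys (w \<alpha>)))"
    if w: "w \<in> W" and a: "\<alpha> \<in> \<Phi>" for w \<alpha>
  proof (rule K.comm_inv_char[symmetric])
    note hom = frac_act_hom[OF w] and ic = K.Units_inv_closed[OF Y_unit(1)[OF a]]
    show "emb (fg.q (ys (w \<alpha>))) \<in> carrier K" by (rule Yc)
    show "frac_act w (inv\<^bsub>K\<^esub> emb (fg.q (ys \<alpha>))) \<in> carrier K" by (rule ring_hom_closed[OF hom ic])
    show "emb (fg.q (ys (w \<alpha>))) \<otimes>\<^bsub>K\<^esub> frac_act w (inv\<^bsub>K\<^esub> emb (fg.q (ys \<alpha>))) = \<one>\<^bsub>K\<^esub>"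
      unfolding Y_act[OF w, symmetric] ring_hom_mult[OF hom Yc ic, symmetric] YY[OF a] ring_hom_one[OF hom] ..
  qed
  show "\<exists>u\<in>(\<lambda>s. emb s) ` carrier fg.S. inv\<^bsub>K\<^esub> emb (fg.q (ys \<alpha>)) = u \<otimes>\<^bsub>K\<^esub> fr \<one>\<^bsub>fg.S\<^esub> (fg.X \<alpha>)"
    if "\<alpha> \<in> \<Phi>" for \<alpha>
    using Y_unit(2)[OF that] by blast
  show "\<exists>n\<in>carrier K. (\<forall>w\<in>W. frac_act w n = n) \<and>
      emb (fg.q (ys l)) \<ominus>\<^bsub>K\<^esub> emb (fg.q (ys (reflection \<alpha> l))) = n \<otimes>\<^bsub>K\<^esub> emb (fg.q (ys \<alpha>))"
    if a: "\<alpha> \<in> \<Phi>" and l: "l \<in> RtL" for \<alpha> l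
    \<comment> \<open>The invariant \<open>n\<close> is the integer pairing of \<open>l\<close> with
      the coroot of \<alpha>, embedded as a constant series.\<close>
    using Y_diff[OF l a, of "\<lfloor>l \<bullet> coroot \<alpha>\<rfloor>"] kc const_act
    unfolding reflection_floor[OF a l] by blast
  show "emb (fg.q (ys l)) \<ominus>\<^bsub>K\<^esub> emb (fg.q (ys l')) \<in> Units K"
    if l: "l \<in> RtL" "l' \<in> RtL" and a: "\<alpha> \<in> \<Phi>" and m: "m > 0" "l - l' = of_nat m *\<^sub>R \<alpha>" for l l' \<alpha> m
  proof -
    \<comment> \<open>The difference is \<open>m\<close> times \<open>y_alpha\<close>; the constant
      \<open>m\<close> is invertible in the coefficients and \<open>y_alpha\<close> in the
      localization.\<close>
    have l': "l' = l - of_int (int m) *\<^sub>R \<alpha>" using m(2) by (simp add: algebra_simps)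
    obtain r :: 'r where r: "of_nat m * r = 1" using rat[OF m(1)] by blast
    hence "of_int (int m) * r = 1" by simp
    hence "emb (fg.q (ps_const (of_int (int m)))) \<in> Units K" by (rule const_unit)
    thus ?thesis unfolding l' Y_diff[OF l(1) a] by (intro K.Units_m_closed Y_unit(1) a)
  qed
  show "emb (fg.q (ps_const kap)) \<in> (\<lambda>s. emb s) ` carrier fg.S" by (intro imageI qc)
  show "finsum K (\<lambda>w. emb (fg.q (ps_const kap))) W = \<one>\<^bsub>K\<^esub>"
    unfolding const_sum[OF finite_weyl] kap by (rule const_one)
qed (simp add: split_def)

lemma Q_Wa_eq: "Q_Wa F \<Phi> = tw.TA"
  by (simp add: Q_Wa_def Q_ring_def)

lemma S_in_Q_Wa_eq: "S_in_Q_Wa F \<Phi> = (\<lambda>c. tw.sc c) ` (\<lambda>s. emb s) ` carrier fg.S"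
  unfolding S_in_Q_Wa_def Q_ring_def Q_frac_def image_image ..

lemma demazure_elem_eq: "demazure_elem F \<Phi> \<beta> u = core.dem (fr \<one>\<^bsub>fg.S\<^esub> (fg.X \<beta>)) u"
  unfolding demazure_elem_def Q_Wa_eq Q_ring_def Q_frac_def ..

lemma D_W_eq: "D_W F \<Phi> \<Delta> = core.DW"
  unfolding D_W_def core.DW_def Q_Wa_eq S_in_Q_Wa_eq X_simple_def demazure_elem_eq ..

lemma D_Wa_eq: "D_Wa F \<Phi> \<Delta> \<theta> = core.H"
  unfolding D_Wa_def core.H_def Q_Wa_eq S_in_Q_Wa_eq X_simple_def X_affine_def demazure_elem_eq ..

lemma peterson_eq: "formal_peterson F \<Phi> \<Delta> \<theta> = core.p ` core.H"
proof -
  have "incl_transl F \<Phi> (pr_transl F \<Phi> f) = core.p f" for f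
    unfolding incl_transl_def pr_transl_def core.p_def Q_ring_def ..
  thus ?thesis unfolding formal_peterson_def D_Wa_eq image_image by simp
qed

end

theorem theorem1:
  fixes F :: "nat \<Rightarrow> nat \<Rightarrow> 'r::{comm_ring_1, ring_char_0}"
    and \<Phi> \<Delta> :: "'v::euclidean_space set"
    and \<theta> :: 'v
  assumes "formal_group_law F"
    and "irreducible_root_system \<Phi>"
    and "simple_roots \<Phi> \<Delta>"
    and "highest_root \<Phi> \<Delta> \<theta>"
    and "\<forall>\<alpha>\<in>\<Phi>. regular_elem (S_ring F \<Phi>) (S_var F \<Phi> \<alpha>)"
    and "contains_rationals TYPE('r)"
  shows "module_span (Q_Wa F \<Phi>) (S_in_Q_Wa F \<Phi>) (centre (Q_Wa F \<Phi>) (D_Wa F \<Phi> \<Delta> \<theta>))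
           = formal_peterson F \<Phi> \<Delta> \<theta>
       \<and> module_span (Q_Wa F \<Phi>) (D_W F \<Phi> \<Delta>) (centre (Q_Wa F \<Phi>) (D_Wa F \<Phi> \<Delta> \<theta>))
           = D_Wa F \<Phi> \<Delta> \<theta>"
proof -
  obtain h :: "rat \<Rightarrow> 'r" where h: "h 1 = 1" "\<And>p q. h (p + q) = h p + h q" "\<And>p q. h (p * q) = h p * h q"
    using assms(6) by (auto simp: contains_rationals_def)
  have "h 0 = 0" using h(2)[of 0 0] by simp
  \<comment> \<open>The embedding of the rationals sends natural numbers to themselves, so the image
    of \<open>1 / n\<close> inverts \<open>n\<close> among the coefficients.\<close>
  hence h_nat: "h (of_nat n) = of_nat n" for n by (induction n) (auto simp: h)
  have rat: "\<exists>r::'r. of_nat n * r = 1" if "n > 0" for n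
    using h(3)[of "of_nat n" "1 / of_nat n"] that
    by (intro exI[of _ "h (1 / of_nat n)"]) (simp add: h_nat h(1))
  interpret peterson \<Phi> \<Delta> F \<theta>
    by unfold_locales
      (use assms rat in \<open>auto simp: irreducible_root_system_def highest_root_def\<close>)
  show ?thesis
    using core.S_span_centre core.DW_span_centre
    unfolding Q_Wa_eq S_in_Q_Wa_eq D_W_eq D_Wa_eq peterson_eq core.Z_def by blast
qed

end
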